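(* For every $i\ge1$, $\mathsf{T}^i_{\mathsf{PV}}$ proves every $\forall\Sigma^b_{i-1}$-sentence of $\mathcal{L}_{\mathsf{PV}}$ that is true in $\mathbb{N}$, even when sharply bounded quantifiers are allowed to appear arbitrarily in the sentence.
   Context: $\mathcal{L}_{\mathsf{PV}}$ has constants $0,1$, equality as the only relation, and a function symbol for every polynomial-time computable $f:\mathbb{N}^k\to\mathbb{N}$, including the bit-length function $|x|$. A bounded quantifier is $\exists x\le t$ or $\forall x\le t$ ($t$ a term not containing $x$); a sharply bounded quantifier is one of the form $\exists x\le|t|$ or $\forall x\le|t|$. The strict classes $\Sigma^b_j,\Pi^b_j$: $\Sigma^b_0=\Pi^b_0$ are quantifier-free formulas; $\Sigma^b_j,\Pi^b_j$ are the smallest classes containing $\Sigma^b_{j-1}\cup\Pi^b_{j-1}$, closed under $\wedge,\vee$, $\Sigma^b_j$ under bounded $\exists$, $\Pi^b_j$ under bounded $\forall$, negation exchanging them. $\mathsf{T}^i_{\mathsf{PV}}$ is the theory of all strict $\forall\Sigma^b_{i-1}$-sentences ($\forall\vec y\,\varphi$ with $\varphi$ strict $\Sigma^b_{i-1}$) true in $\mathbb{N}$. "Sharply bounded quantifiers allowed arbitrarily" means the classes are additionally closed under sharply bounded quantification of either kind at any position, without this counting toward the level of the hierarchy. *)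

theory Defs
  imports "HOL-Library.Log_Nat" "HOL-Computational_Algebra.Polynomial"
begin

section \<open>Polynomial-time computable functions\<close>

text \<open>
  Deterministic multi-tape Turing machines with two-way infinite tapes.  A tape is its content
  together with the head position; symbol 0 is the blank.  A machine is a list whose entry \<open>q\<close> is the
  transition table of state \<open>q\<close>: it maps the list of scanned symbols to the next state and, for every
  tape, the symbol to write and the head displacement.  State 0 is initial and the state
  \<open>length M\<close> is the halting state.
\<close>

type_synonym tape = "(int \<Rightarrow> nat) \<times> int"
type_synonym machine = "(nat list \<Rightarrow> nat \<times> (nat \<times> int) list) list"

text \<open>\<open>m\<close> is the number of tapes, and the tape alphabet is \<open>{..<g}\<close>.\<close>

definition turing_machine :: "nat \<Rightarrow> nat \<Rightarrow> machine \<Rightarrow> bool" where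
  "turing_machine m g M \<longleftrightarrow>
     (\<forall>\<delta>\<in>set M. \<forall>as. length as = m \<and> set as \<subseteq> {..<g} \<longrightarrow>
        fst (\<delta> as) \<le> length M \<and>
        length (snd (\<delta> as)) = m \<and>
        set (snd (\<delta> as)) \<subseteq> {..<g} \<times> {-1, 0, 1})"

definition tm_step :: "machine \<Rightarrow> nat \<times> tape list \<Rightarrow> nat \<times> tape list" where
  "tm_step M = (\<lambda>(q, tps).
     if q < length M then
       (let (q', acts) = (M ! q) (map (\<lambda>(c, p). c p) tps)
        in (q', map2 (\<lambda>(c, p) (a, d). (c(p := a), p + d)) tps acts))
     else (q, tps))"

text \<open>
  The bit-length of \<open>n\<close> is \<open>floorlog 2 n\<close> (in particular it is 0 for \<open>n = 0\<close>).  Numbers are written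
  in binary without leading zeros, least significant bit first, starting at cell 0, with symbol 1
  for the bit 0 and symbol 2 for the bit 1.  Hence the number 0 is represented by an empty tape.
\<close>

definition binary :: "nat \<Rightarrow> int \<Rightarrow> nat" where
  "binary n = (\<lambda>i. if 0 \<le> i \<and> i < int (floorlog 2 n)
                   then (if bit n (nat i) then 2 else 1) else 0)"

text \<open>
  Tape 0 is the output tape, the inputs are on tapes \<open>1, \<dots>, length xs\<close>, and all other tapes are
  initially blank.
\<close>

definition start_tapes :: "nat \<Rightarrow> nat list \<Rightarrow> tape list" where
  "start_tapes m xs =
     map (\<lambda>n. (if n \<in> {1..length xs} then binary (xs ! (n - 1)) else (\<lambda>_. 0), 0)) [0..<m]"

definition computes_within :: "nat \<Rightarrow> machine \<Rightarrow> nat list \<Rightarrow> nat \<Rightarrow> nat \<Rightarrow> bool" where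
  "computes_within m M xs y T \<longleftrightarrow>
     (\<exists>t\<le>T. \<exists>tps. (tm_step M ^^ t) (0, start_tapes m xs) = (length M, tps) \<and>
                  fst (tps ! 0) = binary y)"

text \<open>A function \<open>\<nat>\<^sup>k \<rightarrow> \<nat>\<close> is given by its values on the lists of length \<open>k\<close>.\<close>

definition poly_time :: "nat \<Rightarrow> (nat list \<Rightarrow> nat) \<Rightarrow> bool" where
  "poly_time k f \<longleftrightarrow>
     (\<exists>m g M. \<exists>p :: nat poly. k < m \<and> 2 < g \<and> turing_machine m g M \<and>
        (\<forall>xs. length xs = k \<longrightarrow>
           computes_within m M xs (f xs) (poly p (\<Sum>x\<leftarrow>xs. floorlog 2 x))))"


section \<open>The language\<close>

text \<open>
  A function symbol is an arity together with the function it denotes.  The function is required to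
  vanish on lists of the wrong length, so that there is exactly one symbol for each function.
\<close>

definition pv_symbol :: "nat \<Rightarrow> (nat list \<Rightarrow> nat) \<Rightarrow> bool" where
  "pv_symbol k f \<longleftrightarrow> poly_time k f \<and> (\<forall>xs. length xs \<noteq> k \<longrightarrow> f xs = 0)"

text \<open>Variables are de Bruijn indices.\<close>

datatype tm =
    Var nat
  | Zero
  | One
  | Fun nat "nat list \<Rightarrow> nat" "tm list"

datatype fm =
    Eq tm tm
  | Neg fm
  | And fm fm
  | Or fm fm
  | All fm
  | Ex fm

text \<open>
  Only the terms and formulas satisfying the following predicates belong to the language.
\<close>

fun pv_tm :: "tm \<Rightarrow> bool" where
  "pv_tm (Var _) \<longleftrightarrow> True"
| "pv_tm Zero \<longleftrightarrow> True"
| "pv_tm One \<longleftrightarrow> True"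
| "pv_tm (Fun k f ts) \<longleftrightarrow> pv_symbol k f \<and> length ts = k \<and> (\<forall>t\<in>set ts. pv_tm t)"

fun pv_fm :: "fm \<Rightarrow> bool" where
  "pv_fm (Eq s t) \<longleftrightarrow> pv_tm s \<and> pv_tm t"
| "pv_fm (Neg \<phi>) \<longleftrightarrow> pv_fm \<phi>"
| "pv_fm (And \<phi> \<psi>) \<longleftrightarrow> pv_fm \<phi> \<and> pv_fm \<psi>"
| "pv_fm (Or \<phi> \<psi>) \<longleftrightarrow> pv_fm \<phi> \<and> pv_fm \<psi>"
| "pv_fm (All \<phi>) \<longleftrightarrow> pv_fm \<phi>"
| "pv_fm (Ex \<phi>) \<longleftrightarrow> pv_fm \<phi>"

text \<open>All free variables are among the first \<open>n\<close> ones.\<close>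

fun closed_tm :: "nat \<Rightarrow> tm \<Rightarrow> bool" where
  "closed_tm n (Var x) \<longleftrightarrow> x < n"
| "closed_tm n Zero \<longleftrightarrow> True"
| "closed_tm n One \<longleftrightarrow> True"
| "closed_tm n (Fun k f ts) \<longleftrightarrow> (\<forall>t\<in>set ts. closed_tm n t)"

fun closed_fm :: "nat \<Rightarrow> fm \<Rightarrow> bool" where
  "closed_fm n (Eq s t) \<longleftrightarrow> closed_tm n s \<and> closed_tm n t"
| "closed_fm n (Neg \<phi>) \<longleftrightarrow> closed_fm n \<phi>"
| "closed_fm n (And \<phi> \<psi>) \<longleftrightarrow> closed_fm n \<phi> \<and> closed_fm n \<psi>"
| "closed_fm n (Or \<phi> \<psi>) \<longleftrightarrow> closed_fm n \<phi> \<and> closed_fm n \<psi>"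
| "closed_fm n (All \<phi>) \<longleftrightarrow> closed_fm (Suc n) \<phi>"
| "closed_fm n (Ex \<phi>) \<longleftrightarrow> closed_fm (Suc n) \<phi>"

definition pv_sentence :: "fm \<Rightarrow> bool" where
  "pv_sentence \<phi> \<longleftrightarrow> pv_fm \<phi> \<and> closed_fm 0 \<phi>"


subsection \<open>Substitution\<close>

fun subst_tm :: "(nat \<Rightarrow> tm) \<Rightarrow> tm \<Rightarrow> tm" where
  "subst_tm \<sigma> (Var x) = \<sigma> x"
| "subst_tm \<sigma> Zero = Zero"
| "subst_tm \<sigma> One = One"
| "subst_tm \<sigma> (Fun k f ts) = Fun k f (map (subst_tm \<sigma>) ts)"

definition shift_tm :: "tm \<Rightarrow> tm" where
  "shift_tm = subst_tm (\<lambda>x. Var (Suc x))"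

definition under_binder :: "(nat \<Rightarrow> tm) \<Rightarrow> nat \<Rightarrow> tm" where
  "under_binder \<sigma> = case_nat (Var 0) (\<lambda>x. shift_tm (\<sigma> x))"

fun subst_fm :: "(nat \<Rightarrow> tm) \<Rightarrow> fm \<Rightarrow> fm" where
  "subst_fm \<sigma> (Eq s t) = Eq (subst_tm \<sigma> s) (subst_tm \<sigma> t)"
| "subst_fm \<sigma> (Neg \<phi>) = Neg (subst_fm \<sigma> \<phi>)"
| "subst_fm \<sigma> (And \<phi> \<psi>) = And (subst_fm \<sigma> \<phi>) (subst_fm \<sigma> \<psi>)"
| "subst_fm \<sigma> (Or \<phi> \<psi>) = Or (subst_fm \<sigma> \<phi>) (subst_fm \<sigma> \<psi>)"
| "subst_fm \<sigma> (All \<phi>) = All (subst_fm (under_binder \<sigma>) \<phi>)"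
| "subst_fm \<sigma> (Ex \<phi>) = Ex (subst_fm (under_binder \<sigma>) \<phi>)"

definition shift_fm :: "fm \<Rightarrow> fm" where
  "shift_fm = subst_fm (\<lambda>x. Var (Suc x))"

text \<open>Substitution of \<open>t\<close> for variable 0, which disappears.\<close>

definition inst_fm :: "tm \<Rightarrow> fm \<Rightarrow> fm" where
  "inst_fm t = subst_fm (case_nat t Var)"


subsection \<open>Truth in the standard model\<close>

fun eval_tm :: "(nat \<Rightarrow> nat) \<Rightarrow> tm \<Rightarrow> nat" where
  "eval_tm e (Var x) = e x"
| "eval_tm e Zero = 0"
| "eval_tm e One = 1"
| "eval_tm e (Fun k f ts) = f (map (eval_tm e) ts)"

fun sat :: "(nat \<Rightarrow> nat) \<Rightarrow> fm \<Rightarrow> bool" where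
  "sat e (Eq s t) \<longleftrightarrow> eval_tm e s = eval_tm e t"
| "sat e (Neg \<phi>) \<longleftrightarrow> \<not> sat e \<phi>"
| "sat e (And \<phi> \<psi>) \<longleftrightarrow> sat e \<phi> \<and> sat e \<psi>"
| "sat e (Or \<phi> \<psi>) \<longleftrightarrow> sat e \<phi> \<or> sat e \<psi>"
| "sat e (All \<phi>) \<longleftrightarrow> (\<forall>a. sat (case_nat a e) \<phi>)"
| "sat e (Ex \<phi>) \<longleftrightarrow> (\<exists>a. sat (case_nat a e) \<phi>)"

definition true_in_nat :: "fm \<Rightarrow> bool" where
  "true_in_nat \<phi> \<longleftrightarrow> (\<forall>e. sat e \<phi>)"


subsection \<open>Provability\<close>

text \<open>
  Natural deduction for classical first-order logic with equality.  All formulas in a derivation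
  belong to the language when those in \<open>\<Gamma>\<close> do.  The eigenvariable conditions are expressed by
  shifting the context.
\<close>

inductive proves :: "fm set \<Rightarrow> fm \<Rightarrow> bool" (infix "\<turnstile>" 50) where
  Assm: "\<phi> \<in> \<Gamma> \<Longrightarrow> \<Gamma> \<turnstile> \<phi>"
| AndI: "\<Gamma> \<turnstile> \<phi> \<Longrightarrow> \<Gamma> \<turnstile> \<psi> \<Longrightarrow> \<Gamma> \<turnstile> And \<phi> \<psi>"
| AndE1: "\<Gamma> \<turnstile> And \<phi> \<psi> \<Longrightarrow> \<Gamma> \<turnstile> \<phi>"
| AndE2: "\<Gamma> \<turnstile> And \<phi> \<psi> \<Longrightarrow> \<Gamma> \<turnstile> \<psi>"
| OrI1: "\<Gamma> \<turnstile> \<phi> \<Longrightarrow> pv_fm \<psi> \<Longrightarrow> \<Gamma> \<turnstile> Or \<phi> \<psi>"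
| OrI2: "\<Gamma> \<turnstile> \<psi> \<Longrightarrow> pv_fm \<phi> \<Longrightarrow> \<Gamma> \<turnstile> Or \<phi> \<psi>"
| OrE: "\<Gamma> \<turnstile> Or \<phi> \<psi> \<Longrightarrow> insert \<phi> \<Gamma> \<turnstile> \<chi> \<Longrightarrow> insert \<psi> \<Gamma> \<turnstile> \<chi> \<Longrightarrow> \<Gamma> \<turnstile> \<chi>"
| NegI: "pv_fm \<phi> \<Longrightarrow> insert \<phi> \<Gamma> \<turnstile> \<psi> \<Longrightarrow> insert \<phi> \<Gamma> \<turnstile> Neg \<psi> \<Longrightarrow> \<Gamma> \<turnstile> Neg \<phi>"
| Contr: "pv_fm \<phi> \<Longrightarrow> insert (Neg \<phi>) \<Gamma> \<turnstile> \<psi> \<Longrightarrow> insert (Neg \<phi>) \<Gamma> \<turnstile> Neg \<psi> \<Longrightarrow> \<Gamma> \<turnstile> \<phi>"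
| AllI: "shift_fm ` \<Gamma> \<turnstile> \<phi> \<Longrightarrow> \<Gamma> \<turnstile> All \<phi>"
| AllE: "\<Gamma> \<turnstile> All \<phi> \<Longrightarrow> pv_tm t \<Longrightarrow> \<Gamma> \<turnstile> inst_fm t \<phi>"
| ExI: "\<Gamma> \<turnstile> inst_fm t \<phi> \<Longrightarrow> pv_tm t \<Longrightarrow> \<Gamma> \<turnstile> Ex \<phi>"
| ExE: "\<Gamma> \<turnstile> Ex \<phi> \<Longrightarrow> insert \<phi> (shift_fm ` \<Gamma>) \<turnstile> shift_fm \<chi> \<Longrightarrow> \<Gamma> \<turnstile> \<chi>"
| EqI: "pv_tm t \<Longrightarrow> \<Gamma> \<turnstile> Eq t t"
| EqE: "\<Gamma> \<turnstile> Eq s t \<Longrightarrow> \<Gamma> \<turnstile> inst_fm s \<phi> \<Longrightarrow> \<Gamma> \<turnstile> inst_fm t \<phi>"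


section \<open>Bounded formulas\<close>

definition len_tm :: "tm \<Rightarrow> tm" where
  "len_tm t = Fun 1 (\<lambda>xs. if length xs = 1 then floorlog 2 (xs ! 0) else 0) [t]"

text \<open>
  Equality is the only relation symbol, so \<open>s \<le> t\<close> is expressed by means of the function symbol for
  the characteristic function of the ordering.
\<close>

definition Le :: "tm \<Rightarrow> tm \<Rightarrow> fm" where
  "Le s t = Eq (Fun 2 (\<lambda>xs. if length xs = 2 \<and> xs ! 0 \<le> xs ! 1 then 1 else 0) [s, t]) One"

text \<open>The shift ensures that the bound does not contain the quantified variable.\<close>

definition BEx :: "tm \<Rightarrow> fm \<Rightarrow> fm" where
  "BEx t \<phi> = Ex (And (Le (Var 0) (shift_tm t)) \<phi>)"

definition BAll :: "tm \<Rightarrow> fm \<Rightarrow> fm" where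
  "BAll t \<phi> = All (Or (Neg (Le (Var 0) (shift_tm t))) \<phi>)"

fun quantifier_free :: "fm \<Rightarrow> bool" where
  "quantifier_free (Eq s t) \<longleftrightarrow> True"
| "quantifier_free (Neg \<phi>) \<longleftrightarrow> quantifier_free \<phi>"
| "quantifier_free (And \<phi> \<psi>) \<longleftrightarrow> quantifier_free \<phi> \<and> quantifier_free \<psi>"
| "quantifier_free (Or \<phi> \<psi>) \<longleftrightarrow> quantifier_free \<phi> \<and> quantifier_free \<psi>"
| "quantifier_free (All \<phi>) \<longleftrightarrow> False"
| "quantifier_free (Ex \<phi>) \<longleftrightarrow> False"

text \<open>
  The strict classes; since the bounds of \<open>BEx\<close> and \<open>BAll\<close> are arbitrary terms, sharply bounded
  quantifiers count towards the level here.
\<close>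

inductive sigma_b :: "nat \<Rightarrow> fm \<Rightarrow> bool" and pi_b :: "nat \<Rightarrow> fm \<Rightarrow> bool" where
  "quantifier_free \<phi> \<Longrightarrow> sigma_b 0 \<phi>"
| "quantifier_free \<phi> \<Longrightarrow> pi_b 0 \<phi>"
| "sigma_b j \<phi> \<Longrightarrow> sigma_b (Suc j) \<phi>"
| "pi_b j \<phi> \<Longrightarrow> sigma_b (Suc j) \<phi>"
| "sigma_b j \<phi> \<Longrightarrow> pi_b (Suc j) \<phi>"
| "pi_b j \<phi> \<Longrightarrow> pi_b (Suc j) \<phi>"
| "sigma_b j \<phi> \<Longrightarrow> sigma_b j \<psi> \<Longrightarrow> sigma_b j (And \<phi> \<psi>)"
| "sigma_b j \<phi> \<Longrightarrow> sigma_b j \<psi> \<Longrightarrow> sigma_b j (Or \<phi> \<psi>)"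
| "pi_b j \<phi> \<Longrightarrow> pi_b j \<psi> \<Longrightarrow> pi_b j (And \<phi> \<psi>)"
| "pi_b j \<phi> \<Longrightarrow> pi_b j \<psi> \<Longrightarrow> pi_b j (Or \<phi> \<psi>)"
| "pi_b j \<phi> \<Longrightarrow> sigma_b j (Neg \<phi>)"
| "sigma_b j \<phi> \<Longrightarrow> pi_b j (Neg \<phi>)"
| "sigma_b (Suc j) \<phi> \<Longrightarrow> sigma_b (Suc j) (BEx t \<phi>)"
| "pi_b (Suc j) \<phi> \<Longrightarrow> pi_b (Suc j) (BAll t \<phi>)"

text \<open>
  The same classes with sharply bounded quantifiers allowed arbitrarily: the last four rules apply
  at every level, including level 0.
\<close>

inductive sigma_b_sh :: "nat \<Rightarrow> fm \<Rightarrow> bool" and pi_b_sh :: "nat \<Rightarrow> fm \<Rightarrow> bool" where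
  "quantifier_free \<phi> \<Longrightarrow> sigma_b_sh 0 \<phi>"
| "quantifier_free \<phi> \<Longrightarrow> pi_b_sh 0 \<phi>"
| "sigma_b_sh j \<phi> \<Longrightarrow> sigma_b_sh (Suc j) \<phi>"
| "pi_b_sh j \<phi> \<Longrightarrow> sigma_b_sh (Suc j) \<phi>"
| "sigma_b_sh j \<phi> \<Longrightarrow> pi_b_sh (Suc j) \<phi>"
| "pi_b_sh j \<phi> \<Longrightarrow> pi_b_sh (Suc j) \<phi>"
| "sigma_b_sh j \<phi> \<Longrightarrow> sigma_b_sh j \<psi> \<Longrightarrow> sigma_b_sh j (And \<phi> \<psi>)"
| "sigma_b_sh j \<phi> \<Longrightarrow> sigma_b_sh j \<psi> \<Longrightarrow> sigma_b_sh j (Or \<phi> \<psi>)"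
| "pi_b_sh j \<phi> \<Longrightarrow> pi_b_sh j \<psi> \<Longrightarrow> pi_b_sh j (And \<phi> \<psi>)"
| "pi_b_sh j \<phi> \<Longrightarrow> pi_b_sh j \<psi> \<Longrightarrow> pi_b_sh j (Or \<phi> \<psi>)"
| "pi_b_sh j \<phi> \<Longrightarrow> sigma_b_sh j (Neg \<phi>)"
| "sigma_b_sh j \<phi> \<Longrightarrow> pi_b_sh j (Neg \<phi>)"
| "sigma_b_sh (Suc j) \<phi> \<Longrightarrow> sigma_b_sh (Suc j) (BEx t \<phi>)"
| "pi_b_sh (Suc j) \<phi> \<Longrightarrow> pi_b_sh (Suc j) (BAll t \<phi>)"
| "sigma_b_sh j \<phi> \<Longrightarrow> sigma_b_sh j (BEx (len_tm t) \<phi>)"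
| "sigma_b_sh j \<phi> \<Longrightarrow> sigma_b_sh j (BAll (len_tm t) \<phi>)"
| "pi_b_sh j \<phi> \<Longrightarrow> pi_b_sh j (BEx (len_tm t) \<phi>)"
| "pi_b_sh j \<phi> \<Longrightarrow> pi_b_sh j (BAll (len_tm t) \<phi>)"

definition forall_sentence :: "(fm \<Rightarrow> bool) \<Rightarrow> fm \<Rightarrow> bool" where
  "forall_sentence C \<phi> \<longleftrightarrow> pv_sentence \<phi> \<and> (\<exists>n \<psi>. C \<psi> \<and> \<phi> = (All ^^ n) \<psi>)"

definition T_PV :: "nat \<Rightarrow> fm set" where
  "T_PV i = {\<phi>. forall_sentence (sigma_b (i - 1)) \<phi> \<and> true_in_nat \<phi>}"

end

theory Submission
  imports Defs "HOL-Library.Nat_Bijection"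
begin

text \<open>
  By induction on the formula, every formula of level \<open>j\<close> with sharply bounded quantifiers is given
  a strict form of the same level and the same truth value.  The theory whose axioms are the true
  strict sentences \<open>\<forall>\<Sigma>\<^sub>j\<close> proves that the strict form of a \<open>\<Sigma>\<^sub>j\<close>-formula implies the formula (and
  dually for \<open>\<Pi>\<^sub>j\<close>); this suffices, because the strict form of a true sentence is an axiom.  The
  theory one level up proves the equivalence, as is needed for the subformulas of lower level.

  At level 0 a sharply bounded quantifier is eliminated by a function symbol that searches for a
  witness.  At level \<open>j + 1\<close> the problem is \<open>\<forall>y\<le>|t|. \<exists>z\<le>s. \<psi>(y, z)\<close>, which is replaced by
  \<open>\<exists>w. \<forall>y\<le>|t|. \<psi>(y, (w)\<^sub>y)\<close>.  That the latter implies the former follows from a true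
  \<open>\<forall>\<Sigma>\<^sub>j\<^sub>+\<^sub>1\<close>-sentence by moving the quantifier over \<open>w\<close> to the front.  The converse, an instance
  of collection, is itself a true \<open>\<forall>\<Sigma>\<^sub>j\<^sub>+\<^sub>2\<close>-sentence and hence an axiom one level up.

  The function symbols are obtained from programs whose registers are stacks: a stack is a tape, and
  a tape is a pair of stacks, so polynomial-time programs and Turing machines compute the same
  functions, while composition and iteration are easy for programs.
\<close>


section \<open>Binary strings\<close>

text \<open>Every true sentence of the right complexity is an axiom, so no arithmetic is carried out
  inside the theories. Pairing, sequence coding and collection are established only as facts about
  truth in the standard model; for an implication between two formulas it then remains to count the
  quantifiers of its universal closure. The derivations proper are short: monotonicity of the
  connectives and quantifiers, and the prenexing of one implication. The labour is in the function
  symbols. Bounds and witnesses have to be terms, and a symbol is available only for a function with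
  a Turing machine behind it, so closure under composition, bounded iteration and sequence decoding
  must be derived from the machine model. Only the ordering and the length get no machine of their
  own: a bounded quantifier contains the symbol of the ordering and a sharp one also that of the
  length, so a formula that belongs to the language already certifies that both are computable in
  polynomial time. They are therefore assumptions in the contexts below, discharged from
  \<open>pv_fm\<close>.\<close>

primrec val :: "nat list \<Rightarrow> nat" where
  "val [] = 0"
| "val (x # xs) = (if x = 2 then 2 ^ length xs else 0) + val xs"

text \<open>The leading bit comes first: read as a stack with its top at the head of the list, this
  puts the least significant bit on cell 0 and makes the tape content equal to
  \<open>binary n\<close>.\<close>

definition rep :: "nat \<Rightarrow> nat list" where
  "rep n = rev (map (\<lambda>i. if bit n i then 2 else 1) [0..<floorlog 2 n])"

definition is_rep :: "nat list \<Rightarrow> bool" where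
  "is_rep xs \<longleftrightarrow> set xs \<subseteq> {1, 2} \<and> (xs \<noteq> [] \<longrightarrow> hd xs = 2)"

lemma val_append: "val (xs @ ys) = val xs * 2 ^ length ys + val ys"
  by (induction xs) (auto simp: algebra_simps power_add)

lemma val_less: "val xs < 2 ^ length xs"
  by (induction xs) auto

lemma floorlog_half: "n > 0 \<Longrightarrow> floorlog 2 n = Suc (floorlog 2 (n div 2))"
  by (subst compute_floorlog) auto

lemma rep_0 [simp]: "rep 0 = []"
  by (simp add: rep_def floorlog_def)

lemma rep_rec: "n > 0 \<Longrightarrow> rep n = rep (n div 2) @ [if odd n then 2 else 1]"
  by (simp add: rep_def floorlog_half upt_conv_Cons map_Suc_upt[symmetric] bit_Suc bit_0 comp_def
      del: upt_Suc)

lemma length_rep [simp]: "length (rep n) = floorlog 2 n"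
  by (simp add: rep_def)

lemma val_rep [simp]: "val (rep n) = n"
proof (induction n rule: less_induct)
  case (less n)
  show ?case
  proof (cases "n = 0")
    case False
    then show ?thesis using less[of "n div 2"]
      by (subst rep_rec) (auto simp: val_append elim: oddE)
  qed auto
qed

lemma set_rep: "set (rep n) \<subseteq> {1, 2}"
  by (auto simp: rep_def)

lemma is_rep_rep [simp]: "is_rep (rep n)"
proof -
  have "rep n \<noteq> [] \<longrightarrow> hd (rep n) = 2"
  proof (induction n rule: less_induct)
    case (less n)
    show ?case
    proof (cases "n \<le> 1")
      case True
      then have "n = 0 \<or> n = 1" by auto
      then show ?thesis by (auto simp: rep_rec)
    next
      case False
      then have "rep (n div 2) \<noteq> []"
        using val_rep[of "n div 2"] by (metis False One_nat_def div_eq_0_iff less_2_cases_iff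
            not_le numeral_2_eq_2 val.simps(1) zero_neq_numeral less_Suc_eq_le)
      then show ?thesis using less[of "n div 2"] False by (subst (2) rep_rec) auto
    qed
  qed
  then show ?thesis using set_rep by (simp add: is_rep_def)
qed

lemma val_ge: "xs \<noteq> [] \<Longrightarrow> hd xs = 2 \<Longrightarrow> 2 ^ (length xs - 1) \<le> val xs"
  by (cases xs) auto

lemma val_inj:
  assumes "set xs \<subseteq> {1, 2}" "set ys \<subseteq> {1, 2}" "length xs = length ys" "val xs = val ys"
  shows "xs = ys"
  using assms(3,1,2,4)
proof (induction xs ys rule: list_induct2)
  case (Cons x xs y ys)
  then show ?case using val_less[of xs] val_less[of ys] by (auto split: if_splits)
qed auto

lemma length_is_rep: "is_rep xs \<Longrightarrow> floorlog 2 (val xs) = length xs"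
proof (cases "xs = []")
  case True then show ?thesis by (simp add: floorlog_def)
next
  case False
  assume "is_rep xs"
  then have "2 ^ (length xs - 1) \<le> val xs" using val_ge False by (auto simp: is_rep_def)
  moreover have "val xs < 2 ^ length xs" by (rule val_less)
  ultimately show ?thesis using False
    by (intro antisym floorlog_leI floorlog_geI) auto
qed

lemma rep_val: "is_rep xs \<Longrightarrow> rep (val xs) = xs"
  using val_inj[of "rep (val xs)" xs] set_rep by (auto simp: length_is_rep is_rep_def)

lemma rep_unique: "is_rep xs \<Longrightarrow> val xs = n \<Longrightarrow> rep n = xs"
  using rep_val by blast

lemma rep_eq_Nil [simp]: "rep n = [] \<longleftrightarrow> n = 0"
  by (metis rep_0 val_rep)

text \<open>The leading symbol of the joint string is that of \<open>rep a\<close>, or of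
  \<open>rep b\<close> if \<open>a = 0\<close>, so the joint string is again free of leading
  zeros.\<close>

lemma rep_cat: "rep (a * 2 ^ floorlog 2 b + b) = rep a @ rep b"
proof (rule rep_unique)
  show "is_rep (rep a @ rep b)"
    using is_rep_rep[of a] is_rep_rep[of b] by (auto simp: is_rep_def hd_append split: if_splits)
qed (simp add: val_append)

lemma rep_div: "rep (n div 2 ^ k) = take (floorlog 2 n - k) (rep n)"
proof (cases "k \<le> floorlog 2 n")
  case True
  let ?a = "take (floorlog 2 n - k) (rep n)" and ?b = "drop (floorlog 2 n - k) (rep n)"
  have "n = val ?a * 2 ^ length ?b + val ?b"
    using val_append[of ?a ?b] by simp
  moreover have "length ?b = k" using True by simp
  ultimately have "val ?a = n div 2 ^ k" using val_less[of ?b]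
    by (metis add.right_neutral div_less div_mult_self3 power_not_zero zero_neq_numeral)
  moreover have "is_rep ?a" using is_rep_rep[of n] set_take_subset[of _ "rep n"]
    by (auto simp: is_rep_def)
  ultimately show ?thesis by (rule rep_unique[rotated])
next
  case False
  then have "n < 2 ^ k"
    using val_less[of "rep n"] power_increasing[of "floorlog 2 n" k "2::nat"] by (simp del: power_increasing_iff)
  then show ?thesis using False by simp
qed

lemma is_rep_dropWhile: "set xs \<subseteq> {1, 2} \<Longrightarrow> is_rep (dropWhile (\<lambda>x. x = 1) xs)"
  by (induction xs) (auto simp: is_rep_def)

lemma val_dropWhile: "val (dropWhile (\<lambda>x. x = 1) xs) = val xs"
  by (induction xs) auto

text \<open>Cutting leading bits may expose zeros, which are written as symbol 1; they can be
  removed without changing the value.\<close>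

lemma rep_mod: "rep (n mod 2 ^ (floorlog 2 n - k)) = dropWhile (\<lambda>x. x = 1) (drop k (rep n))"
proof (rule rep_unique)
  show "is_rep (dropWhile (\<lambda>x. x = 1) (drop k (rep n)))"
    using set_rep[of n] set_drop_subset[of k "rep n"] by (intro is_rep_dropWhile) auto
  have "n = val (take k (rep n)) * 2 ^ length (drop k (rep n)) + val (drop k (rep n))"
    by (metis append_take_drop_id val_append val_rep)
  then show "val (dropWhile (\<lambda>x. x = 1) (drop k (rep n))) = n mod 2 ^ (floorlog 2 n - k)"
    using val_less[of "drop k (rep n)"]
    by (metis length_drop length_rep mod_less mod_mult_self3 val_dropWhile)
qed


section \<open>Stack programs\<close>

type_synonym store = "nat \<Rightarrow> nat list"

datatype com =
    Skip
  | Push nat "(nat \<Rightarrow> nat) \<Rightarrow> nat"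
  | Pop nat
  | Seq com com (infixr ";;" 60)
  | Cond "(nat \<Rightarrow> nat) \<Rightarrow> bool" com com
  | While "(nat \<Rightarrow> nat) \<Rightarrow> bool" com

text \<open>The value 0 for the empty stack is the blank that the head sees on cell -1, so a command
  and its machine code branch on the same information.\<close>

definition topsym :: "nat list \<Rightarrow> nat" where
  "topsym xs = (case xs of [] \<Rightarrow> 0 | x # _ \<Rightarrow> x)"

lemma topsym_simps [simp]: "topsym [] = 0" "topsym (x # xs) = x"
  by (auto simp: topsym_def)

definition tops :: "store \<Rightarrow> nat \<Rightarrow> nat" where
  "tops s r = topsym (s r)"

text \<open>
  The time is the exact number of steps of the compiled command.  To push a symbol, the head first
  moves to the blank cell above the stack, so the symbol cannot depend on the top of that stack.
\<close>

inductive exec :: "com \<Rightarrow> store \<Rightarrow> nat \<Rightarrow> store \<Rightarrow> bool" where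
  "exec Skip s 0 s"
| "exec (Push r f) s 2 (s(r := f ((tops s)(r := 0)) # s r))"
| "exec (Pop r) s 1 (s(r := tl (s r)))"
| "exec c s t s' \<Longrightarrow> exec d s' t' s'' \<Longrightarrow> exec (c ;; d) s (t + t') s''"
| "b (tops s) \<Longrightarrow> exec c s t s' \<Longrightarrow> exec (Cond b c d) s (t + 2) s'"
| "\<not> b (tops s) \<Longrightarrow> exec d s t s' \<Longrightarrow> exec (Cond b c d) s (t + 1) s'"
| "\<not> b (tops s) \<Longrightarrow> exec (While b c) s 1 s"
| "b (tops s) \<Longrightarrow> exec c s t s' \<Longrightarrow> exec (While b c) s' t' s'' \<Longrightarrow>
     exec (While b c) s (t + t' + 2) s''"

text \<open>A pushed 0 would be indistinguishable from the end of the stack. The bound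
  \<open>g\<close> is demanded for every argument because \<open>turing_machine\<close> also covers
  symbol lists that never occur.\<close>

fun wf_com :: "nat \<Rightarrow> nat \<Rightarrow> com \<Rightarrow> bool" where
  "wf_com m g Skip \<longleftrightarrow> True"
| "wf_com m g (Push r f) \<longleftrightarrow> r < m \<and> (\<forall>\<sigma>. 0 < f \<sigma> \<and> f \<sigma> < g)"
| "wf_com m g (Pop r) \<longleftrightarrow> r < m"
| "wf_com m g (c ;; d) \<longleftrightarrow> wf_com m g c \<and> wf_com m g d"
| "wf_com m g (Cond b c d) \<longleftrightarrow> wf_com m g c \<and> wf_com m g d"
| "wf_com m g (While b c) \<longleftrightarrow> wf_com m g c"

lemma wf_com_mono: "wf_com m g c \<Longrightarrow> m \<le> m' \<Longrightarrow> g \<le> g' \<Longrightarrow> wf_com m' g' c"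
proof (induction c)
  case (Push r f)
  then show ?case by simp (meson less_le_trans)
qed simp_all

text \<open>One unit of time adds at most one symbol to a stack. Output lengths and leftover stacks
  are later estimated by running times through this fact.\<close>

lemma exec_length: "exec c s t s' \<Longrightarrow> length (s' r) \<le> length (s r) + t"
  by (induction rule: exec.induct) auto


subsection \<open>Compilation to Turing machines\<close>

text \<open>Guards are functions on all registers, whereas a machine sees \<open>m\<close> symbols;
  the registers from \<open>m\<close> on are empty and read as 0, which is the default here.\<close>

definition nthd :: "nat list \<Rightarrow> nat \<Rightarrow> nat" where
  "nthd as i = (if i < length as then as ! i else 0)"

definition upd :: "nat \<Rightarrow> nat \<Rightarrow> nat \<Rightarrow> int \<Rightarrow> nat list \<Rightarrow> (nat \<times> int) list" where
  "upd m r x d as = map (\<lambda>i. if i = r then (x, d) else (as ! i, 0)) [0..<m]"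

definition stay :: "nat \<Rightarrow> nat list \<Rightarrow> (nat \<times> int) list" where
  "stay m as = map (\<lambda>i. (as ! i, 0)) [0..<m]"

fun clen :: "com \<Rightarrow> nat" where
  "clen Skip = 0"
| "clen (Push r f) = 2"
| "clen (Pop r) = 1"
| "clen (c ;; d) = clen c + clen d"
| "clen (Cond b c d) = clen c + clen d + 2"
| "clen (While b c) = clen c + 2"

text \<open>The block for a command placed at state \<open>k\<close> is left by entering state \<open>k + clen c\<close>.\<close>

fun code :: "nat \<Rightarrow> nat \<Rightarrow> com \<Rightarrow> machine" where
  "code m k Skip = []"
| "code m k (Push r f) =
     [\<lambda>as. (k + 1, upd m r (as ! r) 1 as), \<lambda>as. (k + 2, upd m r (f (nthd as)) 0 as)]"
| "code m k (Pop r) = [\<lambda>as. (k + 1, upd m r 0 (if as ! r = 0 then 0 else -1) as)]"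
| "code m k (c ;; d) = code m k c @ code m (k + clen c) d"
| "code m k (Cond b c d) =
     [\<lambda>as. (if b (nthd as) then k + 1 else k + clen c + 2, stay m as)] @ code m (k + 1) c @
     [\<lambda>as. (k + clen c + clen d + 2, stay m as)] @ code m (k + clen c + 2) d"
| "code m k (While b c) =
     [\<lambda>as. (if b (nthd as) then k + 1 else k + clen c + 2, stay m as)] @ code m (k + 1) c @
     [\<lambda>as. (k, stay m as)]"

lemma length_code [simp]: "length (code m k c) = clen c"
  by (induction c arbitrary: k) auto

text \<open>The bottom of a stack is at cell 0 and the head is on its top, so it rests on cell \<open>-1\<close> when
  the stack is empty.\<close>

definition tape_of :: "nat list \<Rightarrow> tape" where
  "tape_of xs = (\<lambda>i. if 0 \<le> i \<and> i < int (length xs) then rev xs ! nat i else 0, int (length xs) - 1)"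

definition tapes_of :: "nat \<Rightarrow> store \<Rightarrow> tape list" where
  "tapes_of m s = map (\<lambda>r. tape_of (s r)) [0..<m]"

definition good_store :: "nat \<Rightarrow> store \<Rightarrow> bool" where
  "good_store m s \<longleftrightarrow> (\<forall>r. 0 \<notin> set (s r)) \<and> (\<forall>r\<ge>m. s r = [])"

lemma scan_tape_of: "(case tape_of xs of (c, p) \<Rightarrow> c p) = topsym xs"
  by (cases xs) (auto simp: tape_of_def nth_append)

lemma scan_tapes_of: "map (\<lambda>(c, p). c p) (tapes_of m s) = map (tops s) [0..<m]"
  using scan_tape_of by (auto simp: tapes_of_def tops_def)

lemma nthd_scan: "good_store m s \<Longrightarrow> nthd (map (tops s) [0..<m]) = tops s"
  by (auto simp: nthd_def good_store_def tops_def fun_eq_iff)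

lemma exec_good: "exec c s t s' \<Longrightarrow> wf_com m g c \<Longrightarrow> good_store m s \<Longrightarrow> good_store m s'"
proof (induction rule: exec.induct)
  case (3 r s)
  have "set (tl (s r)) \<subseteq> set (s r)" by (cases "s r") auto
  with 3 show ?case by (auto simp: good_store_def)
next
  case (2 r f s)
  then show ?case by (fastforce simp: good_store_def)
qed auto

lemma tm_step_stay:
  assumes "q < length M" "(M ! q) (map (tops s) [0..<m]) = (q', stay m (map (tops s) [0..<m]))"
  shows "tm_step M (q, tapes_of m s) = (q', tapes_of m s)"
proof -
  have "map2 (\<lambda>(c, p) (a, d). (c(p := a), p + d)) (tapes_of m s) (stay m (map (tops s) [0..<m]))
      = tapes_of m s"
  proof (intro nth_equalityI)
    fix i
    assume "i < length (map2 (\<lambda>(c, p) (a, d). (c(p := a), p + d)) (tapes_of m s) (stay m (map (tops s) [0..<m])))"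
    then have i: "i < m" by (simp add: tapes_of_def stay_def)
    obtain c p where cp: "tape_of (s i) = (c, p)" by fastforce
    then have "c p = tops s i" using scan_tape_of[of "s i"] by (simp add: tops_def)
    then have "c(p := tops s i) = c" by auto
    with i cp show "map2 (\<lambda>(c, p) (a, d). (c(p := a), p + d)) (tapes_of m s) (stay m (map (tops s) [0..<m])) ! i
      = tapes_of m s ! i"
      by (simp add: tapes_of_def stay_def)
  qed (simp add: tapes_of_def stay_def)
  then show ?thesis using assms by (simp add: tm_step_def scan_tapes_of)
qed

lemma tm_step_upd:
  assumes "q < length M" "map (\<lambda>(c, p). c p) tps = as" "length tps = m" "r < m"
    and "(M ! q) as = (q', upd m r x d as)" "tps ! r = (c, p)"
  shows "tm_step M (q, tps) = (q', tps[r := (c(p := x), p + d)])"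
proof -
  have "map2 (\<lambda>(c, p) (a, d). (c(p := a), p + d)) tps (upd m r x d as) = tps[r := (c(p := x), p + d)]"
    using assms(2,3,4,6)
    by (intro nth_equalityI) (auto simp: upd_def nth_list_update split: prod.splits)
  then show ?thesis using assms by (simp add: tm_step_def)
qed

lemma tapes_of_upd: "r < m \<Longrightarrow> (tapes_of m s)[r := tape_of xs] = tapes_of m (s(r := xs))"
  by (intro nth_equalityI) (auto simp: tapes_of_def nth_list_update)

definition code_at :: "machine \<Rightarrow> nat \<Rightarrow> machine \<Rightarrow> bool" where
  "code_at M k cs \<longleftrightarrow> k + length cs \<le> length M \<and> (\<forall>i<length cs. M ! (k + i) = cs ! i)"

lemma code_at_append:
  "code_at M k (cs @ ds) \<longleftrightarrow> code_at M k cs \<and> code_at M (k + length cs) ds"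
proof -
  have "(\<forall>i<length cs + length ds. M ! (k + i) = (cs @ ds) ! i) \<longleftrightarrow>
      (\<forall>i<length cs. M ! (k + i) = cs ! i) \<and> (\<forall>i<length ds. M ! (k + length cs + i) = ds ! i)"
    (is "?L \<longleftrightarrow> ?R")
  proof
    assume L: ?L
    have "M ! (k + length cs + i) = ds ! i" if "i < length ds" for i
      using L[rule_format, of "length cs + i"] that by (simp add: add.assoc)
    then show ?R using L by (auto simp: nth_append)
  next
    assume R: ?R
    show ?L
    proof (intro allI impI)
      fix i assume "i < length cs + length ds"
      then show "M ! (k + i) = (cs @ ds) ! i"
        using R[THEN conjunct1, rule_format, of i] R[THEN conjunct2, rule_format, of "i - length cs"]
        by (cases "i < length cs") (auto simp: nth_append)
    qed
  qed
  then show ?thesis by (auto simp: code_at_def)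
qed

lemma code_at_Cons:
  "code_at M k (c # cs) \<longleftrightarrow> k < length M \<and> M ! k = c \<and> code_at M (Suc k) cs"
  using code_at_append[of M k "[c]" cs] by (auto simp: code_at_def)

lemma funpow_trans: "(f ^^ s) x = y \<Longrightarrow> (f ^^ t) y = z \<Longrightarrow> (f ^^ (s + t)) x = z"
  by (simp add: add.commute[of s t] funpow_add)

text \<open>Time is matched exactly, not just bounded, because \<open>exec\<close> charges precisely
  the transitions of \<open>code\<close>. The induction is on the execution, with the address
  \<open>k\<close> free, since subcommands sit at shifted addresses.\<close>

lemma exec_code:
  assumes "exec c s t s'" "wf_com m g c" "good_store m s" "code_at M k (code m k c)"
  shows "(tm_step M ^^ t) (k, tapes_of m s) = (k + clen c, tapes_of m s')"
  using assms
proof (induction arbitrary: k rule: exec.induct)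
  case (2 r f s)
  obtain c p where tr: "tape_of (s r) = (c, p)" by fastforce
  then have cp: "c = (\<lambda>i. if 0 \<le> i \<and> i < int (length (s r)) then rev (s r) ! nat i else 0)"
    "p = int (length (s r)) - 1" by (simp_all add: tape_of_def)
  have r: "r < m" and tr': "tapes_of m s ! r = (c, p)" using 2 tr by (auto simp: tapes_of_def)
  have c: "c p = topsym (s r)" using scan_tape_of[of "s r"] tr by simp
  let ?as = "map (tops s) [0..<m]"
  let ?tps = "(tapes_of m s)[r := (c, p + 1)]"
  have 1: "tm_step M (k, tapes_of m s) = (k + 1, (tapes_of m s)[r := (c(p := ?as ! r), p + 1)])"
    by (rule tm_step_upd) (use 2 r tr' in \<open>auto simp: code_at_Cons scan_tapes_of, auto simp: tapes_of_def\<close>)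
  also have "c(p := ?as ! r) = c" using r c by (auto simp: tops_def)
  finally have 1: "tm_step M (k, tapes_of m s) = (k + 1, ?tps)" .
  \<comment> \<open>The head now rests on the blank above the stack; this is why the symbol function
    is applied to \<open>(tops s)(r := 0)\<close>.\<close>
  have c1: "c (p + 1) = 0" using tr by (auto simp: tape_of_def)
  have sc: "map (\<lambda>(c, p). c p) ?tps = ?as[r := 0]"
    by (simp only: map_update scan_tapes_of) (simp add: c1)
  have nt: "nthd (?as[r := 0]) = (tops s)(r := 0)"
    using nthd_scan[OF 2(2)] r by (auto simp: nthd_def fun_eq_iff nth_list_update split: if_splits)
  let ?x = "f ((tops s)(r := 0))"
  have "tm_step M (k + 1, ?tps) = (k + 2, ?tps[r := (c(p + 1 := ?x), p + 1 + 0)])"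
    by (rule tm_step_upd[where m = m and as = "?as[r := 0]"])
       (use 2 r sc nt in \<open>auto simp: code_at_Cons tapes_of_def\<close>)
  also have "?tps[r := (c(p + 1 := ?x), p + 1 + 0)] = tapes_of m (s(r := ?x # s r))"
  proof -
    have "(c(p + 1 := ?x), p + 1) = tape_of (?x # s r)"
      using cp by (auto simp: tape_of_def fun_eq_iff nth_append)
    then show ?thesis using r by (simp add: tapes_of_upd)
  qed
  finally have 2: "tm_step M (k + 1, ?tps) = (k + 2, tapes_of m (s(r := ?x # s r)))" .
  have "(tm_step M ^^ (1 + 1)) (k, tapes_of m s) = (k + 2, tapes_of m (s(r := ?x # s r)))"
    by (rule funpow_trans[where y = "(k + 1, ?tps)"]) (use 1 2 in simp_all)
  then show ?case by (simp only: one_add_one clen.simps)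
next
  case (3 r s)
  obtain c p where tr: "tape_of (s r) = (c, p)" by fastforce
  then have cp: "c = (\<lambda>i. if 0 \<le> i \<and> i < int (length (s r)) then rev (s r) ! nat i else 0)"
    "p = int (length (s r)) - 1" by (simp_all add: tape_of_def)
  have r: "r < m" and tr': "tapes_of m s ! r = (c, p)" using 3 tr by (auto simp: tapes_of_def)
  let ?as = "map (tops s) [0..<m]"
  have 1: "tm_step M (k, tapes_of m s) =
      (k + 1, (tapes_of m s)[r := (c(p := 0), p + (if ?as ! r = 0 then 0 else -1))])"
    by (rule tm_step_upd) (use 3 r tr' in \<open>auto simp: code_at_Cons scan_tapes_of, auto simp: tapes_of_def\<close>)
  also have "(c(p := 0), p + (if ?as ! r = 0 then 0 else -1)) = tape_of (tl (s r))"
  proof (cases "s r")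
    case Nil
    then show ?thesis using cp r by (auto simp: tape_of_def fun_eq_iff tops_def)
  next
    case (Cons x xs)
    \<comment> \<open>A nonempty stack never shows a blank, so the test for 0 in the code moves the
      head down exactly when there is something to pop.\<close>
    then have "x \<noteq> 0" using 3(2) by (metis good_store_def list.set_intros(1))
    then show ?thesis using cp r Cons by (auto simp: tape_of_def fun_eq_iff tops_def nth_append)
  qed
  finally show ?case using r by (simp add: tapes_of_upd fun_upd_def)
next
  case (4 c s t s' d t' s'')
  have "good_store m s'" using exec_good[OF 4(1), of m g] 4(5,6) by simp
  then have b: "(tm_step M ^^ t') (k + clen c, tapes_of m s') = (k + clen c + clen d, tapes_of m s'')"
    using 4 by (simp add: code_at_append)
  have a: "(tm_step M ^^ t) (k, tapes_of m s) = (k + clen c, tapes_of m s')"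
    using 4 by (simp add: code_at_append)
  show ?case using funpow_trans[OF a b] by (simp add: add.assoc)
next
  case (5 b s c t s' d)
  then have 1: "(tm_step M ^^ 1) (k, tapes_of m s) = (k + 1, tapes_of m s)"
    by (simp, intro tm_step_stay) (auto simp: code_at_Cons nthd_scan)
  have 2: "(tm_step M ^^ t) (k + 1, tapes_of m s) = (k + 1 + clen c, tapes_of m s')"
    using 5 by (simp add: code_at_append code_at_Cons)
  have 3: "(tm_step M ^^ 1) (k + 1 + clen c, tapes_of m s') = (k + clen c + clen d + 2, tapes_of m s')"
    using 5 by (simp, intro tm_step_stay) (auto simp: code_at_append code_at_Cons)
  show ?case using funpow_trans[OF funpow_trans[OF 1 2] 3] by (simp add: add_ac)
next
  case (6 b s d t s' c)
  then have 1: "(tm_step M ^^ 1) (k, tapes_of m s) = (k + clen c + 2, tapes_of m s)"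
    by (simp, intro tm_step_stay) (auto simp: code_at_Cons nthd_scan)
  have 2: "(tm_step M ^^ t) (k + clen c + 2, tapes_of m s) = (k + clen c + 2 + clen d, tapes_of m s')"
    using 6 by (simp add: code_at_append code_at_Cons)
  show ?case using funpow_trans[OF 1 2] by (simp add: add_ac)
next
  case (7 b s c)
  then show ?case by (auto intro!: tm_step_stay simp: code_at_Cons nthd_scan)
next
  case (8 b s c t s' t' s'')
  then have 1: "(tm_step M ^^ 1) (k, tapes_of m s) = (k + 1, tapes_of m s)"
    by (simp, intro tm_step_stay) (auto simp: code_at_Cons nthd_scan)
  have 2: "(tm_step M ^^ t) (k + 1, tapes_of m s) = (k + 1 + clen c, tapes_of m s')"
    using 8 by (simp add: code_at_append code_at_Cons)
  have 3: "(tm_step M ^^ 1) (k + 1 + clen c, tapes_of m s') = (k, tapes_of m s')"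
    using 8 by (simp, intro tm_step_stay) (auto simp: code_at_append code_at_Cons)
  have "good_store m s'" using exec_good[OF 8(2), of m g] 8(6,7) by simp
  then have 4: "(tm_step M ^^ t') (k, tapes_of m s') = (k + clen (While b c), tapes_of m s'')"
    using 8 by (simp del: clen.simps code.simps)
  show ?case using funpow_trans[OF funpow_trans[OF funpow_trans[OF 1 2] 3] 4] by (simp add: add_ac)
next
  case (1 s)
  then show ?case by simp
qed


lemma poly_nat_mono: "x \<le> y \<Longrightarrow> poly p x \<le> poly p (y::nat)"
  by (induction p) (auto intro: add_mono mult_mono)

subsection \<open>Running time\<close>

text \<open>Register count and alphabet are hidden; by monotonicity the maxima serve for a compound
  program, so they surface only when a complete machine is built.\<close>

definition wf_prog :: "com \<Rightarrow> bool" where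
  "wf_prog c \<longleftrightarrow> (\<exists>m g. wf_com m g c)"

lemma wf_prog_simps [simp]:
  "wf_prog Skip" "wf_prog (Pop r)"
  "wf_prog (c ;; d) \<longleftrightarrow> wf_prog c \<and> wf_prog d"
  "wf_prog (Cond b c d) \<longleftrightarrow> wf_prog c \<and> wf_prog d"
  "wf_prog (While b c) \<longleftrightarrow> wf_prog c"
proof -
  have *: "(\<exists>m g. wf_com m g c \<and> wf_com m g d) \<longleftrightarrow> wf_prog c \<and> wf_prog d" for c d
  proof
    assume "wf_prog c \<and> wf_prog d"
    then obtain m g m' g' where "wf_com m g c" "wf_com m' g' d" by (auto simp: wf_prog_def)
    then have "wf_com (max m m') (max g g') c \<and> wf_com (max m m') (max g g') d"
      by (auto elim: wf_com_mono)
    then show "\<exists>m g. wf_com m g c \<and> wf_com m g d" by blast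
  qed (auto simp: wf_prog_def)
  show "wf_prog Skip" "wf_prog (Pop r)"
    "wf_prog (c ;; d) \<longleftrightarrow> wf_prog c \<and> wf_prog d"
    "wf_prog (Cond b c d) \<longleftrightarrow> wf_prog c \<and> wf_prog d"
    "wf_prog (While b c) \<longleftrightarrow> wf_prog c"
    using * by (auto simp: wf_prog_def)
qed

lemma wf_prog_Push: "(\<And>\<sigma>. 0 < f \<sigma> \<and> f \<sigma> < g) \<Longrightarrow> wf_prog (Push r f)"
  by (auto simp: wf_prog_def)

definition runs :: "com \<Rightarrow> store \<Rightarrow> nat \<Rightarrow> store \<Rightarrow> bool" where
  "runs c s T s' \<longleftrightarrow> (\<exists>t\<le>T. exec c s t s')"

lemma runs_mono: "runs c s T s' \<Longrightarrow> T \<le> T' \<Longrightarrow> runs c s T' s'"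
  unfolding runs_def by (meson le_trans)

lemma runs_eq: "runs c s T s' \<Longrightarrow> s' = s'' \<Longrightarrow> T \<le> T' \<Longrightarrow> runs c s T' s''"
  unfolding runs_def by (metis le_trans)

lemma runs_Skip: "runs Skip s T s"
  by (auto simp: runs_def intro: exec.intros)

lemma runs_Push: "runs (Push r f) s 2 (s(r := f ((tops s)(r := 0)) # s r))"
  unfolding runs_def using exec.intros(2) by blast

lemma runs_Pop: "runs (Pop r) s 1 (s(r := tl (s r)))"
  unfolding runs_def using exec.intros(3) by blast

lemma runs_Seq:
  assumes "runs c s T s'" "runs d s' T' s''"
  shows "runs (c ;; d) s (T + T') s''"
proof -
  obtain t t' where t: "t \<le> T" "t' \<le> T'" "exec c s t s'" "exec d s' t' s''"
    using assms by (auto simp: runs_def)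
  have "exec (c ;; d) s (t + t') s''" by (rule exec.intros(4)[OF t(3,4)])
  then show ?thesis using t(1,2) add_mono unfolding runs_def by blast
qed

lemma runs_Cond:
  assumes "runs (if b (tops s) then c else d) s T s'"
  shows "runs (Cond b c d) s (T + 2) s'"
proof -
  obtain t where t: "t \<le> T" "exec (if b (tops s) then c else d) s t s'"
    using assms by (auto simp: runs_def)
  have "exec (Cond b c d) s (t + (if b (tops s) then 2 else 1)) s'"
    using t(2) exec.intros(5)[of b s c t s' d] exec.intros(6)[of b s d t s' c]
    by (simp split: if_splits)
  moreover have "t + (if b (tops s) then 2 else 1) \<le> T + 2" using t(1) by simp
  ultimately show ?thesis unfolding runs_def by blast
qed

text \<open>The loop is described by the sequence \<open>S\<close> of its stores, which replaces an
  invariant and a variant. Each round pays 2 for the test and the jump back, and the failing test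
  costs 1.\<close>

lemma runs_For:
  assumes "\<And>i. i < n \<Longrightarrow> b (tops (S i))" "\<not> b (tops (S n))"
    and "\<And>i. i < n \<Longrightarrow> runs c (S i) T (S (Suc i))"
  shows "runs (While b c) (S 0) (n * (T + 2) + 1) (S n)"
  using assms
proof (induction n arbitrary: S)
  case 0
  then show ?case using exec.intros(7)[of b "S 0" c] by (auto simp: runs_def)
next
  case (Suc n)
  have "runs (While b c) ((\<lambda>i. S (Suc i)) 0) (n * (T + 2) + 1) ((\<lambda>i. S (Suc i)) n)"
    by (rule Suc.IH) (use Suc.prems in auto)
  then obtain t' where t': "t' \<le> n * (T + 2) + 1" "exec (While b c) (S (Suc 0)) t' (S (Suc n))"
    by (auto simp: runs_def)
  obtain t where t: "t \<le> T" "exec c (S 0) t (S (Suc 0))"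
    using Suc.prems(3)[of 0] by (auto simp: runs_def)
  have "exec (While b c) (S 0) (t + t' + 2) (S (Suc n))"
    using exec.intros(8)[OF _ t(2) t'(2)] Suc.prems(1) by simp
  moreover have "t + t' + 2 \<le> Suc n * (T + 2) + 1" using t t' by simp
  ultimately show ?case unfolding runs_def by blast
qed

lemma runs_length: "runs c s T s' \<Longrightarrow> length (s' r) \<le> length (s r) + T"
  unfolding runs_def using exec_length by (meson add_left_mono le_trans)


subsection \<open>Elementary programs\<close>

text \<open>A copied symbol has to be nonzero and bounded for every conceivable argument, so it is
  passed through this total function, which fixes the bit symbols 1 and 2.\<close>

definition bitsym :: "nat \<Rightarrow> nat" where
  "bitsym x = (if x = 2 then 2 else 1)"

lemma wf_prog_bitsym [simp]: "wf_prog (Push r (\<lambda>\<sigma>. bitsym (\<sigma> a)))"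
  by (rule wf_prog_Push[of _ 3]) (auto simp: bitsym_def)

lemma wf_prog_Push_const [simp]: "0 < x \<Longrightarrow> wf_prog (Push r (\<lambda>\<sigma>. x))"
  by (rule wf_prog_Push[of _ "Suc x"]) auto

lemma bitsym_nth: "set xs \<subseteq> {1, 2} \<Longrightarrow> i < length xs \<Longrightarrow> bitsym (xs ! i) = xs ! i"
  using nth_mem[of i xs] by (fastforce simp: bitsym_def)

lemma top_drop: "i < length xs \<Longrightarrow> topsym (drop i xs) = xs ! i"
  by (simp add: topsym_def Cons_nth_drop_Suc[symmetric])

lemma tl_drop': "tl (drop i xs) = drop (Suc i) xs"
  by (simp add: drop_Suc tl_drop)

text \<open>Moving between stacks reverses the order. The recoding \<open>h\<close> serves to
  translate between bits and the shifted alphabet of the machine simulation.\<close>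

definition move_while :: "(nat \<Rightarrow> bool) \<Rightarrow> (nat \<Rightarrow> nat) \<Rightarrow> nat \<Rightarrow> nat \<Rightarrow> com" where
  "move_while P h a b = While (\<lambda>\<sigma>. P (\<sigma> a)) (Push b (\<lambda>\<sigma>. h (\<sigma> a)) ;; Pop a)"

lemma runs_move_while:
  assumes "a \<noteq> b" "\<not> P 0"
    and "s' = s(a := dropWhile P (s a), b := rev (map h (takeWhile P (s a))) @ s b)"
    and "5 * length (s a) + 1 \<le> T"
  shows "runs (move_while P h a b) s T s'"
proof -
  let ?n = "length (takeWhile P (s a))"
  let ?S = "\<lambda>i. s(a := drop i (s a), b := rev (map h (take i (s a))) @ s b)"
  have n: "?n \<le> length (s a)" by (rule length_takeWhile_le)
  have *: "runs (While (\<lambda>\<sigma>. P (\<sigma> a)) (Push b (\<lambda>\<sigma>. h (\<sigma> a)) ;; Pop a)) (?S 0)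
      (?n * (3 + 2) + 1) (?S ?n)"
  proof (rule runs_For)
    fix i assume i: "i < ?n"
    then have i': "i < length (s a)" using n by simp
    have "P (s a ! i)"
      using set_takeWhileD[OF nth_mem[OF i]] takeWhile_nth[OF i] by simp
    then show "P (tops (?S i) a)" using i' assms(1) by (simp add: tops_def top_drop)
    show "runs (Push b (\<lambda>\<sigma>. h (\<sigma> a)) ;; Pop a) (?S i) 3 (?S (Suc i))"
      by (rule runs_eq, rule runs_Seq[OF runs_Push runs_Pop])
         (use i' assms(1) in
          \<open>simp_all add: fun_eq_iff tops_def top_drop take_Suc_conv_app_nth tl_drop'\<close>)
  next
    show "\<not> P (tops (?S ?n) a)"
      using nth_length_takeWhile[of P "s a"] n assms(1,2)
      by (cases "?n = length (s a)") (auto simp: tops_def top_drop)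
  qed
  have "?S 0 = s" "?S ?n = s'" by (simp_all add: assms(3) dropWhile_eq_drop takeWhile_eq_take[symmetric])
  with * have "runs (move_while P h a b) s (?n * (3 + 2) + 1) s'" by (simp only: move_while_def)
  then show ?thesis by (rule runs_mono) (use assms(4) n in simp)
qed

abbreviation move :: "nat \<Rightarrow> nat \<Rightarrow> com" where
  "move \<equiv> move_while (\<lambda>x. x \<noteq> 0) bitsym"

lemma runs_move:
  assumes "a \<noteq> b" "set (s a) \<subseteq> {1, 2}" "s' = s(a := [], b := rev (s a) @ s b)"
    and "5 * length (s a) + 1 \<le> T"
  shows "runs (move a b) s T s'"
proof -
  have eqs: "takeWhile (\<lambda>x. x \<noteq> 0) xs = xs" "dropWhile (\<lambda>x. x \<noteq> 0) xs = []" "map bitsym xs = xs"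
    if "set xs \<subseteq> {1, 2}" for xs
    using that by (induction xs) (auto simp: bitsym_def)
  have "s' = s(a := dropWhile (\<lambda>x. x \<noteq> 0) (s a),
      b := rev (map bitsym (takeWhile (\<lambda>x. x \<noteq> 0) (s a))) @ s b)"
    by (simp only: assms(3) eqs[OF assms(2)])
  from runs_move_while[OF assms(1) _ this assms(4)] show ?thesis by simp
qed

text \<open>The auxiliary stack \<open>t\<close> receives the reversed contents; unloading it onto
  both \<open>a\<close> and \<open>b\<close> reverses again, which restores \<open>a\<close> and
  puts a correctly ordered copy on top of \<open>b\<close>.\<close>

definition copy :: "nat \<Rightarrow> nat \<Rightarrow> nat \<Rightarrow> com" where
  "copy t a b = move a t ;; While (\<lambda>\<sigma>. \<sigma> t \<noteq> 0)
     (Push a (\<lambda>\<sigma>. bitsym (\<sigma> t)) ;; Push b (\<lambda>\<sigma>. bitsym (\<sigma> t)) ;; Pop t)"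

lemma runs_copy:
  assumes "a \<noteq> b" "a \<noteq> t" "b \<noteq> t" "set (s a) \<subseteq> {1, 2}" "s t = []" "s' = s(b := s a @ s b)"
    and "12 * length (s a) + 2 \<le> T"
  shows "runs (copy t a b) s T s'"
proof -
  let ?r = "rev (s a)"
  let ?c = "Push a (\<lambda>\<sigma>. bitsym (\<sigma> t)) ;; Push b (\<lambda>\<sigma>. bitsym (\<sigma> t)) ;; Pop t"
  let ?S = "\<lambda>i. s(a := rev (take i ?r), b := rev (take i ?r) @ s b, t := drop i ?r)"
  have r: "set ?r \<subseteq> {1, 2}" using assms by simp
  have 1: "runs (move a t) s (5 * length (s a) + 1) (?S 0)"
    by (rule runs_move) (use assms in \<open>auto simp: fun_eq_iff\<close>)
  have 2: "runs (While (\<lambda>\<sigma>. \<sigma> t \<noteq> 0) ?c) (?S 0) (length (s a) * (5 + 2) + 1) (?S (length (s a)))"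
  proof (rule runs_For)
    fix i assume i: "i < length (s a)"
    then have i': "i < length ?r" by simp
    then have "?r ! i \<noteq> 0" using r nth_mem[OF i'] by force
    then show "tops (?S i) t \<noteq> 0" using i' by (simp add: tops_def top_drop del: length_rev)
    show "runs ?c (?S i) 5 (?S (Suc i))"
      by (rule runs_eq, rule runs_Seq[OF runs_Push runs_Seq[OF runs_Push runs_Pop]])
         (use i' assms(1,2,3) bitsym_nth[OF r i'] in
          \<open>auto simp: fun_eq_iff tops_def top_drop take_Suc_conv_app_nth tl_drop' simp del: length_rev\<close>)
  qed (simp add: tops_def)
  have "?S (length (s a)) = s'" using assms(1,2,3,5,6) by (simp add: fun_eq_iff)
  then show ?thesis using runs_mono[OF runs_Seq[OF 1 2], of T] assms(7) by (simp add: copy_def)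
qed

definition clear :: "nat \<Rightarrow> com" where
  "clear a = While (\<lambda>\<sigma>. \<sigma> a \<noteq> 0) (Pop a)"

lemma runs_clear:
  assumes "0 \<notin> set (s a)" "s' = s(a := [])" "3 * length (s a) + 1 \<le> T"
  shows "runs (clear a) s T s'"
proof -
  let ?S = "\<lambda>i. s(a := drop i (s a))"
  have "runs (While (\<lambda>\<sigma>. \<sigma> a \<noteq> 0) (Pop a)) (?S 0) (length (s a) * (1 + 2) + 1) (?S (length (s a)))"
  proof (rule runs_For)
    fix i assume i: "i < length (s a)"
    have "s a ! i \<noteq> 0" using assms(1) nth_mem[OF i] by metis
    then show "tops (?S i) a \<noteq> 0" using i by (simp add: tops_def top_drop)
    show "runs (Pop a) (?S i) 1 (?S (Suc i))"
      by (rule runs_eq, rule runs_Pop) (simp_all add: tl_drop')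
  qed (simp add: tops_def)
  moreover have "?S 0 = s" by simp
  ultimately have "runs (clear a) s (length (s a) * (1 + 2) + 1) (?S (length (s a)))"
    by (simp only: clear_def)
  then show ?thesis by (rule runs_eq) (use assms in simp_all)
qed

definition drop_by :: "nat \<Rightarrow> nat \<Rightarrow> com" where
  "drop_by a b = While (\<lambda>\<sigma>. \<sigma> a \<noteq> 0) (Pop a ;; Pop b)"

lemma runs_drop_by:
  assumes "a \<noteq> b" "0 \<notin> set (s a)" "s' = s(a := [], b := drop (length (s a)) (s b))"
    and "4 * length (s a) + 1 \<le> T"
  shows "runs (drop_by a b) s T s'"
proof -
  let ?S = "\<lambda>i. s(a := drop i (s a), b := drop i (s b))"
  have "runs (While (\<lambda>\<sigma>. \<sigma> a \<noteq> 0) (Pop a ;; Pop b)) (?S 0) (length (s a) * (2 + 2) + 1) (?S (length (s a)))"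
  proof (rule runs_For)
    fix i assume i: "i < length (s a)"
    have "s a ! i \<noteq> 0" using assms(2) nth_mem[OF i] by metis
    then show "tops (?S i) a \<noteq> 0" using assms(1) i by (simp add: tops_def top_drop)
    show "runs (Pop a ;; Pop b) (?S i) 2 (?S (Suc i))"
      by (rule runs_eq, rule runs_Seq[OF runs_Pop runs_Pop])
         (use assms(1) in \<open>simp_all add: fun_eq_iff tl_drop'\<close>)
  qed (use assms(1) in \<open>simp add: tops_def\<close>)
  moreover have "?S 0 = s" by simp
  ultimately have "runs (drop_by a b) s (length (s a) * (2 + 2) + 1) (?S (length (s a)))"
    by (simp only: drop_by_def)
  then show ?thesis by (rule runs_eq) (use assms in simp_all)
qed

definition strip :: "nat \<Rightarrow> com" where
  "strip a = While (\<lambda>\<sigma>. \<sigma> a = 1) (Pop a)"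

lemma runs_strip:
  assumes "s' = s(a := dropWhile (\<lambda>x. x = 1) (s a))" "3 * length (s a) + 1 \<le> T"
  shows "runs (strip a) s T s'"
proof -
  let ?n = "length (takeWhile (\<lambda>x. x = 1) (s a))"
  let ?S = "\<lambda>i. s(a := drop i (s a))"
  have n: "?n \<le> length (s a)" by (rule length_takeWhile_le)
  have "runs (While (\<lambda>\<sigma>. \<sigma> a = 1) (Pop a)) (?S 0) (?n * (1 + 2) + 1) (?S ?n)"
  proof (rule runs_For)
    fix i assume i: "i < ?n"
    have "s a ! i = 1"
      using set_takeWhileD[OF nth_mem[OF i]] takeWhile_nth[OF i] by simp
    then show "tops (?S i) a = 1" using i n by (simp add: tops_def top_drop)
    show "runs (Pop a) (?S i) 1 (?S (Suc i))"
      by (rule runs_eq, rule runs_Pop) (simp_all add: tl_drop')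
  next
    show "tops (?S ?n) a \<noteq> 1"
      using nth_length_takeWhile[of "\<lambda>x. x = 1" "s a"] n
      by (cases "?n = length (s a)") (auto simp: tops_def top_drop)
  qed
  moreover have "?S ?n = s'" by (simp add: assms(1) dropWhile_eq_drop)
  ultimately have "runs (strip a) s (?n * (1 + 2) + 1) s'" by (simp add: strip_def)
  then show ?thesis by (rule runs_mono) (use assms(2) n in simp)
qed

fun clear_range :: "nat \<Rightarrow> nat \<Rightarrow> com" where
  "clear_range w 0 = Skip"
| "clear_range w (Suc k) = clear_range w k ;; clear (w + k)"

lemma runs_clear_range:
  assumes "\<And>r. w \<le> r \<Longrightarrow> r < w + k \<Longrightarrow> 0 \<notin> set (s r) \<and> length (s r) \<le> l"
  shows "runs (clear_range w k) s (k * (3 * l + 1)) (\<lambda>r. if w \<le> r \<and> r < w + k then [] else s r)"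
  using assms
proof (induction k)
  case (Suc k)
  have "runs (clear_range w k ;; clear (w + k)) s (k * (3 * l + 1) + (3 * l + 1))
      (\<lambda>r. if w \<le> r \<and> r < w + Suc k then [] else s r)"
    by (rule runs_Seq[OF Suc.IH runs_clear]) (use Suc.prems in \<open>auto simp: fun_eq_iff\<close>)
  then show ?case by (simp add: add_ac)
next
  case 0
  have "(if w \<le> r \<and> r < w + 0 then [] else s r) = s r" for r by auto
  then show ?case by (simp only: clear_range.simps runs_Skip)
qed

lemma wf_prog_move_while: "(\<And>x. 0 < h x \<and> h x < g) \<Longrightarrow> wf_prog (move_while P h a b)"
  by (auto simp: move_while_def intro: wf_prog_Push)

lemma wf_prog_elementary [simp]:
  "wf_prog (move_while P bitsym a b)" "wf_prog (copy t a b)" "wf_prog (clear a)" "wf_prog (drop_by a b)"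
  "wf_prog (strip a)"
  by (simp_all add: move_while_def copy_def clear_def drop_by_def strip_def)

lemma wf_prog_clear_range [simp]: "wf_prog (clear_range w k)"
  by (induction k) simp_all


subsection \<open>Functions computed by stack programs\<close>

abbreviation insize :: "nat list \<Rightarrow> nat" where
  "insize vs \<equiv> \<Sum>x\<leftarrow>vs. floorlog 2 x"

text \<open>The program may use the registers from \<open>w\<close> on as workspace and leaves them empty.\<close>

definition implements :: "com \<Rightarrow> nat \<Rightarrow> nat \<Rightarrow> nat list \<Rightarrow> (nat list \<Rightarrow> nat) \<Rightarrow> nat poly \<Rightarrow> bool" where
  "implements c w out xs f p \<longleftrightarrow> wf_prog c \<and>
     (\<forall>s vs. length vs = length xs \<longrightarrow> (\<forall>r\<ge>w. s r = []) \<longrightarrow> s out = [] \<longrightarrow> map s xs = map rep vs \<longrightarrow>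
        runs c s (poly p (insize vs)) (s(out := rep (f vs))))"

lemma implementsI:
  assumes "wf_prog c"
    and "\<And>s vs. length vs = length xs \<Longrightarrow> \<forall>r\<ge>w. s r = [] \<Longrightarrow> s out = [] \<Longrightarrow> map s xs = map rep vs \<Longrightarrow>
      runs c s (poly p (insize vs)) (s(out := rep (f vs)))"
  shows "\<exists>c. implements c w out xs f p"
  using assms unfolding implements_def by blast

lemma implementsD:
  assumes "implements c w out xs f p"
  shows "wf_prog c"
    and "length vs = length xs \<Longrightarrow> \<forall>r\<ge>w. s r = [] \<Longrightarrow> s out = [] \<Longrightarrow> map s xs = map rep vs \<Longrightarrow>
      runs c s (poly p (insize vs)) (s(out := rep (f vs)))"
  using assms unfolding implements_def by blast+

text \<open>The polynomial is fixed before the registers are chosen: composition has to state its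
  bound before it can assign registers to the subprograms. The freedom in \<open>w\<close> lets a
  caller protect its own intermediate results.\<close>

definition fp :: "nat \<Rightarrow> (nat list \<Rightarrow> nat) \<Rightarrow> bool" where
  "fp k f \<longleftrightarrow> (\<exists>p. \<forall>w out xs. length xs = k \<longrightarrow> set xs \<subseteq> {..<w} \<longrightarrow> out < w \<longrightarrow> out \<notin> set xs \<longrightarrow>
     (\<exists>c. implements c w out xs f p))"

lemma fpI:
  assumes "\<And>w out xs. length xs = k \<Longrightarrow> set xs \<subseteq> {..<w} \<Longrightarrow> out < w \<Longrightarrow> out \<notin> set xs \<Longrightarrow>
     \<exists>c. implements c w out xs f p"
  shows "fp k f"
  unfolding fp_def by (intro exI[of _ p] allI impI) (rule assms)

text \<open>The length bound comes from running the program on one concrete store: the output stack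
  starts empty and cannot become longer than the running time.\<close>

lemma fpE:
  assumes "fp k f"
  obtains p where
    "\<And>w out xs. length xs = k \<Longrightarrow> set xs \<subseteq> {..<w} \<Longrightarrow> out < w \<Longrightarrow> out \<notin> set xs \<Longrightarrow>
     \<exists>c. implements c w out xs f p"
    and "\<And>vs. length vs = k \<Longrightarrow> floorlog 2 (f vs) \<le> poly p (insize vs)"
proof -
  from assms obtain p where p: "\<And>w out xs. length xs = k \<Longrightarrow> set xs \<subseteq> {..<w} \<Longrightarrow> out < w \<Longrightarrow>
      out \<notin> set xs \<Longrightarrow> \<exists>c. implements c w out xs f p"
    unfolding fp_def by metis
  have b: "floorlog 2 (f vs) \<le> poly p (insize vs)" if "length vs = k" for vs
  proof -
    let ?s = "\<lambda>r. if r < k then rep (vs ! r) else []"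
    obtain c where c: "implements c (Suc k) k [0..<k] f p"
      using p[of "[0..<k]" "Suc k" k] by (auto simp: subset_iff)
    have "map ?s [0..<k] = map rep vs" using that by (intro nth_equalityI) auto
    then have "runs c ?s (poly p (insize vs)) (?s(k := rep (f vs)))"
      using that by (intro implementsD(2)[OF c]) auto
    then have "length ((?s(k := rep (f vs))) k) \<le> length (?s k) + poly p (insize vs)"
      by (rule runs_length)
    then show ?thesis by simp
  qed
  show ?thesis by (rule that[of p]) (fact p, fact b)
qed

lemma fp_cong:
  assumes "fp k f" "\<And>vs. length vs = k \<Longrightarrow> f vs = g vs"
  shows "fp k g"
proof -
  obtain p where p: "\<And>w out xs. length xs = k \<Longrightarrow> set xs \<subseteq> {..<w} \<Longrightarrow> out < w \<Longrightarrow> out \<notin> set xs \<Longrightarrow>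
     \<exists>c. implements c w out xs f p"
    using fpE[OF assms(1)] by metis
  have "implements c w out xs f p \<Longrightarrow> implements c w out xs g p" if "length xs = k" for c w out xs
    using assms(2) that by (simp add: implements_def)
  with p show ?thesis by (intro fpI[of _ _ p]) blast
qed

lemma floorlog_le_insize: "i < length vs \<Longrightarrow> floorlog 2 (vs ! i) \<le> insize vs"
  by (rule member_le_sum_list) auto

lemma fp_proj: "i < n \<Longrightarrow> fp n (\<lambda>vs. vs ! i)"
proof (rule fpI[of _ _ "[:2, 12:]"])
  fix w out :: nat and xs :: "nat list"
  assume i: "i < n" and xs: "length xs = n" "set xs \<subseteq> {..<w}" "out < w" "out \<notin> set xs"
  have xi: "xs ! i < w" "xs ! i \<noteq> out" using i xs by (auto simp: subset_iff)
  show "\<exists>c. implements c w out xs (\<lambda>vs. vs ! i) [:2, 12:]"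
  proof (rule implementsI[of "copy w (xs ! i) out"])
    fix s and vs :: "nat list"
    assume *: "length vs = length xs" "\<forall>r\<ge>w. s r = []" "s out = []" "map s xs = map rep vs"
    then have "s (xs ! i) = rep (vs ! i)" using i xs by (metis nth_map)
    then show "runs (copy w (xs ! i) out) s (poly [:2, 12:] (insize vs)) (s(out := rep (vs ! i)))"
      using * xi xs i set_rep[of "vs ! i"] floorlog_le_insize[of i vs] by (intro runs_copy) auto
  qed simp
qed

lemma fp_zero: "fp n (\<lambda>vs. 0)"
  by (rule fpI[of _ _ 0], rule implementsI[of Skip]) (auto simp: fun_upd_idem runs_Skip)

lemma fp_one: "fp n (\<lambda>vs. 1)"
proof (rule fpI[of _ _ "[:2:]"], rule implementsI)
  have "rep 1 = [2]" by (simp add: rep_rec)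
  then show "runs (Push out (\<lambda>_. 2)) s (poly [:2:] (insize vs)) (s(out := rep 1))" if "s out = []"
    for out s and vs :: "nat list"
    using that by - (rule runs_eq[OF runs_Push], auto)
qed simp

lemma length_Suc_convs: "length xs = Suc 0 \<longleftrightarrow> (\<exists>a. xs = [a])"
  "length xs = Suc (Suc 0) \<longleftrightarrow> (\<exists>a b. xs = [a, b])"
  "length xs = Suc (Suc (Suc 0)) \<longleftrightarrow> (\<exists>a b c. xs = [a, b, c])"
  by (auto simp: length_Suc_conv)

lemma fp_cat: "fp 2 (\<lambda>vs. vs ! 0 * 2 ^ floorlog 2 (vs ! 1) + vs ! 1)"
proof (rule fpI[of _ _ "[:4, 12:]"])
  fix w out and xs :: "nat list"
  assume xs: "length xs = 2" "set xs \<subseteq> {..<w}" "out < w" "out \<notin> set xs"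
  then obtain a b where ab: "xs = [a, b]" by (auto simp: numeral_2_eq_2 length_Suc_convs)
  show "\<exists>c. implements c w out xs (\<lambda>vs. vs ! 0 * 2 ^ floorlog 2 (vs ! 1) + vs ! 1) [:4, 12:]"
  proof (rule implementsI[of "copy w b out ;; copy w a out"])
    fix s and vs :: "nat list"
    assume *: "length vs = length xs" "\<forall>r\<ge>w. s r = []" "s out = []" "map s xs = map rep vs"
    then obtain x y where xy: "vs = [x, y]" using xs(1) by (auto simp: numeral_2_eq_2 length_Suc_convs)
    have "runs (copy w b out ;; copy w a out) s ((12 * floorlog 2 y + 2) + (12 * floorlog 2 x + 2))
        (s(out := rep x @ rep y))"
      by (rule runs_Seq[OF runs_copy[where s' = "s(out := rep y)"] runs_copy])
         (use * xy ab xs set_rep[of x] set_rep[of y] in auto)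
    then show "runs (copy w b out ;; copy w a out) s (poly [:4, 12:] (insize vs))
        (s(out := rep (vs ! 0 * 2 ^ floorlog 2 (vs ! 1) + vs ! 1)))"
      by (rule runs_eq) (simp_all add: xy rep_cat)
  qed simp
qed

lemma fp_cond: "fp 3 (\<lambda>vs. if vs ! 0 = 0 then vs ! 2 else vs ! 1)"
proof (rule fpI[of _ _ "[:4, 12:]"])
  fix w out and xs :: "nat list"
  assume xs: "length xs = 3" "set xs \<subseteq> {..<w}" "out < w" "out \<notin> set xs"
  then obtain a b c where ab: "xs = [a, b, c]" by (auto simp: numeral_3_eq_3 length_Suc_convs)
  let ?c = "Cond (\<lambda>\<sigma>. \<sigma> a = 0) (copy w c out) (copy w b out)"
  show "\<exists>c. implements c w out xs (\<lambda>vs. if vs ! 0 = 0 then vs ! 2 else vs ! 1) [:4, 12:]"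
  proof (rule implementsI[of ?c])
    fix s and vs :: "nat list"
    assume *: "length vs = length xs" "\<forall>r\<ge>w. s r = []" "s out = []" "map s xs = map rep vs"
    then obtain x y z where xy: "vs = [x, y, z]" using xs(1) by (auto simp: numeral_3_eq_3 length_Suc_convs)
    have sa: "s a = rep x" using * xy ab by simp
    have "tops s a = 0 \<longleftrightarrow> x = 0"
      using set_rep[of x] sa by (cases "rep x") (auto simp: tops_def)
    then have "runs ?c s ((12 * (floorlog 2 y + floorlog 2 z) + 2) + 2)
        (s(out := rep (if x = 0 then z else y)))"
      by (intro runs_Cond)
         (use * xy ab xs set_rep[of z] set_rep[of y] in \<open>auto intro!: runs_copy\<close>)
    then show "runs ?c s (poly [:4, 12:] (insize vs))
        (s(out := rep (if vs ! 0 = 0 then vs ! 2 else vs ! 1)))"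
      by (rule runs_eq) (simp_all add: xy)
  qed simp
qed

text \<open>The bits to be removed lie at the bottom of the stack, so the first argument is
  reversed, shortened by one pop for each symbol of the second argument, and reversed back.\<close>

lemma fp_shr: "fp 2 (\<lambda>vs. vs ! 0 div 2 ^ floorlog 2 (vs ! 1))"
proof (rule fpI[of _ _ "[:7, 22:]"])
  fix w out and xs :: "nat list"
  assume xs: "length xs = 2" "set xs \<subseteq> {..<w}" "out < w" "out \<notin> set xs"
  then obtain a b where ab: "xs = [a, b]" by (auto simp: numeral_2_eq_2 length_Suc_convs)
  let ?c = "copy w a (w + 1) ;; move (w + 1) (w + 2) ;; copy w b (w + 3) ;;
    drop_by (w + 3) (w + 2) ;; move (w + 2) out"
  show "\<exists>c. implements c w out xs (\<lambda>vs. vs ! 0 div 2 ^ floorlog 2 (vs ! 1)) [:7, 22:]"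
  proof (rule implementsI[of ?c])
    fix s and vs :: "nat list"
    assume *: "length vs = length xs" "\<forall>r\<ge>w. s r = []" "s out = []" "map s xs = map rep vs"
    then obtain x y where xy: "vs = [x, y]" using xs(1) by (auto simp: numeral_2_eq_2 length_Suc_convs)
    have set: "set (drop n (rev (rep x))) \<subseteq> {1, 2}" for n
      using set_rep[of x] set_drop_subset[of n "rev (rep x)"] by auto
    have 1: "runs ?c s ((12 * floorlog 2 x + 2) + ((5 * floorlog 2 x + 1) + ((12 * floorlog 2 y + 2) +
        ((4 * floorlog 2 y + 1) + (5 * floorlog 2 x + 1)))))
        (s(out := rev (drop (floorlog 2 y) (rev (rep x)))))"
      apply (rule runs_Seq[OF runs_copy[where s' = "s(w + 1 := rep x)"]
          runs_Seq[OF runs_move[where s' = "s(w + 2 := rev (rep x))"]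
          runs_Seq[OF runs_copy[where s' = "s(w + 2 := rev (rep x), w + 3 := rep y)"]
          runs_Seq[OF runs_drop_by[where s' = "s(w + 2 := drop (floorlog 2 y) (rev (rep x)))"] runs_move]]]])
      using * xy ab xs set_rep[of x] set_rep[of y] set[of "floorlog 2 y"] by (auto simp: fun_eq_iff)
    have 2: "rev (drop (floorlog 2 y) (rev (rep x))) = rep (x div 2 ^ floorlog 2 y)"
      by (simp add: rep_div rev_drop)
    show "runs ?c s (poly [:7, 22:] (insize vs))
        (s(out := rep (vs ! 0 div 2 ^ floorlog 2 (vs ! 1))))"
      by (rule runs_eq[OF 1]) (simp_all add: xy 2)
  qed simp
qed

text \<open>Here the leading bits go, which lie on top; zeros that become leading are stripped. The
  exponent is the number of remaining bits, and \<open>fp_lowI\<close> turns this into truncation to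
  a given length.\<close>

lemma fp_dropz: "fp 2 (\<lambda>vs. vs ! 0 mod 2 ^ (floorlog 2 (vs ! 0) - floorlog 2 (vs ! 1)))"
proof (rule fpI[of _ _ "[:6, 16:]"])
  fix w out and xs :: "nat list"
  assume xs: "length xs = 2" "set xs \<subseteq> {..<w}" "out < w" "out \<notin> set xs"
  then obtain a b where ab: "xs = [a, b]" by (auto simp: numeral_2_eq_2 length_Suc_convs)
  let ?c = "copy w a out ;; copy w b (w + 1) ;; drop_by (w + 1) out ;; strip out"
  show "\<exists>c. implements c w out xs (\<lambda>vs. vs ! 0 mod 2 ^ (floorlog 2 (vs ! 0) - floorlog 2 (vs ! 1))) [:6, 16:]"
  proof (rule implementsI[of ?c])
    fix s and vs :: "nat list"
    assume *: "length vs = length xs" "\<forall>r\<ge>w. s r = []" "s out = []" "map s xs = map rep vs"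
    then obtain x y where xy: "vs = [x, y]" using xs(1) by (auto simp: numeral_2_eq_2 length_Suc_convs)
    have "runs ?c s ((12 * floorlog 2 x + 2) + ((12 * floorlog 2 y + 2) +
        ((4 * floorlog 2 y + 1) + (3 * floorlog 2 x + 1))))
        (s(out := dropWhile (\<lambda>x. x = 1) (drop (floorlog 2 y) (rep x))))"
      apply (rule runs_Seq[OF runs_copy[where s' = "s(out := rep x)"]
          runs_Seq[OF runs_copy[where s' = "s(out := rep x, w + 1 := rep y)"]
          runs_Seq[OF runs_drop_by[where s' = "s(out := drop (floorlog 2 y) (rep x))"] runs_strip]]])
      using * xy ab xs set_rep[of x] set_rep[of y] by (auto simp: fun_eq_iff)
    then show "runs ?c s (poly [:6, 16:] (insize vs))
        (s(out := rep (vs ! 0 mod 2 ^ (floorlog 2 (vs ! 0) - floorlog 2 (vs ! 1)))))"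
      by (rule runs_eq) (simp_all add: xy rep_mod)
  qed simp
qed


lemma fp_calls:
  assumes "\<forall>g\<in>set gs. fp n g"
  shows "\<exists>p. \<forall>w b xs. length xs = n \<and> set xs \<subseteq> {..<w} \<and> w + length gs \<le> b \<longrightarrow>
     (\<exists>c. wf_prog c \<and> (\<forall>s vs. length vs = n \<longrightarrow> (\<forall>r\<ge>w. s r = []) \<longrightarrow> map s xs = map rep vs \<longrightarrow>
        runs c s (poly p (insize vs))
          (\<lambda>r. if w \<le> r \<and> r < w + length gs then rep ((gs ! (r - w)) vs) else s r)))"
  using assms
proof (induction gs rule: rev_induct)
  case Nil
  have "runs Skip s T (\<lambda>r. if w \<le> r \<and> r < w + length [] then rep (([] ! (r - w)) vs) else s r)"
    for s T w and vs :: "nat list"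
    by (rule runs_eq[OF runs_Skip]) (auto simp: fun_eq_iff)
  then show ?case using wf_prog_simps(1) by blast
next
  case (snoc g gs)
  have "\<forall>g\<in>set gs. fp n g" using snoc.prems by simp
  from snoc.IH[OF this] obtain p where p: "\<forall>w b xs. length xs = n \<and> set xs \<subseteq> {..<w} \<and> w + length gs \<le> b \<longrightarrow>
     (\<exists>c. wf_prog c \<and> (\<forall>s vs. length vs = n \<longrightarrow> (\<forall>r\<ge>w. s r = []) \<longrightarrow> map s xs = map rep vs \<longrightarrow>
        runs c s (poly p (insize vs))
          (\<lambda>r. if w \<le> r \<and> r < w + length gs then rep ((gs ! (r - w)) vs) else s r)))"
    by (elim exE)
  from snoc.prems have "fp n g" by simp
  then obtain q where q:
    "\<And>w out xs. length xs = n \<Longrightarrow> set xs \<subseteq> {..<w} \<Longrightarrow> out < w \<Longrightarrow> out \<notin> set xs \<Longrightarrow>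
     \<exists>c. implements c w out xs g q"
    by (rule fpE) metis
  show ?case
  proof (intro exI[of _ "p + q"] allI impI, elim conjE)
    fix w b :: nat and xs :: "nat list"
    assume xs: "length xs = n" "set xs \<subseteq> {..<w}" and b: "w + length (gs @ [g]) \<le> b"
    let ?o = "w + length gs"
    from b have "?o \<le> b" by simp
    from p[rule_format, OF conjI[OF xs(1) conjI[OF xs(2) this]]] obtain c where c: "wf_prog c" and runs_c:
      "\<And>s vs. length vs = n \<Longrightarrow> (\<forall>r\<ge>w. s r = []) \<Longrightarrow> map s xs = map rep vs \<Longrightarrow>
        runs c s (poly p (insize vs))
          (\<lambda>r. if w \<le> r \<and> r < w + length gs then rep ((gs ! (r - w)) vs) else s r)" by blast
    have xs': "set xs \<subseteq> {..<b}" "?o < b" "?o \<notin> set xs" using xs b by auto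
    from q[OF xs(1) this] obtain d where d: "implements d b ?o xs g q" by blast
    show "\<exists>c. wf_prog c \<and> (\<forall>s vs. length vs = n \<longrightarrow> (\<forall>r\<ge>w. s r = []) \<longrightarrow> map s xs = map rep vs \<longrightarrow>
        runs c s (poly (p + q) (insize vs))
          (\<lambda>r. if w \<le> r \<and> r < w + length (gs @ [g]) then rep (((gs @ [g]) ! (r - w)) vs) else s r))"
    proof (intro exI[of _ "c ;; d"] conjI allI impI)
      fix s :: store and vs
      assume vs: "length vs = n" and s: "\<forall>r\<ge>w. s r = []" "map s xs = map rep vs"
      let ?s = "\<lambda>r. if w \<le> r \<and> r < w + length gs then rep ((gs ! (r - w)) vs) else s r"
      have "map ?s xs = map s xs" using xs by (auto simp: subset_iff)
      then have "runs d ?s (poly q (insize vs)) (?s(?o := rep (g vs)))"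
        using s vs xs(1) b by (intro implementsD(2)[OF d]) auto
      from runs_Seq[OF runs_c[OF vs s] this]
      show "runs (c ;; d) s (poly (p + q) (insize vs))
          (\<lambda>r. if w \<le> r \<and> r < w + length (gs @ [g]) then rep (((gs @ [g]) ! (r - w)) vs) else s r)"
        by (rule runs_eq) (auto simp: fun_eq_iff nth_append)
    qed (use c implementsD(1)[OF d] in simp)
  qed
qed

lemma fp_bounds:
  assumes "\<forall>g\<in>set gs. fp n g"
  shows "\<exists>p. \<forall>g\<in>set gs. \<forall>vs. length vs = n \<longrightarrow> floorlog 2 (g vs) \<le> poly p (insize vs)"
  using assms
proof (induction gs)
  case (Cons g gs)
  then obtain p where p: "\<forall>g\<in>set gs. \<forall>vs. length vs = n \<longrightarrow> floorlog 2 (g vs) \<le> poly p (insize vs)"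
    by auto
  have "fp n g" using Cons.prems by simp
  then obtain q where q: "\<And>vs. length vs = n \<Longrightarrow> floorlog 2 (g vs) \<le> poly q (insize vs)"
    by (rule fpE) metis
  show ?case using p q by (intro exI[of _ "p + q"]) (auto intro: trans_le_add1 trans_le_add2)
qed simp

lemma sum_list_le: "(\<And>x. x \<in> set xs \<Longrightarrow> f x \<le> (b::nat)) \<Longrightarrow> sum_list (map f xs) \<le> length xs * b"
  by (induction xs) (auto intro: add_mono)

lemma zero_notin_rep [simp]: "0 \<notin> set (rep n)"
  using set_rep[of n] by auto

lemma fp_comp:
  assumes "fp k h" "\<forall>g\<in>set gs. fp n g" "length gs = k"
  shows "fp n (\<lambda>vs. h (map (\<lambda>g. g vs) gs))"
proof -
  obtain p1 where p1: "\<forall>w b xs. length xs = n \<and> set xs \<subseteq> {..<w} \<and> w + length gs \<le> b \<longrightarrow>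
     (\<exists>c. wf_prog c \<and> (\<forall>s vs. length vs = n \<longrightarrow> (\<forall>r\<ge>w. s r = []) \<longrightarrow> map s xs = map rep vs \<longrightarrow>
        runs c s (poly p1 (insize vs))
          (\<lambda>r. if w \<le> r \<and> r < w + length gs then rep ((gs ! (r - w)) vs) else s r)))"
    using fp_calls[OF assms(2)] by (elim exE)
  obtain p2 where p2: "\<And>g vs. g \<in> set gs \<Longrightarrow> length vs = n \<Longrightarrow> floorlog 2 (g vs) \<le> poly p2 (insize vs)"
    using fp_bounds[OF assms(2)] by blast
  obtain p3 where p3:
    "\<And>w out xs. length xs = k \<Longrightarrow> set xs \<subseteq> {..<w} \<Longrightarrow> out < w \<Longrightarrow> out \<notin> set xs \<Longrightarrow>
     \<exists>c. implements c w out xs h p3"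
    using fpE[OF assms(1)] by metis
  \<comment> \<open>The arguments of \<open>h\<close> have total length at most
    \<open>k * p2\<close>, and \<open>p3\<close> is monotone; the last summand pays for clearing the
    \<open>k\<close> result registers, each of length at most \<open>p2\<close>.\<close>
  let ?p = "p1 + (pcompose p3 ([:k:] * p2) + [:k:] * ([:3:] * p2 + [:1:]))"
  show ?thesis
  proof (rule fpI[of _ _ ?p])
    fix w out :: nat and xs :: "nat list"
    assume xs: "length xs = n" "set xs \<subseteq> {..<w}" and out: "out < w" "out \<notin> set xs"
    have "w + length gs \<le> w + k" using assms(3) by simp
    from p1[rule_format, OF conjI[OF xs(1) conjI[OF xs(2) this]]] obtain c where c: "wf_prog c" and runs_c:
      "\<And>s vs. length vs = n \<Longrightarrow> (\<forall>r\<ge>w. s r = []) \<Longrightarrow> map s xs = map rep vs \<Longrightarrow>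
        runs c s (poly p1 (insize vs))
          (\<lambda>r. if w \<le> r \<and> r < w + k then rep ((gs ! (r - w)) vs) else s r)"
      unfolding assms(3) by blast
    have "length [w..<w + k] = k" "set [w..<w + k] \<subseteq> {..<w + k}" "out < w + k" "out \<notin> set [w..<w + k]"
      using out by auto
    from p3[OF this] obtain d where d: "implements d (w + k) out [w..<w + k] h p3" by blast
    show "\<exists>c. implements c w out xs (\<lambda>vs. h (map (\<lambda>g. g vs) gs)) ?p"
    proof (rule implementsI[of "c ;; d ;; clear_range w k"])
      fix s :: store and vs
      assume "length vs = length xs" and s: "\<forall>r\<ge>w. s r = []" "s out = []" "map s xs = map rep vs"
      then have vs: "length vs = n" using xs(1) by simp
      let ?N = "insize vs" and ?us = "map (\<lambda>g. g vs) gs"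
      let ?s = "\<lambda>r. if w \<le> r \<and> r < w + k then rep ((gs ! (r - w)) vs) else s r"
      have us: "insize ?us \<le> k * poly p2 ?N"
        using sum_list_le[of gs "\<lambda>g. floorlog 2 (g vs)" "poly p2 ?N"] p2 vs assms(3) by (simp add: comp_def)
      have "runs d ?s (poly p3 (insize ?us)) (?s(out := rep (h ?us)))"
        using s out assms(3) by (intro implementsD(2)[OF d]) (auto intro: nth_equalityI)
      then have 2: "runs d ?s (poly p3 (k * poly p2 ?N)) (?s(out := rep (h ?us)))"
        by (rule runs_mono) (rule poly_nat_mono[OF us])
      have 3: "runs (clear_range w k) (?s(out := rep (h ?us))) (k * (3 * poly p2 ?N + 1))
         (\<lambda>r. if w \<le> r \<and> r < w + k then [] else (?s(out := rep (h ?us))) r)"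
        by (rule runs_clear_range) (use p2 vs out assms(3) in auto)
      show "runs (c ;; d ;; clear_range w k) s (poly ?p ?N) (s(out := rep (h ?us)))"
        by (rule runs_eq[OF runs_Seq[OF runs_c[OF vs s(1,3)] runs_Seq[OF 2 3]]])
           (use s out in \<open>auto simp: fun_eq_iff poly_pcompose\<close>)
    qed (use c implementsD(1)[OF d] in simp)
  qed
qed

subsection \<open>Loops\<close>

text \<open>
  The step function receives the index in unary, as the number \<open>2 ^ i - 1\<close>: unlike a binary
  counter, its stack grows by a single push.
\<close>

primrec iterate :: "(nat list \<Rightarrow> nat) \<Rightarrow> nat list \<Rightarrow> nat \<Rightarrow> nat \<Rightarrow> nat" where
  "iterate F vs z 0 = z"
| "iterate F vs z (Suc i) = F ((2 ^ i - 1) # iterate F vs z i # vs)"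

lemma rep_ones: "rep (2 ^ i - 1) = replicate i 2"
proof (rule rep_unique)
  show "val (replicate i 2) = 2 ^ i - 1"
  proof (induction i)
    case (Suc i)
    have "(0::nat) < 2 ^ i" by simp
    with Suc show ?case by simp
  qed simp
qed (auto simp: is_rep_def)

lemma floorlog_ones [simp]: "floorlog 2 (2 ^ i - Suc 0) = i"
  by (metis One_nat_def length_rep length_replicate rep_ones)

text \<open>This is Cobham's bounded recursion on notation in iterative form: the number of rounds
  is the length of a value, and \<open>q\<close> keeps every intermediate value short. Without such
  a bound, lengths could double in every round.\<close>

lemma fp_iterate:
  assumes F: "fp (n + 2) F" and x: "fp n x" and z: "fp n z"
    and q: "\<And>vs i. length vs = n \<Longrightarrow> i \<le> floorlog 2 (x vs) \<Longrightarrow>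
      floorlog 2 (iterate F vs (z vs) i) \<le> poly q (insize vs)"
  shows "fp n (\<lambda>vs. iterate F vs (z vs) (floorlog 2 (x vs)))"
proof -
  obtain px where px:
    "\<And>w out xs. length xs = n \<Longrightarrow> set xs \<subseteq> {..<w} \<Longrightarrow> out < w \<Longrightarrow> out \<notin> set xs \<Longrightarrow>
     \<exists>c. implements c w out xs x px"
    and px': "\<And>vs. length vs = n \<Longrightarrow> floorlog 2 (x vs) \<le> poly px (insize vs)"
    using fpE[OF x] by metis
  obtain pz where pz:
    "\<And>w out xs. length xs = n \<Longrightarrow> set xs \<subseteq> {..<w} \<Longrightarrow> out < w \<Longrightarrow> out \<notin> set xs \<Longrightarrow>
     \<exists>c. implements c w out xs z pz"
    using fpE[OF z] by metis
  obtain pF where pF: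
    "\<And>w out xs. length xs = n + 2 \<Longrightarrow> set xs \<subseteq> {..<w} \<Longrightarrow> out < w \<Longrightarrow> out \<notin> set xs \<Longrightarrow>
     \<exists>c. implements c w out xs F pF"
    using fpE[OF F] by metis
  \<comment> \<open>One round consists of a pop, the call, a clearing at 3 per symbol, two moves at
    5 per symbol and a push: this gives the factor 13, and the constant costs add up to 6.\<close>
  let ?pT = "pcompose pF (px + (q + [:0, 1:])) + [:13:] * q + [:6:]"
  let ?p = "px + (pz + ((px * (?pT + [:2:]) + [:1:]) + (([:3:] * px + [:1:]) + (([:5:] * q + [:1:]) + ([:5:] * q + [:1:])))))"
  show ?thesis
  proof (rule fpI[of _ _ ?p])
    fix w out :: nat and xs :: "nat list"
    assume xs: "length xs = n" "set xs \<subseteq> {..<w}" and out: "out < w" "out \<notin> set xs"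
    \<comment> \<open>\<open>?X\<close> is popped once per round and drives the loop,
      \<open>?Z\<close> carries the current value, \<open>?U\<close> the index in unary,
      \<open>?Y\<close> the new value, and \<open>?T\<close> holds it reversed on its way back to
      \<open>?Z\<close>.\<close>
    let ?X = "w" and ?Z = "w + 1" and ?U = "w + 2" and ?Y = "w + 3" and ?T = "w + 4" and ?b = "w + 5"
    have b: "set xs \<subseteq> {..<?b}" using xs by auto
    have "?X < ?b" "?X \<notin> set xs" using xs by auto
    from px[OF xs(1) b this] obtain cx where cx: "implements cx ?b ?X xs x px" by blast
    have "?Z < ?b" "?Z \<notin> set xs" using xs by auto
    from pz[OF xs(1) b this] obtain cz where cz: "implements cz ?b ?Z xs z pz" by blast
    have "length (?U # ?Z # xs) = n + 2" "set (?U # ?Z # xs) \<subseteq> {..<?b}" "?Y < ?b" "?Y \<notin> set (?U # ?Z # xs)"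
      using xs by auto
    from pF[OF this] obtain cF where cF: "implements cF ?b ?Y (?U # ?Z # xs) F pF" by blast
    let ?body = "Pop ?X ;; cF ;; clear ?Z ;; move ?Y ?T ;; move ?T ?Z ;; Push ?U (\<lambda>_. 2)"
    let ?c = "cx ;; cz ;; While (\<lambda>\<sigma>. \<sigma> ?X \<noteq> 0) ?body ;; clear ?U ;; move ?Z ?T ;; move ?T out"
    show "\<exists>c. implements c w out xs (\<lambda>vs. iterate F vs (z vs) (floorlog 2 (x vs))) ?p"
    proof (rule implementsI[of ?c])
      fix s :: store and vs
      assume "length vs = length xs" and s: "\<forall>r\<ge>w. s r = []" "s out = []" "map s xs = map rep vs"
      then have vs: "length vs = n" using xs(1) by simp
      let ?N = "insize vs" and ?l = "floorlog 2 (x vs)" and ?it = "iterate F vs (z vs)"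
      let ?s = "\<lambda>X Z U Y T. s(?X := X, ?Z := Z, ?U := U, ?Y := Y, ?T := T)"
      have s0: "s = ?s [] [] [] [] []" using s by (auto simp: fun_eq_iff)
      have xs': "map (?s X Z U Y T) xs = map rep vs" for X Z U Y T
      proof -
        have "(?s X Z U Y T) r = s r" if "r \<in> set xs" for r
          using that xs(2) by auto
        then show ?thesis using s(3) by (simp cong: map_cong)
      qed
      have bb: "\<forall>r\<ge>?b. (?s X Z U Y T) r = []" for X Z U Y T using s by auto
      let ?S = "\<lambda>i. ?s (drop i (rep (x vs))) (rep (?it i)) (replicate i 2) [] []"
      have 1: "runs cx s (poly px ?N) (?s (rep (x vs)) [] [] [] [])"
        by (rule runs_eq[OF implementsD(2)[OF cx]]) (use s vs xs(1) in \<open>auto simp: fun_eq_iff\<close>)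
      have 2: "runs cz (?s (rep (x vs)) [] [] [] []) (poly pz ?N) (?S 0)"
        by (rule runs_eq[OF implementsD(2)[OF cz]]) (use s xs' vs xs(1) bb in \<open>auto simp: fun_eq_iff\<close>)
      have 3: "runs (While (\<lambda>\<sigma>. \<sigma> ?X \<noteq> 0) ?body) (?S 0) (?l * (poly ?pT ?N + 2) + 1) (?S ?l)"
      proof (rule runs_For)
        fix i assume i: "i < ?l"
        then have i': "i < length (rep (x vs))" by simp
        have "rep (x vs) ! i \<noteq> 0" using nth_mem[OF i'] set_rep[of "x vs"] zero_notin_rep by metis
        then show "tops (?S i) ?X \<noteq> 0" using i by (simp add: tops_def top_drop)
        let ?x = "drop (Suc i) (rep (x vs))" and ?u = "replicate i 2"
        have z: "floorlog 2 (?it i) \<le> poly q ?N" "floorlog 2 (?it (Suc i)) \<le> poly q ?N"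
          using q[OF vs, of i] q[OF vs, of "Suc i"] i by auto
        have sz: "insize ((2 ^ i - 1) # ?it i # vs) \<le> poly (px + (q + [:0, 1:])) ?N"
          using z i px'[OF vs] by simp
        have a: "runs (Pop ?X) (?S i) 1 (?s ?x (rep (?it i)) ?u [] [])"
          by (rule runs_eq[OF runs_Pop]) (auto simp: fun_eq_iff tl_drop')
        have "runs cF (?s ?x (rep (?it i)) ?u [] []) (poly pF (insize ((2 ^ i - 1) # ?it i # vs)))
            ((?s ?x (rep (?it i)) ?u [] [])(?Y := rep (F ((2 ^ i - 1) # ?it i # vs))))"
        proof (rule implementsD(2)[OF cF])
          show "map (?s ?x (rep (?it i)) ?u [] []) (?U # ?Z # xs) = map rep ((2 ^ i - 1) # ?it i # vs)"
            using xs' by (simp add: rep_ones del: One_nat_def)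
        qed (use vs xs(1) bb in simp_all)
        then have b: "runs cF (?s ?x (rep (?it i)) ?u [] []) (poly (pcompose pF (px + (q + [:0, 1:]))) ?N)
            (?s ?x (rep (?it i)) ?u (rep (?it (Suc i))) [])"
          by (rule runs_eq) (use poly_nat_mono[OF sz] in \<open>simp_all add: fun_eq_iff poly_pcompose\<close>)
        have c: "runs (clear ?Z) (?s ?x (rep (?it i)) ?u (rep (?it (Suc i))) []) (3 * poly q ?N + 1)
            (?s ?x [] ?u (rep (?it (Suc i))) [])"
          by (rule runs_clear) (use z in \<open>simp_all add: fun_eq_iff\<close>)
        have d: "runs (move ?Y ?T) (?s ?x [] ?u (rep (?it (Suc i))) []) (5 * poly q ?N + 1)
            (?s ?x [] ?u [] (rev (rep (?it (Suc i)))))"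
          by (rule runs_move) (use z set_rep in \<open>simp_all add: fun_eq_iff\<close>)
        have e: "runs (move ?T ?Z) (?s ?x [] ?u [] (rev (rep (?it (Suc i))))) (5 * poly q ?N + 1)
            (?s ?x (rep (?it (Suc i))) ?u [] [])"
          by (rule runs_move) (use z set_rep in \<open>simp_all add: fun_eq_iff\<close>)
        have f: "runs (Push ?U (\<lambda>_. 2)) (?s ?x (rep (?it (Suc i))) ?u [] []) 2 (?S (Suc i))"
          by (rule runs_eq[OF runs_Push]) (simp_all add: fun_eq_iff)
        show "runs ?body (?S i) (poly ?pT ?N) (?S (Suc i))"
          by (rule runs_eq[OF runs_Seq[OF a runs_Seq[OF b runs_Seq[OF c runs_Seq[OF d runs_Seq[OF e f]]]]] refl])
             simp
      qed (simp add: tops_def)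
      have l: "?l \<le> poly px ?N" by (rule px'[OF vs])
      have zl: "floorlog 2 (?it ?l) \<le> poly q ?N" using q[OF vs] by simp
      have l': "?l * (poly ?pT ?N + 2) + 1 \<le> poly px ?N * (poly ?pT ?N + 2) + 1"
        by (intro add_mono mult_le_mono1 l order_refl)
      have 3: "runs (While (\<lambda>\<sigma>. \<sigma> ?X \<noteq> 0) ?body) (?S 0) (poly px ?N * (poly ?pT ?N + 2) + 1)
          (?s [] (rep (?it ?l)) (replicate ?l 2) [] [])"
        by (rule runs_eq[OF 3 _ l']) simp
      have 4: "runs (clear ?U) (?s [] (rep (?it ?l)) (replicate ?l 2) [] []) (3 * poly px ?N + 1)
          (?s [] (rep (?it ?l)) [] [] [])"
        by (rule runs_clear) (use l in \<open>simp_all add: fun_eq_iff\<close>)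
      have 5: "runs (move ?Z ?T) (?s [] (rep (?it ?l)) [] [] []) (5 * poly q ?N + 1)
          (?s [] [] [] [] (rev (rep (?it ?l))))"
        by (rule runs_move) (use zl set_rep in \<open>simp_all add: fun_eq_iff\<close>)
      have 6: "runs (move ?T out) (?s [] [] [] [] (rev (rep (?it ?l)))) (5 * poly q ?N + 1)
          (s(out := rep (?it ?l)))"
        by (rule runs_move) (use zl set_rep out s in \<open>simp_all add: fun_eq_iff\<close>)
      show "runs ?c s (poly ?p ?N) (s(out := rep (?it ?l)))"
        by (rule runs_eq[OF runs_Seq[OF 1 runs_Seq[OF 2 runs_Seq[OF 3 runs_Seq[OF 4 runs_Seq[OF 5 6]]]]] refl])
           simp
    qed (use implementsD(1)[OF cx] implementsD(1)[OF cz] implementsD(1)[OF cF] in simp)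
  qed
qed


subsection \<open>Stack programs compute polynomial-time functions\<close>

lemma tape_of_rep: "tape_of (rep y) = (binary y, int (floorlog 2 y) - 1)"
  by (auto simp: tape_of_def binary_def fun_eq_iff rep_def)

lemma code_valid:
  assumes "wf_com m g c" "0 < g" "k + clen c \<le> N" "\<delta> \<in> set (code m k c)"
    and "length as = m" "set as \<subseteq> {..<g}"
  shows "fst (\<delta> as) \<le> N \<and> length (snd (\<delta> as)) = m \<and> set (snd (\<delta> as)) \<subseteq> {..<g} \<times> {-1, 0, 1}"
proof -
  have nth: "as ! i < g" if "i < m" for i using assms(5,6) that by (auto simp: subset_iff)
  have stay: "length (stay m as) = m" "set (stay m as) \<subseteq> {..<g} \<times> {-1, 0, 1}"
    using nth by (auto simp: stay_def)
  have upd: "length (upd m r x d as) = m"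
    "x < g \<Longrightarrow> d \<in> {-1, 0, 1} \<Longrightarrow> set (upd m r x d as) \<subseteq> {..<g} \<times> {-1, 0, 1}" for r x d
    using nth by (auto simp: upd_def)
  show ?thesis using assms(1,3,4)
  proof (induction c arbitrary: k)
    case (Push r f)
    then have "f (nthd as) < g" "as ! r < g" using nth by auto
    then have "set (upd m r (as ! r) 1 as) \<subseteq> {..<g} \<times> {-1, 0, 1}"
      "set (upd m r (f (nthd as)) 0 as) \<subseteq> {..<g} \<times> {-1, 0, 1}" by (intro upd(2); simp)+
    moreover have "\<delta> = (\<lambda>as. (k + 1, upd m r (as ! r) 1 as)) \<or>
        \<delta> = (\<lambda>as. (k + 2, upd m r (f (nthd as)) 0 as))" using Push.prems by auto
    ultimately show ?case using Push.prems(2) upd(1) by (elim disjE) simp_all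
  next
    case (Pop r)
    then show ?case using upd assms(2) by auto
  next
    case (Seq c d)
    from Seq.prems consider "\<delta> \<in> set (code m k c)" | "\<delta> \<in> set (code m (k + clen c) d)" by auto
    then show ?case
    proof cases
      case 1 then show ?thesis using Seq.prems by (intro Seq.IH(1)) simp_all
    next
      case 2 then show ?thesis using Seq.prems by (intro Seq.IH(2)) simp_all
    qed
  next
    case (Cond b c d)
    from Cond.prems consider "\<delta> \<in> set (code m (k + 1) c)" | "\<delta> \<in> set (code m (k + clen c + 2) d)"
      | "\<delta> = (\<lambda>as. (if b (nthd as) then k + 1 else k + clen c + 2, stay m as))"
      | "\<delta> = (\<lambda>as. (k + clen c + clen d + 2, stay m as))" by auto
    then show ?case
    proof cases
      case 1 then show ?thesis using Cond.prems by (intro Cond.IH(1)) simp_all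
    next
      case 2 then show ?thesis using Cond.prems by (intro Cond.IH(2)) simp_all
    qed (use Cond.prems stay in simp_all)
  next
    case (While b c)
    from While.prems consider "\<delta> \<in> set (code m (k + 1) c)"
      | "\<delta> = (\<lambda>as. (if b (nthd as) then k + 1 else k + clen c + 2, stay m as))"
      | "\<delta> = (\<lambda>as. (k, stay m as))" by auto
    then show ?case
    proof cases
      case 1 then show ?thesis using While.prems by (intro While.IH) simp_all
    qed (use While.prems stay in simp_all)
  qed simp
qed

text \<open>The heads start on cell 0, the bottom of the stacks, and are first moved to their tops.\<close>

definition wind :: "nat \<Rightarrow> nat list \<Rightarrow> nat \<times> (nat \<times> int) list" where
  "wind m as = (if \<forall>a\<in>set as. a = 0 then (1, map (\<lambda>i. (0, -1)) [0..<m])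
     else (0, map (\<lambda>i. if as ! i = 0 then (0, 0) else (as ! i, 1)) [0..<m]))"

definition winding :: "nat \<Rightarrow> store \<Rightarrow> nat \<Rightarrow> tape list" where
  "winding m s j = map (\<lambda>r. (fst (tape_of (s r)), int (min j (length (s r))))) [0..<m]"

lemma scan_winding:
  assumes "good_store m s"
  shows "map (\<lambda>(c, p). c p) (winding m s j) =
    map (\<lambda>r. if j < length (s r) then rev (s r) ! j else 0) [0..<m]"
    and "j < length (s r) \<Longrightarrow> rev (s r) ! j \<noteq> 0"
proof -
  show "map (\<lambda>(c, p). c p) (winding m s j) =
    map (\<lambda>r. if j < length (s r) then rev (s r) ! j else 0) [0..<m]"
    by (auto simp: winding_def tape_of_def)
  assume "j < length (s r)"
  then have "rev (s r) ! j \<in> set (s r)" by (metis length_rev nth_mem set_rev)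
  then show "rev (s r) ! j \<noteq> 0" using assms by (metis good_store_def)
qed

text \<open>Heads on shorter stacks wait at their first blank while the longest stack is still being
  crossed, which takes \<open>J\<close> rounds. After that every head is one cell above its top, and
  one common step to the left finishes.\<close>

lemma wind_steps:
  assumes M: "M ! 0 = wind m" "M \<noteq> []" and s: "good_store m s" and j: "j \<le> J"
    and J: "\<And>j. j < J \<Longrightarrow> \<exists>r<m. j < length (s r)"
  shows "(tm_step M ^^ j) (0, winding m s 0) = (0, winding m s j)"
  using j
proof (induction j)
  case (Suc j)
  let ?as = "map (\<lambda>r. if j < length (s r) then rev (s r) ! j else 0) [0..<m]"
  from J[of j] Suc.prems obtain r where r: "r < m" "j < length (s r)" by auto
  have nz: "\<not> (\<forall>a\<in>set ?as. a = 0)"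
  proof
    assume "\<forall>a\<in>set ?as. a = 0"
    then have "?as ! r = 0" by (rule bspec) (use r(1) in \<open>intro nth_mem, simp\<close>)
    then show False using r scan_winding(2)[OF s r(2)] by simp
  qed
  have w: "wind m ?as = (0, map (\<lambda>i. if ?as ! i = 0 then (0, 0) else (?as ! i, 1)) [0..<m])"
    by (simp only: wind_def nz if_False)
  have "tm_step M (0, winding m s j) = (0, map2 (\<lambda>(c, p) (a, d). (c(p := a), p + d)) (winding m s j)
      (map (\<lambda>i. if ?as ! i = 0 then (0, 0) else (?as ! i, 1)) [0..<m]))"
    using M by (simp add: tm_step_def scan_winding(1)[OF s] w)
  also have "map2 (\<lambda>(c, p) (a, d). (c(p := a), p + d)) (winding m s j)
      (map (\<lambda>i. if ?as ! i = 0 then (0, 0) else (?as ! i, 1)) [0..<m]) = winding m s (Suc j)"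
  proof (intro nth_equalityI)
    fix i
    assume "i < length (map2 (\<lambda>(c, p) (a, d). (c(p := a), p + d)) (winding m s j)
      (map (\<lambda>i. if ?as ! i = 0 then (0, 0) else (?as ! i, 1)) [0..<m]))"
    then have i: "i < m" by (simp add: winding_def)
    have *: "(fst (tape_of (s i)))(int j := rev (s i) ! j) = fst (tape_of (s i))" if "j < length (s i)"
      using that by (auto simp: tape_of_def)
    have **: "(fst (tape_of (s i)))(int (length (s i)) := 0) = fst (tape_of (s i))"
      by (auto simp: tape_of_def)
    show "map2 (\<lambda>(c, p) (a, d). (c(p := a), p + d)) (winding m s j)
      (map (\<lambda>i. if ?as ! i = 0 then (0, 0) else (?as ! i, 1)) [0..<m]) ! i = winding m s (Suc j) ! i"
      using i scan_winding(2)[OF s, of j i] * ** by (simp add: winding_def min_def)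
  qed (simp add: winding_def)
  finally show ?case using Suc.IH Suc.prems by simp
qed simp

lemma wind_final:
  assumes M: "M ! 0 = wind m" "M \<noteq> []" and s: "good_store m s"
    and J: "\<And>r. r < m \<Longrightarrow> length (s r) \<le> J"
  shows "tm_step M (0, winding m s J) = (1, tapes_of m s)"
proof -
  let ?as = "map (\<lambda>r. if J < length (s r) then rev (s r) ! J else 0) [0..<m]"
  have "?as = map (\<lambda>_. 0) [0..<m]" using J by (auto simp: not_less[symmetric])
  then have z: "\<forall>a\<in>set ?as. a = 0" by auto
  have w: "wind m ?as = (1, map (\<lambda>i. (0, -1)) [0..<m])"
    unfolding wind_def by (rule if_P[OF z])
  have "tm_step M (0, winding m s J) = (1, map2 (\<lambda>(c, p) (a, d). (c(p := a), p + d)) (winding m s J)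
      (map (\<lambda>i. (0, -1)) [0..<m]))"
    using M by (simp add: tm_step_def scan_winding(1)[OF s] w)
  also have "map2 (\<lambda>(c, p) (a, d). (c(p := a), p + d)) (winding m s J) (map (\<lambda>i. (0, -1)) [0..<m]) =
      tapes_of m s"
    using J by (intro nth_equalityI)
      (auto simp: winding_def tapes_of_def tape_of_def fun_eq_iff min_def dest: le_antisym)
  finally show ?thesis .
qed

text \<open>State 0 positions the heads and the compiled program follows from state 1, so that
  leaving its block is halting. The registers are chosen to agree with the conventions for tapes:
  output 0, inputs from 1 on.\<close>

lemma fp_imp_poly_time:
  assumes "fp k f"
  shows "poly_time k f"
proof -
  obtain p where p:
    "\<And>w out xs. length xs = k \<Longrightarrow> set xs \<subseteq> {..<w} \<Longrightarrow> out < w \<Longrightarrow> out \<notin> set xs \<Longrightarrow>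
     \<exists>c. implements c w out xs f p"
    using fpE[OF assms] by metis
  have "length [1..<k + 1] = k" "set [1..<k + 1] \<subseteq> {..<k + 1}" "0 < k + 1" "0 \<notin> set [1..<k + 1]"
    by auto
  from p[OF this] obtain c where c: "implements c (k + 1) 0 [1..<k + 1] f p" by blast
  obtain m0 g0 where "wf_com m0 g0 c" using implementsD(1)[OF c] by (auto simp: wf_prog_def)
  define m g where "m = max m0 (k + 1)" and "g = max g0 3"
  have wf: "wf_com m g c" using \<open>wf_com m0 g0 c\<close> by (rule wf_com_mono) (auto simp: m_def g_def)
  have m: "k < m" and g: "2 < g" by (auto simp: m_def g_def)
  define M where "M = wind m # code m 1 c"
  have M0: "M ! 0 = wind m" "M \<noteq> []" by (auto simp: M_def)
  have tm: "turing_machine m g M"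
    unfolding turing_machine_def
  proof (intro ballI allI impI, elim conjE)
    fix \<delta> and as :: "nat list"
    assume \<delta>: "\<delta> \<in> set M" and as: "length as = m" "set as \<subseteq> {..<g}"
    have nth: "as ! i < g" if "i < m" for i using as that by (auto simp: subset_iff)
    show "fst (\<delta> as) \<le> length M \<and> length (snd (\<delta> as)) = m \<and> set (snd (\<delta> as)) \<subseteq> {..<g} \<times> {-1, 0, 1}"
    proof (cases "\<delta> = wind m")
      case True
      then show ?thesis using nth g by (auto simp: wind_def M_def)
    next
      case False
      then have "\<delta> \<in> set (code m 1 c)" using \<delta> by (simp add: M_def)
      with wf g as show ?thesis by (intro code_valid) (auto simp: M_def)
    qed
  qed
  \<comment> \<open>Winding takes at most as many rounds as the total input length, and one more
    step moves the heads back; this is the summand \<open>[:1, 1:]\<close>.\<close>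
  have "computes_within m M vs (f vs) (poly ([:1, 1:] + p) (insize vs))" if vs: "length vs = k" for vs
  proof -
    define s where "s = (\<lambda>r. if r \<in> {1..k} then rep (vs ! (r - 1)) else [])"
    have good: "good_store m s" using m by (auto simp: good_store_def s_def)
    have start: "start_tapes m vs = winding m s 0"
      using vs by (auto simp: start_tapes_def winding_def s_def tape_of_rep) (auto simp: tape_of_def)
    define J where "J = Max ((\<lambda>r. length (s r)) ` {..<m})"
    have fin: "finite ((\<lambda>r. length (s r)) ` {..<m})" "(\<lambda>r. length (s r)) ` {..<m} \<noteq> {}"
      using m by auto
    have J1: "length (s r) \<le> J" if "r < m" for r
      unfolding J_def using that fin by (intro Max_ge) auto
    obtain r where r: "r < m" "length (s r) = J" using Max_in[OF fin] by (auto simp: J_def)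
    then have J2: "\<exists>r<m. j < length (s r)" if "j < J" for j using that by auto
    have J3: "J \<le> insize vs"
    proof (cases "r \<in> {1..k}")
      case True
      then have "floorlog 2 (vs ! (r - 1)) \<le> insize vs" using vs by (intro floorlog_le_insize) auto
      then show ?thesis using r True by (simp add: s_def)
    next
      case False
      then have "s r = []" by (auto simp: s_def)
      then show ?thesis using r by simp
    qed
    have "map s [1..<k + 1] = map rep vs"
      using vs by (intro nth_equalityI) (auto simp: s_def simp del: upt_Suc)
    then have "runs c s (poly p (insize vs)) (s(0 := rep (f vs)))"
      using vs by (intro implementsD(2)[OF c]) (auto simp: s_def)
    then obtain t where t: "t \<le> poly p (insize vs)" "exec c s t (s(0 := rep (f vs)))"
      by (auto simp: runs_def)
    have "code_at M 1 (code m 1 c)" by (simp add: code_at_def M_def)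
    from exec_code[OF t(2) wf good this]
    have 3: "(tm_step M ^^ t) (1, tapes_of m s) = (length M, tapes_of m (s(0 := rep (f vs))))"
      by (simp add: M_def)
    have 2: "(tm_step M ^^ 1) (0, winding m s J) = (1, tapes_of m s)"
      using wind_final[OF M0 good J1] by simp
    have 1: "(tm_step M ^^ J) (0, start_tapes m vs) = (0, winding m s J)"
      unfolding start by (rule wind_steps[OF M0 good order_refl J2])
    have "fst (tapes_of m (s(0 := rep (f vs))) ! 0) = binary (f vs)"
      using m by (simp add: tapes_of_def tape_of_rep)
    moreover have "J + 1 + t \<le> poly ([:1, 1:] + p) (insize vs)" using J3 t(1) by simp
    ultimately show ?thesis
      using funpow_trans[OF funpow_trans[OF 1 2] 3] unfolding computes_within_def by blast
  qed
  then show ?thesis using m g tm unfolding poly_time_def by blast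
qed


subsection \<open>Polynomial-time functions are computed by stack programs\<close>

text \<open>
  The two halves of a tape are kept on two stacks, with the scanned cell on top of the right one.
  The symbols are incremented, so that blanks can be stacked and an empty stack reads as a blank.
\<close>

definition half_rel :: "nat \<Rightarrow> (int \<Rightarrow> nat) \<Rightarrow> int \<Rightarrow> nat list \<times> nat list \<Rightarrow> bool" where
  "half_rel g c p lr \<longleftrightarrow> (\<forall>j. c (p - 1 - int j) = nthd (fst lr) j - 1) \<and>
     (\<forall>j. c (p + int j) = nthd (snd lr) j - 1) \<and> set (fst lr) \<union> set (snd lr) \<subseteq> {1..g}"

text \<open>To the right, unexplored tape is left unstored, as an empty stack already reads as
  blank. To the left a blank has to be created explicitly, with code 1, since it goes on top of
  symbols that are stored.\<close>

definition act :: "nat \<Rightarrow> int \<Rightarrow> nat list \<times> nat list \<Rightarrow> nat list \<times> nat list" where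
  "act a d lr = (case lr of (l, r) \<Rightarrow>
     if d = 1 then (Suc a # l, tl r)
     else if d = -1 then (tl l, (if topsym l = 0 then 1 else topsym l) # Suc a # tl r)
     else (l, Suc a # tl r))"

lemma nthd_simps [simp]: "nthd [] j = 0" "nthd (x # xs) 0 = x" "nthd (x # xs) (Suc j) = nthd xs j"
  by (auto simp: nthd_def)

lemma nthd_tl: "nthd (tl xs) j = nthd xs (Suc j)"
  by (cases xs) auto

lemma half_rel_scan: "half_rel g c p lr \<Longrightarrow> c p = topsym (snd lr) - 1"
proof -
  assume "half_rel g c p lr"
  then have "c (p + int 0) = nthd (snd lr) 0 - 1" unfolding half_rel_def by blast
  then show ?thesis by (cases "snd lr") auto
qed

lemma half_rel_act:
  assumes "half_rel g c p lr" "a < g" "d \<in> {-1, 0, 1}"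
  shows "half_rel g (c(p := a)) (p + d) (act a d lr)"
proof -
  obtain l r where lr: "lr = (l, r)" by fastforce
  have L: "c (p - 1 - int j) = nthd l j - 1" and R: "c (p + int j) = nthd r j - 1" for j
    using assms(1) by (auto simp: half_rel_def lr)
  have sets: "set l \<subseteq> {1..g}" "set r \<subseteq> {1..g}" "set (tl l) \<subseteq> {1..g}" "set (tl r) \<subseteq> {1..g}"
    using assms(1) list.set_sel(2)[of l] list.set_sel(2)[of r]
    by (cases l; cases r; auto simp: half_rel_def lr)+
  have a: "Suc a \<in> {1..g}" using assms(2) by auto
  consider "d = 1" | "d = 0" | "d = -1" using assms(3) by auto
  then show ?thesis
  proof cases
    case 1
    have "(c(p := a)) (p + 1 - 1 - int j) = nthd (Suc a # l) j - 1" for j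
      using L[of "j - 1"] by (cases j) (auto simp: algebra_simps)
    moreover have "(c(p := a)) (p + 1 + int j) = nthd (tl r) j - 1" for j
      using R[of "Suc j"] by (auto simp: nthd_tl algebra_simps)
    ultimately show ?thesis using sets a 1 by (simp add: half_rel_def act_def lr)
  next
    case 2
    have "(c(p := a)) (p + int j) = nthd (Suc a # tl r) j - 1" for j
      using R[of j] by (cases j) (auto simp: nthd_tl)
    then show ?thesis using sets a 2 L by (simp add: half_rel_def act_def lr)
  next
    case 3
    let ?t = "if topsym l = 0 then 1 else topsym l"
    have t: "?t \<in> {1..g}" using sets(1) assms(2) by (cases l) auto
    have t': "nthd l 0 - 1 = ?t - 1" by (cases l) auto
    have "(c(p := a)) (p - 1 - 1 - int j) = nthd (tl l) j - 1" for j
      using L[of "Suc j"] by (auto simp: nthd_tl algebra_simps)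
    moreover have "(c(p := a)) (p - 1 + int j) = nthd (?t # Suc a # tl r) j - 1" for j
    proof (cases j)
      case 0
      then show ?thesis using L[of 0] t' by simp
    next
      case (Suc i)
      then show ?thesis using R[of i] by (cases i) (auto simp: nthd_tl algebra_simps)
    qed
    ultimately show ?thesis using sets a t 3 by (simp add: half_rel_def act_def lr)
  qed
qed

text \<open>Register \<open>w\<close> holds the state of the machine, and \<open>w + 1\<close> the state and the scanned symbols
  while a step is carried out.\<close>

definition lreg :: "nat \<Rightarrow> nat \<Rightarrow> nat" where
  "lreg w i = w + 2 + 2 * i"

definition rreg :: "nat \<Rightarrow> nat \<Rightarrow> nat" where
  "rreg w i = w + 3 + 2 * i"

definition conf_store :: "nat \<Rightarrow> store \<Rightarrow> nat list \<Rightarrow> nat list \<Rightarrow> (nat list \<times> nat list) list \<Rightarrow> store" where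
  "conf_store w s qs ds lrs = (\<lambda>r. if r < w then s r else if r = w then qs else if r = w + 1 then ds
     else if (r - w - 2) div 2 < length lrs then
       (if even (r - w) then fst (lrs ! ((r - w - 2) div 2)) else snd (lrs ! ((r - w - 2) div 2)))
     else [])"

lemma conf_store_simps [simp]:
  "r < w \<Longrightarrow> conf_store w s qs ds lrs r = s r"
  "conf_store w s qs ds lrs w = qs"
  "conf_store w s qs ds lrs (Suc w) = ds"
  "i < length lrs \<Longrightarrow> conf_store w s qs ds lrs (lreg w i) = fst (lrs ! i)"
  "i < length lrs \<Longrightarrow> conf_store w s qs ds lrs (rreg w i) = snd (lrs ! i)"
  "w + 2 + 2 * length lrs \<le> r \<Longrightarrow> conf_store w s qs ds lrs r = []"
  by (auto simp: conf_store_def lreg_def rreg_def)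

lemma reg_neq [simp]:
  "lreg w i \<noteq> w" "lreg w i \<noteq> Suc w" "rreg w i \<noteq> w" "rreg w i \<noteq> Suc w" "lreg w i \<noteq> rreg w j"
  "rreg w j \<noteq> lreg w i" "w \<noteq> lreg w i" "w \<noteq> rreg w i" "Suc w \<noteq> lreg w i" "Suc w \<noteq> rreg w i"
  by (auto simp: lreg_def rreg_def) presburger+

lemma conf_store_upd [simp]:
  "(conf_store w s qs ds lrs)(w := qs') = conf_store w s qs' ds lrs"
  "(conf_store w s qs ds lrs)(Suc w := ds') = conf_store w s qs ds' lrs"
  by (auto simp: conf_store_def fun_eq_iff)

lemma conf_store_upd_reg:
  assumes "i < length lrs"
  shows "(conf_store w s qs ds lrs)(lreg w i := l) = conf_store w s qs ds (lrs[i := (l, snd (lrs ! i))])"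
    and "(conf_store w s qs ds lrs)(rreg w i := r) = conf_store w s qs ds (lrs[i := (fst (lrs ! i), r)])"
proof -
  have cases: "k < w \<or> k = w \<or> k = w + 1 \<or> (\<exists>j. k = lreg w j) \<or> (\<exists>j. k = rreg w j)" for k
  proof -
    have "k = w + 2 + 2 * ((k - w - 2) div 2) \<or> k = w + 3 + 2 * ((k - w - 2) div 2)" if "w + 2 \<le> k"
      using that by presburger
    then show ?thesis unfolding lreg_def rreg_def by (metis Suc_eq_plus1 add_2_eq_Suc' le_less_Suc_eq less_Suc_eq_le not_less)
  qed
  have inj: "lreg w i = lreg w j \<longleftrightarrow> i = j" "rreg w i = rreg w j \<longleftrightarrow> i = j" for i j
    by (auto simp: lreg_def rreg_def)
  have reg: "conf_store w s qs ds ls (lreg w j) = (if j < length ls then fst (ls ! j) else [])"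
    "conf_store w s qs ds ls (rreg w j) = (if j < length ls then snd (ls ! j) else [])" for ls j
    by (auto simp: conf_store_def lreg_def rreg_def)
  have "((conf_store w s qs ds lrs)(lreg w i := l)) k = conf_store w s qs ds (lrs[i := (l, snd (lrs ! i))]) k"
    "((conf_store w s qs ds lrs)(rreg w i := r)) k = conf_store w s qs ds (lrs[i := (fst (lrs ! i), r)]) k" for k
  proof -
    have "k < w \<Longrightarrow> k \<noteq> lreg w i \<and> k \<noteq> rreg w i" by (auto simp: lreg_def rreg_def)
    then show
      "((conf_store w s qs ds lrs)(lreg w i := l)) k = conf_store w s qs ds (lrs[i := (l, snd (lrs ! i))]) k"
      "((conf_store w s qs ds lrs)(rreg w i := r)) k = conf_store w s qs ds (lrs[i := (fst (lrs ! i), r)]) k"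
      using cases[of k] assms by (elim disjE exE; simp add: inj reg nth_list_update)+
  qed
  then show "(conf_store w s qs ds lrs)(lreg w i := l) = conf_store w s qs ds (lrs[i := (l, snd (lrs ! i))])"
    "(conf_store w s qs ds lrs)(rreg w i := r) = conf_store w s qs ds (lrs[i := (fst (lrs ! i), r)])"
    by auto
qed

section \<open>Simulation of a fixed Turing machine by a stack program\<close>

context
  fixes m g :: nat and M :: machine
  assumes tm: "turing_machine m g M" and g: "2 < g" and m: "0 < m"
begin

text \<open>Tapes are updated one after the other, which destroys the scanned symbols. State and
  symbols are therefore packed by \<open>list_encode\<close> into a single symbol in register
  \<open>w + 1\<close>, from which each update recovers its action; the shift by one keeps that
  symbol nonzero.\<close>

definition dec_step :: "nat \<Rightarrow> nat \<times> (nat \<times> int) list" where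
  "dec_step x = (M ! hd (list_decode (x - 1))) (tl (list_decode (x - 1)))"

text \<open>The guards only serve to make the pushed symbols bounded.\<close>

definition enc_scan :: "nat \<Rightarrow> (nat \<Rightarrow> nat) \<Rightarrow> nat" where
  "enc_scan w \<sigma> = (let q = \<sigma> w - 1; as = map (\<lambda>i. \<sigma> (rreg w i) - 1) [0..<m] in
     if q < length M \<and> set as \<subseteq> {..<g} then Suc (list_encode (q # as)) else 1)"

definition new_sym :: "nat \<Rightarrow> nat \<Rightarrow> nat" where
  "new_sym i x = min g (Suc (fst (snd (dec_step x) ! i)))"

definition new_dir :: "nat \<Rightarrow> nat \<Rightarrow> int" where
  "new_dir i x = snd (snd (dec_step x) ! i)"

text \<open>In a move to the left, the neighbouring symbol is still on top of
  \<open>lreg w i\<close> when it is pushed onto the right stack, and only then popped. No push here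
  inspects the stack that it extends, as the semantics demands.\<close>

definition step_tape :: "nat \<Rightarrow> nat \<Rightarrow> com" where
  "step_tape w i =
     Pop (rreg w i) ;;
     Cond (\<lambda>\<sigma>. new_dir i (\<sigma> (Suc w)) = 1)
       (Push (lreg w i) (\<lambda>\<sigma>. new_sym i (\<sigma> (Suc w))))
       (Push (rreg w i) (\<lambda>\<sigma>. new_sym i (\<sigma> (Suc w))) ;;
        Cond (\<lambda>\<sigma>. new_dir i (\<sigma> (Suc w)) = -1)
          (Push (rreg w i) (\<lambda>\<sigma>. if \<sigma> (lreg w i) = 0 then 1 else min g (\<sigma> (lreg w i))) ;;
           Pop (lreg w i))
          Skip)"

fun step_tapes :: "nat \<Rightarrow> nat \<Rightarrow> com" where
  "step_tapes w 0 = Skip"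
| "step_tapes w (Suc i) = step_tapes w i ;; step_tape w i"

definition step_prog :: "nat \<Rightarrow> com" where
  "step_prog w = Push (Suc w) (enc_scan w) ;; step_tapes w m ;; Pop w ;;
     Push w (\<lambda>\<sigma>. Suc (min (length M) (fst (dec_step (\<sigma> (Suc w)))))) ;; Pop (Suc w)"

lemma wf_prog_step_tape: "wf_prog (step_tape w i)"
proof -
  have "wf_prog (Push r (\<lambda>\<sigma>. new_sym i (\<sigma> (Suc w))))" for r
    by (rule wf_prog_Push[of _ "Suc g"]) (use g in \<open>auto simp: new_sym_def\<close>)
  moreover have "wf_prog (Push r (\<lambda>\<sigma>. if \<sigma> (lreg w i) = 0 then 1 else min g (\<sigma> (lreg w i))))" for r
    by (rule wf_prog_Push[of _ "Suc g"]) (use g in auto)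
  ultimately show ?thesis by (simp add: step_tape_def)
qed

lemma wf_prog_step: "wf_prog (step_prog w)"
proof -
  have "wf_prog (step_tapes w i)" for i by (induction i) (auto simp: wf_prog_step_tape)
  moreover have "wf_prog (Push w (\<lambda>\<sigma>. Suc (min (length M) (fst (dec_step (\<sigma> (Suc w)))))))"
    by (rule wf_prog_Push[of _ "length M + 2"]) auto
  moreover have "wf_prog (Push (Suc w) (enc_scan w))"
  proof -
    \<comment> \<open>There are only finitely many combinations of a state with \<open>m\<close>
      scanned symbols, and the guard sends everything else to 1; the largest code bounds the
      alphabet.\<close>
    let ?A = "(\<lambda>(q, as). Suc (list_encode (q # as))) ` ({..<length M} \<times> {as. set as \<subseteq> {..<g} \<and> length as = m})"
    have fin: "finite (insert 1 ?A)" using finite_lists_length_eq[of "{..<g}" m] by auto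
    show ?thesis
    proof (rule wf_prog_Push[of _ "Suc (Max (insert 1 ?A))"])
      fix \<sigma> :: "nat \<Rightarrow> nat"
      have "enc_scan w \<sigma> \<in> insert 1 ?A" by (force simp: enc_scan_def Let_def)
      then have "enc_scan w \<sigma> \<le> Max (insert 1 ?A)" using fin by (rule Max_ge[rotated])
      moreover have "0 < enc_scan w \<sigma>" by (simp add: enc_scan_def Let_def)
      ultimately show "0 < enc_scan w \<sigma> \<and> enc_scan w \<sigma> < Suc (Max (insert 1 ?A))" by simp
    qed
  qed
  ultimately show ?thesis by (simp add: step_prog_def)
qed

lemma runs_step_tape:
  assumes "i < length lrs" "set (fst (lrs ! i)) \<subseteq> {1..g}" "0 < new_sym i x"
  shows "runs (step_tape w i) (conf_store w s qs [x] lrs) 12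
    (conf_store w s qs [x] (lrs[i := act (new_sym i x - 1) (new_dir i x) (lrs ! i)]))"
proof -
  obtain l r where lr: "lrs ! i = (l, r)" by fastforce
  let ?C = "\<lambda>l r. conf_store w s qs [x] (lrs[i := (l, r)])"
  let ?a = "new_sym i x" and ?d = "new_dir i x"
  have upd: "(?C l r)(lreg w i := l') = ?C l' r" "(?C l r)(rreg w i := r') = ?C l r'" for l r l' r'
    using assms(1) by (simp_all add: conf_store_upd_reg)
  have get: "(?C l r) (lreg w i) = l" "(?C l r) (rreg w i) = r" "(?C l r) (Suc w) = [x]" for l r
    using assms(1) by simp_all
  have start: "conf_store w s qs [x] lrs = ?C l r" using lr by (metis list_update_id)
  have P: "runs (Pop (rreg w i)) (?C l r) 1 (?C l (tl r))"
    by (rule runs_eq[OF runs_Pop]) (simp_all only: upd get order_refl)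
  have T: "tops (?C l r) (Suc w) = x" "tops (?C l r) (lreg w i) = topsym l" for l r
    by (simp_all only: tops_def get topsym_simps)
  have a: "Suc (?a - Suc 0) = ?a" using assms(3) by simp
  have l: "topsym l \<le> g" using assms(2) lr by (cases l) auto
  let ?L = "Push (lreg w i) (\<lambda>\<sigma>. new_sym i (\<sigma> (Suc w)))"
  let ?R = "Push (rreg w i) (\<lambda>\<sigma>. new_sym i (\<sigma> (Suc w)))"
  let ?B = "Push (rreg w i) (\<lambda>\<sigma>. if \<sigma> (lreg w i) = 0 then 1 else min g (\<sigma> (lreg w i))) ;; Pop (lreg w i)"
  let ?D = "Cond (\<lambda>\<sigma>. new_dir i (\<sigma> (Suc w)) = -1) ?B Skip"
  have L: "runs ?L (?C l (tl r)) 2 (?C (?a # l) (tl r))"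
    by (rule runs_eq[OF runs_Push]) (simp_all only: upd get order_refl T fun_upd_other reg_neq not_False_eq_True simp_thms)
  have R: "runs ?R (?C l (tl r)) 2 (?C l (?a # tl r))"
    by (rule runs_eq[OF runs_Push]) (simp_all only: upd get order_refl T fun_upd_other reg_neq not_False_eq_True simp_thms)
  let ?t = "if topsym l = 0 then 1 else topsym l"
  have "runs ?B (?C l (?a # tl r)) (2 + 1) (?C (tl l) (?t # ?a # tl r))"
    using l by (intro runs_eq[OF runs_Seq[OF runs_Push runs_Pop]])
      (simp_all add: upd get T min_absorb2 del: list_update_overwrite)
  then have D: "runs ?D (?C l (?a # tl r)) (3 + 2) (if ?d = -1 then ?C (tl l) (?t # ?a # tl r) else ?C l (?a # tl r))"
    by (intro runs_Cond) (auto simp: T runs_Skip)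
  have "runs (Cond (\<lambda>\<sigma>. new_dir i (\<sigma> (Suc w)) = 1) ?L (?R ;; ?D)) (?C l (tl r)) (7 + 2)
      (if ?d = 1 then ?C (?a # l) (tl r)
       else if ?d = -1 then ?C (tl l) (?t # ?a # tl r) else ?C l (?a # tl r))"
    by (rule runs_Cond) (use runs_mono[OF L, of 7] runs_Seq[OF R D] in \<open>auto simp: T\<close>)
  from runs_Seq[OF P this] show ?thesis
    unfolding start step_tape_def[symmetric]
    by (rule runs_eq) (simp_all add: lr act_def a)
qed

lemma runs_step_tapes:
  assumes "length lrs = m" "\<And>i. i < m \<Longrightarrow> set (fst (lrs ! i)) \<subseteq> {1..g} \<and> 0 < new_sym i x" "j \<le> m"
  shows "runs (step_tapes w j) (conf_store w s qs [x] lrs) (12 * j) (conf_store w s qs [x]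
    (map (\<lambda>i. if i < j then act (new_sym i x - 1) (new_dir i x) (lrs ! i) else lrs ! i) [0..<m]))"
  using assms(3)
proof (induction j)
  case 0
  have "map (\<lambda>i. lrs ! i) [0..<m] = lrs" using assms(1) map_nth by metis
  then show ?case by (simp add: runs_Skip)
next
  case (Suc j)
  let ?lrs = "\<lambda>j. map (\<lambda>i. if i < j then act (new_sym i x - 1) (new_dir i x) (lrs ! i) else lrs ! i) [0..<m]"
  have "runs (step_tape w j) (conf_store w s qs [x] (?lrs j)) 12
    (conf_store w s qs [x] ((?lrs j)[j := act (new_sym j x - 1) (new_dir j x) (?lrs j ! j)]))"
    by (rule runs_step_tape) (use Suc.prems assms(2)[of j] in simp_all)
  moreover have "(?lrs j)[j := act (new_sym j x - 1) (new_dir j x) (?lrs j ! j)] = ?lrs (Suc j)"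
    using Suc.prems by (intro nth_equalityI) (auto simp: nth_list_update)
  ultimately have "runs (step_tape w j) (conf_store w s qs [x] (?lrs j)) 12 (conf_store w s qs [x] (?lrs (Suc j)))"
    by (simp only:)
  from runs_Seq[OF Suc.IH this] Suc.prems show ?case by (simp add: add.commute)
qed

definition conf_rel :: "tape list \<Rightarrow> (nat list \<times> nat list) list \<Rightarrow> bool" where
  "conf_rel tps lrs \<longleftrightarrow> length tps = m \<and> length lrs = m \<and>
     (\<forall>i<m. half_rel g (fst (tps ! i)) (snd (tps ! i)) (lrs ! i))"

lemma runs_step:
  assumes "conf_rel tps lrs" "q < length M" "tm_step M (q, tps) = (q', tps')"
  obtains lrs' where "conf_rel tps' lrs'" "q' \<le> length M"
    "runs (step_prog w) (conf_store w s [Suc q] [] lrs) (12 * m + 8) (conf_store w s [Suc q'] [] lrs')"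
proof -
  have len: "length tps = m" "length lrs = m" and rel: "\<And>i. i < m \<Longrightarrow> half_rel g (fst (tps ! i)) (snd (tps ! i)) (lrs ! i)"
    using assms(1) by (auto simp: conf_rel_def)
  let ?as = "map (\<lambda>i. topsym (snd (lrs ! i)) - 1) [0..<m]"
  have scan: "map (\<lambda>(c, p). c p) tps = ?as"
    using half_rel_scan[OF rel] len by (intro nth_equalityI) (auto simp: case_prod_beta)
  have as: "length ?as = m" "set ?as \<subseteq> {..<g}"
  proof -
    have "topsym (snd (lrs ! i)) - 1 < g" if "i < m" for i
      using rel[OF that] g by (cases "snd (lrs ! i)") (auto simp: half_rel_def)
    then show "set ?as \<subseteq> {..<g}" by auto
  qed simp
  obtain acts where acts: "(M ! q) ?as = (fst ((M ! q) ?as), acts)" by (metis prod.collapse)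
  have "M ! q \<in> set M" using assms(2) by simp
  with tm as have "fst ((M ! q) ?as) \<le> length M \<and> length (snd ((M ! q) ?as)) = m \<and>
      set (snd ((M ! q) ?as)) \<subseteq> {..<g} \<times> {-1, 0, 1}"
    unfolding turing_machine_def by blast
  then have q'': "fst ((M ! q) ?as) \<le> length M" and la: "length acts = m"
    and sa: "set acts \<subseteq> {..<g} \<times> {-1, 0, 1}" using acts by (metis snd_conv)+
  have act: "fst (acts ! i) < g" "snd (acts ! i) \<in> {-1, 0, 1}" if "i < m" for i
  proof -
    have "acts ! i \<in> {..<g} \<times> {-1, 0, 1}" using that la by (intro subsetD[OF sa] nth_mem) simp
    then show "fst (acts ! i) < g" "snd (acts ! i) \<in> {-1, 0, 1}" unfolding mem_Times_iff by blast+
  qed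
  have q': "q' = fst ((M ! q) ?as)" and tps': "tps' = map2 (\<lambda>(c, p) (a, d). (c(p := a), p + d)) tps acts"
    using assms(2,3) acts by (auto simp: tm_step_def scan split: prod.splits)
  define x where x_def: "x = Suc (list_encode (q # ?as))"
  have dec: "dec_step x = (q', acts)"
    unfolding dec_step_def x_def
    by (simp only: diff_Suc_1 list_encode_inverse list.sel q' acts[symmetric])
  have sym: "new_sym i x = Suc (fst (acts ! i))" "new_dir i x = snd (acts ! i)" if "i < m" for i
    using act(1)[OF that] by (simp_all add: new_sym_def new_dir_def dec)
  let ?lrs = "map (\<lambda>i. act (fst (acts ! i)) (snd (acts ! i)) (lrs ! i)) [0..<m]"
  have c1: "conf_rel tps' ?lrs"
    unfolding conf_rel_def
  proof (intro conjI allI impI)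
    fix i assume i: "i < m"
    have "tps' ! i = ((fst (tps ! i))(snd (tps ! i) := fst (acts ! i)), snd (tps ! i) + snd (acts ! i))"
      using i len la by (simp add: tps' case_prod_beta)
    then show "half_rel g (fst (tps' ! i)) (snd (tps' ! i)) (?lrs ! i)"
      using half_rel_act[OF rel[OF i] act[OF i]] i by simp
  qed (use len la tps' in simp_all)
  have q1: "q' \<le> length M" using q' q'' by simp
  have runs: "runs (step_prog w) (conf_store w s [Suc q] [] lrs) (2 + (12 * m + (1 + (2 + 1))))
      (conf_store w s [Suc q'] [] ?lrs)"
  proof -
    have "enc_scan w ((tops (conf_store w s [Suc q] [] lrs))(Suc w := 0)) = x"
    proof -
      have 1: "map (\<lambda>i. ((tops (conf_store w s [Suc q] [] lrs))(Suc w := 0)) (rreg w i) - 1) [0..<m] = ?as"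
        using len by (auto simp: tops_def)
      have 2: "((tops (conf_store w s [Suc q] [] lrs))(Suc w := 0)) w - 1 = q" by (simp add: tops_def)
      show ?thesis unfolding enc_scan_def Let_def 1 2 x_def by (rule if_P) (use as(2) assms(2) in blast)
    qed
    then have 1: "runs (Push (Suc w) (enc_scan w)) (conf_store w s [Suc q] [] lrs) 2 (conf_store w s [Suc q] [x] lrs)"
      by (intro runs_eq[OF runs_Push]) simp_all
    have "runs (step_tapes w m) (conf_store w s [Suc q] [x] lrs) (12 * m) (conf_store w s [Suc q] [x]
       (map (\<lambda>i. if i < m then act (new_sym i x - 1) (new_dir i x) (lrs ! i) else lrs ! i) [0..<m]))"
      using len sym rel by (intro runs_step_tapes) (auto simp: half_rel_def)
    moreover have "map (\<lambda>i. if i < m then act (new_sym i x - 1) (new_dir i x) (lrs ! i) else lrs ! i) [0..<m] = ?lrs"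
      using sym by (simp)
    ultimately have 2: "runs (step_tapes w m) (conf_store w s [Suc q] [x] lrs) (12 * m) (conf_store w s [Suc q] [x] ?lrs)"
      by (simp only:)
    have 3: "runs (Pop w) (conf_store w s [Suc q] [x] ?lrs) 1 (conf_store w s [] [x] ?lrs)"
      by (rule runs_eq[OF runs_Pop]) simp_all
    have 4: "runs (Push w (\<lambda>\<sigma>. Suc (min (length M) (fst (dec_step (\<sigma> (Suc w)))))))
        (conf_store w s [] [x] ?lrs) 2 (conf_store w s [Suc q'] [x] ?lrs)"
      using \<open>q' \<le> length M\<close>
      by (intro runs_eq[OF runs_Push]) (simp_all add: tops_def dec min_absorb2)
    have 5: "runs (Pop (Suc w)) (conf_store w s [Suc q'] [x] ?lrs) 1 (conf_store w s [Suc q'] [] ?lrs)"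
      by (rule runs_eq[OF runs_Pop]) simp_all
    show ?thesis
      unfolding step_prog_def by (rule runs_Seq[OF 1 runs_Seq[OF 2 runs_Seq[OF 3 runs_Seq[OF 4 5]]]])
  qed
  show ?thesis by (rule that[OF c1 q1 runs_mono[OF runs]]) simp
qed

lemma runs_machine:
  assumes "(tm_step M ^^ t) (q, tps) = (length M, tps')" "conf_rel tps lrs" "q \<le> length M"
  shows "\<exists>lrs'. conf_rel tps' lrs' \<and> runs (While (\<lambda>\<sigma>. \<sigma> w \<noteq> Suc (length M)) (step_prog w))
    (conf_store w s [Suc q] [] lrs) (t * (12 * m + 10) + 1) (conf_store w s [Suc (length M)] [] lrs')"
  using assms
proof (induction t arbitrary: q tps lrs)
  case 0
  have "exec (While (\<lambda>\<sigma>. \<sigma> w \<noteq> Suc (length M)) (step_prog w)) (conf_store w s [Suc q] [] lrs) 1 (conf_store w s [Suc q] [] lrs)"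
    using 0 by (intro exec.intros(7)) (simp add: tops_def)
  with 0 show ?case by (auto simp: runs_def)
next
  case (Suc t)
  obtain q1 tps1 where 1: "tm_step M (q, tps) = (q1, tps1)" by fastforce
  then have *: "(tm_step M ^^ t) (q1, tps1) = (length M, tps')"
    using Suc.prems(1) by (simp only: funpow_Suc_right o_apply)
  show ?case
  proof (cases "q = length M")
    case True
    \<comment> \<open>A halted machine idles, so its remaining steps cost the loop nothing.\<close>
    then have "q1 = q" "tps1 = tps" using 1 by (simp_all add: tm_step_def)
    with * Suc.IH[of q tps lrs] Suc.prems(2,3) obtain lrs' where "conf_rel tps' lrs'"
      "runs (While (\<lambda>\<sigma>. \<sigma> w \<noteq> Suc (length M)) (step_prog w))
        (conf_store w s [Suc q] [] lrs) (t * (12 * m + 10) + 1) (conf_store w s [Suc (length M)] [] lrs')"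
      by blast
    moreover have "t * (12 * m + 10) + 1 \<le> Suc t * (12 * m + 10) + 1" by simp
    ultimately show ?thesis using runs_mono by blast
  next
    case False
    then have q: "q < length M" using Suc.prems(3) by simp
    from runs_step[OF Suc.prems(2) q 1] obtain lrs1 where lrs1: "conf_rel tps1 lrs1" "q1 \<le> length M"
      and r: "runs (step_prog w) (conf_store w s [Suc q] [] lrs) (12 * m + 8) (conf_store w s [Suc q1] [] lrs1)"
      by metis
    from Suc.IH[OF * lrs1] obtain lrs' where lrs': "conf_rel tps' lrs'"
      and r': "runs (While (\<lambda>\<sigma>. \<sigma> w \<noteq> Suc (length M)) (step_prog w))
        (conf_store w s [Suc q1] [] lrs1) (t * (12 * m + 10) + 1) (conf_store w s [Suc (length M)] [] lrs')"
      by blast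
    obtain u u' where u: "u \<le> 12 * m + 8" "u' \<le> t * (12 * m + 10) + 1"
      "exec (step_prog w) (conf_store w s [Suc q] [] lrs) u (conf_store w s [Suc q1] [] lrs1)"
      "exec (While (\<lambda>\<sigma>. \<sigma> w \<noteq> Suc (length M)) (step_prog w))
        (conf_store w s [Suc q1] [] lrs1) u' (conf_store w s [Suc (length M)] [] lrs')"
      using r r' by (auto simp: runs_def)
    have "exec (While (\<lambda>\<sigma>. \<sigma> w \<noteq> Suc (length M)) (step_prog w))
        (conf_store w s [Suc q] [] lrs) (u + u' + 2) (conf_store w s [Suc (length M)] [] lrs')"
      using q u(3,4) by (intro exec.intros(8)) (simp_all add: tops_def)
    moreover have "u + u' + 2 \<le> Suc t * (12 * m + 10) + 1" using u(1,2) by simp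
    ultimately show ?thesis using lrs' unfolding runs_def by blast
  qed
qed

text \<open>The single reversing move puts cell 0, the least significant bit, on top of the right
  stack, where the head starts. Bits 1 and 2 become 2 and 3, because blanks are stored as 1; the
  index is shifted because tape 0 is the output.\<close>

definition input_prog :: "nat \<Rightarrow> nat list \<Rightarrow> nat \<Rightarrow> com" where
  "input_prog w xs i = copy (w + 2 + 2 * m) (xs ! i) (w + 3 + 2 * m) ;;
     move_while (\<lambda>x. x \<noteq> 0) (\<lambda>x. if x = 2 then 3 else 2) (w + 3 + 2 * m) (rreg w (Suc i))"

fun input_progs :: "nat \<Rightarrow> nat list \<Rightarrow> nat \<Rightarrow> com" where
  "input_progs w xs 0 = Skip"
| "input_progs w xs (Suc i) = input_progs w xs i ;; input_prog w xs i"

text \<open>Tipping the left half onto the right one makes the stored section of the output tape a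
  single stack whose top is its leftmost cell. Once the blanks before it are stripped, the answer is
  the run of symbols that are at least 2, and one last reversing move brings it into the order of
  \<open>rep\<close>.\<close>

definition sim_prog :: "nat \<Rightarrow> nat \<Rightarrow> nat \<Rightarrow> nat list \<Rightarrow> com" where
  "sim_prog k w out xs = Push w (\<lambda>\<sigma>. 1) ;; input_progs w xs k ;;
     While (\<lambda>\<sigma>. \<sigma> w \<noteq> Suc (length M)) (step_prog w) ;;
     move_while (\<lambda>x. x \<noteq> 0) (\<lambda>x. if x = 0 then 1 else min g x) (lreg w 0) (rreg w 0) ;;
     strip (rreg w 0) ;;
     move_while (\<lambda>x. 2 \<le> x) (\<lambda>x. if x = 3 then 2 else 1) (rreg w 0) out ;;
     clear_range w (2 + 2 * m)"

lemma wf_prog_sim: "wf_prog (sim_prog k w out xs)"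
proof -
  have "wf_prog (input_progs w xs i)" for i
    by (induction i) (auto simp: input_prog_def intro: wf_prog_move_while[of _ 4])
  moreover have "wf_prog (move_while P (\<lambda>x. if x = 0 then 1 else min g x) a b)" for P a b
    by (rule wf_prog_move_while[of _ "Suc g"]) (use g in auto)
  moreover have "wf_prog (move_while P (\<lambda>x. if x = 3 then 2 else 1) a b)" for P a b
    by (rule wf_prog_move_while[of _ 3]) auto
  ultimately show ?thesis using wf_prog_step[of w] by (simp add: sim_prog_def)
qed

section \<open>Correctness of loading, running and reading the output\<close>

definition input_confs :: "nat list \<Rightarrow> nat \<Rightarrow> (nat list \<times> nat list) list" where
  "input_confs vs k = map (\<lambda>i. ([], if i \<in> {1..k} then map Suc (rev (rep (vs ! (i - 1)))) else [])) [0..<m]"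

lemma runs_input_progs:
  assumes "length xs = length vs" "set xs \<subseteq> {..<w}" "map s xs = map rep vs" "length vs < m" "j \<le> length vs"
  shows "runs (input_progs w xs j) (conf_store w s qs [] (input_confs vs 0)) (j * (17 * insize vs + 3))
    (conf_store w s qs [] (input_confs vs j))"
  using assms(5)
proof (induction j)
  case (Suc j)
  let ?C = "conf_store w s qs [] (input_confs vs j)" and ?A = "w + 3 + 2 * m" and ?T = "w + 2 + 2 * m"
  let ?v = "rep (vs ! j)"
  have j: "j < length vs" using Suc.prems by simp
  have len: "length (input_confs vs j) = m" for j by (simp add: input_confs_def)
  have l: "floorlog 2 (vs ! j) \<le> insize vs" by (rule floorlog_le_insize[OF j])
  have xj: "xs ! j < w" using assms(1,2) j by (metis lessThan_iff nth_mem subsetD)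
  have sj: "s (xs ! j) = ?v" using assms(1,3) j by (metis nth_map)
  have A: "?C ?A = []" "?C ?T = []" by (simp_all add: len)
  have 1: "runs (copy ?T (xs ! j) ?A) ?C (12 * insize vs + 2) (?C(?A := ?v))"
    by (rule runs_copy) (use xj sj A l set_rep in simp_all)
  have all: "takeWhile (\<lambda>x. x \<noteq> 0) ?v = ?v" "dropWhile (\<lambda>x. x \<noteq> 0) ?v = []"
    "map (\<lambda>x. if x = 2 then 3 else 2) ?v = map Suc ?v"
    using set_rep[of "vs ! j"] by (auto simp: takeWhile_eq_all_conv)
  have neq: "?A \<noteq> rreg w (Suc j)" using j assms(4) by (simp add: rreg_def)
  have "runs (move_while (\<lambda>x. x \<noteq> 0) (\<lambda>x. if x = 2 then 3 else 2) ?A (rreg w (Suc j))) (?C(?A := ?v)) (5 * insize vs + 1)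
      (?C(rreg w (Suc j) := map Suc (rev ?v)))"
  proof (rule runs_move_while[OF neq])
    have r: "?C (rreg w (Suc j)) = []" using j assms(4) by (simp add: input_confs_def)
    show "?C(rreg w (Suc j) := map Suc (rev ?v)) = (?C(?A := ?v))
      (?A := dropWhile (\<lambda>x. x \<noteq> 0) ((?C(?A := ?v)) ?A),
       rreg w (Suc j) := rev (map (\<lambda>x. if x = 2 then 3 else 2) (takeWhile (\<lambda>x. x \<noteq> 0) ((?C(?A := ?v)) ?A))) @
         (?C(?A := ?v)) (rreg w (Suc j)))"
      unfolding fun_upd_same all fun_upd_other[OF neq[symmetric]] r
      using A(1) by (auto simp: fun_eq_iff rev_map)
  qed (use l in simp_all)
  also have "?C(rreg w (Suc j) := map Suc (rev ?v)) = conf_store w s qs [] (input_confs vs (Suc j))"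
  proof -
    have "(input_confs vs j)[Suc j := (fst (input_confs vs j ! Suc j), map Suc (rev ?v))] = input_confs vs (Suc j)"
      using j assms(4) by (intro nth_equalityI) (auto simp: input_confs_def nth_list_update)
    moreover have "Suc j < length (input_confs vs j)" using len j assms(4) by simp
    ultimately show ?thesis by (simp only: conf_store_upd_reg)
  qed
  finally have "runs (input_prog w xs j) ?C (12 * insize vs + 2 + (5 * insize vs + 1))
      (conf_store w s qs [] (input_confs vs (Suc j)))"
    unfolding input_prog_def by (rule runs_Seq[OF 1])
  from runs_Seq[OF Suc.IH[OF less_imp_le[OF j]] this] show ?case
    unfolding input_progs.simps by (rule runs_eq) (simp_all add: algebra_simps)
qed (simp add: runs_Skip)

lemma conf_rel_start: "length vs < m \<Longrightarrow> conf_rel (start_tapes m vs) (input_confs vs (length vs))"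
  unfolding conf_rel_def
proof (intro conjI allI impI)
  fix i assume i: "i < m" and vs: "length vs < m"
  show "half_rel g (fst (start_tapes m vs ! i)) (snd (start_tapes m vs ! i)) (input_confs vs (length vs) ! i)"
  proof (cases "i \<in> {1..length vs}")
    case True
    let ?v = "vs ! (i - 1)"
    have "binary ?v (int j) = nthd (map Suc (rev (rep ?v))) j - 1" for j
      by (simp add: binary_def nthd_def rep_def)
    moreover have "binary ?v (0 - 1 - int j) = 0" for j by (simp add: binary_def)
    moreover have "set (map Suc (rev (rep ?v))) \<subseteq> {1..g}" using set_rep[of ?v] g by auto
    ultimately show ?thesis using True i by (simp add: half_rel_def start_tapes_def input_confs_def)
  next
    case False
    then show ?thesis using i by (auto simp: half_rel_def start_tapes_def input_confs_def)
  qed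
qed (simp_all add: start_tapes_def input_confs_def)

text \<open>The head may halt anywhere, so the stored section may extend beyond the number on both
  sides, while all cells outside it are blank. Hence for \<open>y > 0\<close> it consists of the
  shifted bits of \<open>y\<close> between two blocks of the code 1.\<close>

lemma half_rel_output:
  assumes "half_rel g (binary y) p (l, r)"
  shows "takeWhile (\<lambda>x. 2 \<le> x) (dropWhile (\<lambda>x. x = 1) (rev l @ r)) = map Suc (rev (rep y))"
proof -
  let ?R = "rev l @ r" and ?a = "p - int (length l)"
  have pos: "set ?R \<subseteq> {1..g}" using assms by (auto simp: half_rel_def)
  have L: "binary y (p - 1 - int j) = nthd l j - 1" and R: "binary y (p + int j) = nthd r j - 1" for j
    using assms by (auto simp: half_rel_def)
  have nth: "?R ! j = Suc (binary y (?a + int j))" if "j < length ?R" for j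
  proof -
    have "?R ! j - 1 = binary y (?a + int j)"
    proof (cases "j < length l")
      case True
      have "?R ! j = nthd l (length l - Suc j)" using True by (simp add: nth_append rev_nth nthd_def)
      moreover have "?a + int j = p - 1 - int (length l - Suc j)" using True by (simp add: of_nat_diff)
      ultimately show ?thesis by (simp only: L)
    next
      case False
      then have "?R ! j = nthd r (j - length l)" using that by (simp add: nth_append nthd_def)
      moreover have "?a + int j = p + int (j - length l)" using False by (simp add: of_nat_diff)
      ultimately show ?thesis by (simp only: R)
    qed
    moreover have "?R ! j \<in> {1..g}" by (rule subsetD[OF pos nth_mem[OF that]])
    ultimately show ?thesis by (cases "?R ! j") simp_all
  qed
  have out: "?a \<le> i \<and> i < ?a + int (length ?R)" if "binary y i \<noteq> 0" for i
  proof (rule ccontr)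
    assume "\<not> ?thesis"
    then consider "i < ?a" | "?a + int (length ?R) \<le> i" by linarith
    then show False
    proof cases
      case 1
      then have "p - 1 - int (nat (p - 1 - i)) = i" "length l \<le> nat (p - 1 - i)" by auto
      then show False using L[of "nat (p - 1 - i)"] that by (simp only:) (simp add: nthd_def)
    next
      case 2
      then have "p + int (nat (i - p)) = i" "length r \<le> nat (i - p)" by auto
      then show False using R[of "nat (i - p)"] that by (simp only:) (simp add: nthd_def)
    qed
  qed
  show ?thesis
  proof (cases "y = 0")
    case True
    have "x = 1" if "x \<in> set ?R" for x
    proof -
      from that obtain j where j: "j < length ?R" "?R ! j = x"
        unfolding in_set_conv_nth by (elim exE conjE)
      from nth[OF j(1)] show ?thesis unfolding j(2) True by (simp add: binary_def floorlog_def)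
    qed
    then have "dropWhile (\<lambda>x. x = 1) ?R = []" unfolding dropWhile_eq_Nil_conv by (rule ballI)
    then show ?thesis unfolding True by (simp only: takeWhile.simps rep_0 list.map rev.simps)
  next
    case False
    \<comment> \<open>The stored section starts at cell \<open>?a\<close>, so \<open>?n\<close>
      blanks precede cell 0, where the number begins.\<close>
    let ?b = "floorlog 2 y" and ?n = "nat (- ?a)"
    have b: "0 < ?b" using False by (simp add: floorlog_half)
    have bin: "binary y i = (if 0 \<le> i \<and> i < int ?b then rev (rep y) ! nat i else 0)" for i
      by (auto simp: binary_def rep_def nat_less_iff)
    have nz: "binary y i \<noteq> 0" if "0 \<le> i" "i < int ?b" for i using that by (simp add: binary_def)
    have a: "?a \<le> 0" "int ?b \<le> ?a + int (length ?R)"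
      using out[OF nz[of 0]] out[OF nz[of "int ?b - 1"]] b by auto
    let ?z = "length ?R - ?n - ?b"
    have R_eq: "?R = replicate ?n 1 @ map Suc (rev (rep y)) @ replicate ?z 1"
    proof (rule nth_equalityI)
      show "length ?R = length (replicate ?n 1 @ map Suc (rev (rep y)) @ replicate ?z 1)"
        using a by simp
      fix j assume j: "j < length ?R"
      then have "?R ! j = Suc (binary y (int j - int ?n))" using nth[OF j] a(1) by (simp add: algebra_simps)
      also have "\<dots> = (replicate ?n 1 @ map Suc (rev (rep y)) @ replicate ?z 1) ! j"
        using j by (auto simp: bin nth_append not_less nat_diff_distrib')
      finally show "?R ! j = (replicate ?n 1 @ map Suc (rev (rep y)) @ replicate ?z 1) ! j" .
    qed
    have scan: "takeWhile (\<lambda>x. 2 \<le> x) (dropWhile (\<lambda>x. x = 1) (replicate n 1 @ map Suc bs @ replicate z 1)) = map Suc bs"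
      if "set bs \<subseteq> {1, 2}" "bs \<noteq> []" for n z and bs :: "nat list"
    proof -
      have "dropWhile (\<lambda>x. x = 1) (replicate n 1 @ map Suc bs @ replicate z 1) = map Suc bs @ replicate z 1"
        using that by (induction n) (cases bs; auto)+
      moreover have "takeWhile (\<lambda>x. 2 \<le> x) (map Suc bs @ replicate z 1) = map Suc bs"
        using that(1) by (induction bs) (cases z; auto)+
      ultimately show ?thesis by simp
    qed
    have "set (rev (rep y)) \<subseteq> {1, 2}" "rev (rep y) \<noteq> []" using False set_rep[of y] by auto
    from scan[OF this, of ?n ?z] show ?thesis unfolding R_eq[symmetric] .
  qed
qed

text \<open>The final tape contents are never estimated directly: what is left in a work register is
  no longer than the time spent so far, which also bounds the cost of the cleanup. With
  \<open>?T0\<close> for loading and running, the three passes over stacks of length at most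
  \<open>?T0\<close> or \<open>2 * ?T0\<close> lead to \<open>22 * ?T0 + 3\<close>.\<close>

lemma runs_sim:
  assumes vs: "length vs = k" "k < m" and xs: "length xs = k" "set xs \<subseteq> {..<w}" "out < w"
    and s: "\<forall>r\<ge>w. s r = []" "s out = []" "map s xs = map rep vs"
    and comp: "computes_within m M vs y T"
  shows "runs (sim_prog k w out xs) s
    (22 * (k * (17 * insize vs + 3) + T * (12 * m + 10) + 3) + 3 + (2 + 2 * m) *
      (3 * (22 * (k * (17 * insize vs + 3) + T * (12 * m + 10) + 3) + 3) + 1)) (s(out := rep y))"
proof -
  obtain t tps where t: "t \<le> T" "(tm_step M ^^ t) (0, start_tapes m vs) = (length M, tps)"
    and out: "fst (tps ! 0) = binary y"
    using comp by (auto simp: computes_within_def)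
  let ?E = "replicate m ([], []) :: (nat list \<times> nat list) list"
  let ?W = "While (\<lambda>\<sigma>. \<sigma> w \<noteq> Suc (length M)) (step_prog w)"
  have E: "input_confs vs 0 = ?E" by (simp add: input_confs_def map_replicate_const)
  have s0: "s = conf_store w s [] [] ?E"
    using s(1) by (auto simp: conf_store_def fun_eq_iff)
  have "runs (Push w (\<lambda>\<sigma>. 1)) (conf_store w s [] [] ?E) 2 (conf_store w s [1] [] ?E)"
    by (rule runs_eq[OF runs_Push]) simp_all
  then have 1: "runs (Push w (\<lambda>\<sigma>. 1)) s 2 (conf_store w s [Suc 0] [] (input_confs vs 0))"
    unfolding E s0[symmetric] by simp
  have 2: "runs (input_progs w xs k) (conf_store w s [Suc 0] [] (input_confs vs 0)) (k * (17 * insize vs + 3))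
      (conf_store w s [Suc 0] [] (input_confs vs k))"
    using runs_input_progs[of xs vs w s k "[Suc 0]"] vs xs s(3) by simp
  obtain lrs where lrs: "conf_rel tps lrs" and
    3: "runs ?W (conf_store w s [Suc 0] [] (input_confs vs k)) (t * (12 * m + 10) + 1)
        (conf_store w s [Suc (length M)] [] lrs)"
    using runs_machine[OF t(2)] conf_rel_start[of vs] vs by blast
  obtain l r where lr: "lrs ! 0 = (l, r)" by fastforce
  have rel: "half_rel g (binary y) (snd (tps ! 0)) (l, r)"
    using lrs m lr out unfolding conf_rel_def by metis
  have len: "length lrs = m" using lrs by (simp add: conf_rel_def)
  let ?T0 = "k * (17 * insize vs + 3) + T * (12 * m + 10) + 3"
  have 30: "runs (Push w (\<lambda>\<sigma>. 1) ;; input_progs w xs k ;; ?W) s ?T0 (conf_store w s [Suc (length M)] [] lrs)"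
    by (rule runs_mono[OF runs_Seq[OF 1 runs_Seq[OF 2 3]]]) (use t(1) in simp)
  have le: "length (conf_store w s [Suc (length M)] [] lrs r') \<le> ?T0" if "w \<le> r'" for r'
    using runs_length[OF 30, of r'] s(1) that by simp
  have "w \<le> lreg w 0" "w \<le> rreg w 0" by (simp_all add: lreg_def rreg_def)
  from le[OF this(1)] le[OF this(2)] have ll: "length l \<le> ?T0" "length r \<le> ?T0"
    using len m lr by simp_all
  let ?C = "\<lambda>l r. conf_store w s [Suc (length M)] [] (lrs[0 := (l, r)])"
  have C: "conf_store w s [Suc (length M)] [] lrs = ?C l r" using lr by (metis list_update_id)
  have upd: "(?C l r)(lreg w 0 := l') = ?C l' r" "(?C l r)(rreg w 0 := r') = ?C l r'" for l r l' r'
    using len m by (simp_all add: conf_store_upd_reg)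
  have get: "(?C l r) (lreg w 0) = l" "(?C l r) (rreg w 0) = r" for l r
    using len m by simp_all
  have syms: "set l \<subseteq> {1..g}" "set r \<subseteq> {1..g}" using rel by (auto simp: half_rel_def)
  let ?h = "\<lambda>x. if x = 0 then 1 else min g x"
  have l_eqs: "takeWhile (\<lambda>x. x \<noteq> 0) l = l" "dropWhile (\<lambda>x. x \<noteq> 0) l = []" "map ?h l = l"
    using syms(1) by (auto simp: takeWhile_eq_all_conv intro!: map_idI)
  have 4: "runs (move_while (\<lambda>x. x \<noteq> 0) ?h (lreg w 0) (rreg w 0)) (?C l r) (5 * ?T0 + 1) (?C [] (rev l @ r))"
    by (rule runs_move_while) (simp_all only: get upd l_eqs, use ll in simp_all)
  let ?R = "dropWhile (\<lambda>x. x = 1) (rev l @ r)"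
  have 5: "runs (strip (rreg w 0)) (?C [] (rev l @ r)) (6 * ?T0 + 1) (?C [] ?R)"
    by (rule runs_strip) (simp_all only: get upd, use ll in simp_all)
  have R: "length ?R \<le> 2 * ?T0"
    using length_dropWhile_le[of "\<lambda>x. x = 1" "rev l @ r"] ll by simp
  let ?S = "(?C [] (dropWhile (\<lambda>x. 2 \<le> x) ?R))(out := rep y)"
  have "rev (map (\<lambda>x. if x = 3 then 2 else 1) (map Suc (rev (rep y)))) = rep y"
    using set_rep[of y] by (auto simp: rev_map intro!: map_idI)
  then have y: "rev (map (\<lambda>x. if x = 3 then 2 else 1) (takeWhile (\<lambda>x. 2 \<le> x) ?R)) = rep y"
    unfolding half_rel_output[OF rel] .
  have ro: "rreg w 0 \<noteq> out" using xs(3) by (simp add: rreg_def)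
  have 6: "runs (move_while (\<lambda>x. 2 \<le> x) (\<lambda>x. if x = 3 then 2 else 1) (rreg w 0) out) (?C [] ?R) (10 * ?T0 + 1) ?S"
    by (rule runs_move_while[OF ro]) (simp_all only: get upd y, use R xs(3) s(2) in simp_all)
  let ?T1 = "22 * ?T0 + 3"
  have T1: "2 + (k * (17 * insize vs + 3) + (t * (12 * m + 10) + 1 + ((5 * ?T0 + 1) + ((6 * ?T0 + 1) + (10 * ?T0 + 1))))) \<le> ?T1"
    using mult_le_mono1[OF t(1), of "12 * m + 10"] by simp
  have 7: "runs (sim_prog k w out xs) s (2 + (k * (17 * insize vs + 3) + (t * (12 * m + 10) + 1 + ((5 * ?T0 + 1) +
      ((6 * ?T0 + 1) + ((10 * ?T0 + 1) + (2 + 2 * m) * (3 * ?T1 + 1))))))) (s(out := rep y))"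
  proof -
    have "runs (Push w (\<lambda>\<sigma>. 1) ;; input_progs w xs k ;; ?W ;;
       move_while (\<lambda>x. x \<noteq> 0) ?h (lreg w 0) (rreg w 0) ;; strip (rreg w 0) ;;
       move_while (\<lambda>x. 2 \<le> x) (\<lambda>x. if x = 3 then 2 else 1) (rreg w 0) out) s
      (2 + (k * (17 * insize vs + 3) + (t * (12 * m + 10) + 1 + ((5 * ?T0 + 1) + ((6 * ?T0 + 1) + (10 * ?T0 + 1)))))) ?S"
      by (rule runs_Seq[OF 1 runs_Seq[OF 2 runs_Seq[OF 3[unfolded C] runs_Seq[OF 4 runs_Seq[OF 5 6]]]]])
    then have len': "length (?S r') \<le> length (s r') + ?T1" for r'
      by (intro runs_length[OF runs_mono[OF _ T1]])
    have len: "length (?S r') \<le> ?T1" if "w \<le> r'" for r'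
      using len'[of r'] s(1)[rule_format, OF that] by simp
    let ?lrs = "lrs[0 := ([], dropWhile (\<lambda>x. 2 \<le> x) ?R)]"
    have "0 \<notin> set (rev l @ r)" using syms by auto
    then have zR: "0 \<notin> set (dropWhile (\<lambda>x. 2 \<le> x) ?R)" using set_dropWhileD by metis
    have z: "0 \<notin> set (fst (?lrs ! i)) \<and> 0 \<notin> set (snd (?lrs ! i))" if "i < m" for i
    proof (cases "i = 0")
      case True
      then show ?thesis using zR \<open>length lrs = m\<close> m by simp
    next
      case False
      have "set (fst (lrs ! i)) \<union> set (snd (lrs ! i)) \<subseteq> {1..g}"
        using lrs that by (simp add: conf_rel_def half_rel_def)
      then show ?thesis using False by auto
    qed
    have "0 \<notin> set (?S r')" if "w \<le> r'" for r'
    proof -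
      have "r' \<noteq> out" using that xs(3) by simp
      moreover have "0 \<notin> set (conf_store w s [Suc (length M)] [] ?lrs r')"
        using that z by (simp add: conf_store_def \<open>length lrs = m\<close>)
      ultimately show ?thesis by simp
    qed
    with len have 8: "runs (clear_range w (2 + 2 * m)) ?S ((2 + 2 * m) * (3 * ?T1 + 1))
       (\<lambda>r. if w \<le> r \<and> r < w + (2 + 2 * m) then [] else ?S r)"
      by (intro runs_clear_range) blast
    have "(\<lambda>r. if w \<le> r \<and> r < w + (2 + 2 * m) then [] else ?S r) = s(out := rep y)"
    proof
      fix r
      show "(if w \<le> r \<and> r < w + (2 + 2 * m) then [] else ?S r) = (s(out := rep y)) r"
        using xs(3) s(1) \<open>length lrs = m\<close> by (cases "r < w") auto
    qed
    with 8 have 8: "runs (clear_range w (2 + 2 * m)) ?S ((2 + 2 * m) * (3 * ?T1 + 1)) (s(out := rep y))"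
      by (simp only:)
    show ?thesis
      unfolding sim_prog_def
      by (rule runs_Seq[OF 1 runs_Seq[OF 2 runs_Seq[OF 3[unfolded C] runs_Seq[OF 4 runs_Seq[OF 5 runs_Seq[OF 6 8]]]]]])
  qed
  show ?thesis by (rule runs_mono[OF 7]) (use T1 in simp)
qed

lemma fp_sim:
  assumes "k < m" "\<forall>vs. length vs = k \<longrightarrow> computes_within m M vs (f vs) (poly p (insize vs))"
  shows "fp k f"
proof -
  let ?p = "[:k:] * [:3, 17:] + p * [:12 * m + 10:] + [:3:]"
  show ?thesis
  proof (rule fpI[of _ _ "[:22:] * ?p + [:3:] + [:2 + 2 * m:] * ([:3:] * ([:22:] * ?p + [:3:]) + [:1:])"])
    fix w out :: nat and xs :: "nat list"
    assume xs: "length xs = k" "set xs \<subseteq> {..<w}" "out < w" "out \<notin> set xs"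
    show "\<exists>c. implements c w out xs f
      ([:22:] * ?p + [:3:] + [:2 + 2 * m:] * ([:3:] * ([:22:] * ?p + [:3:]) + [:1:]))"
    proof (rule implementsI[of "sim_prog k w out xs"])
      fix s :: store and vs
      assume "length vs = length xs" and s: "\<forall>r\<ge>w. s r = []" "s out = []" "map s xs = map rep vs"
      then have vs: "length vs = k" using xs(1) by simp
      show "runs (sim_prog k w out xs) s
        (poly ([:22:] * ?p + [:3:] + [:2 + 2 * m:] * ([:3:] * ([:22:] * ?p + [:3:]) + [:1:])) (insize vs))
        (s(out := rep (f vs)))"
        by (rule runs_eq[OF runs_sim[OF vs assms(1) xs(1,2,3) s assms(2)[rule_format, OF vs]]])
           (simp_all add: algebra_simps)
    qed (rule wf_prog_sim)
  qed
qed

end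

lemma poly_time_iff_fp: "poly_time k f \<longleftrightarrow> fp k f"
proof
  assume "poly_time k f"
  then obtain m g M p where "k < m" "2 < g" "turing_machine m g M"
    "\<forall>xs. length xs = k \<longrightarrow> computes_within m M xs (f xs) (poly p (insize xs))"
    unfolding poly_time_def by blast
  then show "fp k f" by (intro fp_sim) simp_all
qed (rule fp_imp_poly_time)


section \<open>Some polynomial-time functions\<close>

lemma fp_comp1: "fp 1 h \<Longrightarrow> fp n a \<Longrightarrow> fp n (\<lambda>vs. h [a vs])"
  using fp_comp[of 1 h "[a]" n] by simp

lemma fp_comp2: "fp 2 h \<Longrightarrow> fp n a \<Longrightarrow> fp n b \<Longrightarrow> fp n (\<lambda>vs. h [a vs, b vs])"
  using fp_comp[of 2 h "[a, b]" n] by simp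

lemma fp_comp3: "fp 3 h \<Longrightarrow> fp n a \<Longrightarrow> fp n b \<Longrightarrow> fp n c \<Longrightarrow> fp n (\<lambda>vs. h [a vs, b vs, c vs])"
  using fp_comp[of 3 h "[a, b, c]" n] by simp

definition cat :: "nat \<Rightarrow> nat \<Rightarrow> nat" where
  "cat a b = a * 2 ^ floorlog 2 b + b"

lemma fp_catI: "fp n a \<Longrightarrow> fp n b \<Longrightarrow> fp n (\<lambda>vs. cat (a vs) (b vs))"
  using fp_comp2[OF fp_cat, of n a b] by (simp add: cat_def)

lemma fp_ifI: "fp n c \<Longrightarrow> fp n a \<Longrightarrow> fp n b \<Longrightarrow> fp n (\<lambda>vs. if c vs = 0 then b vs else a vs)"
  using fp_comp3[OF fp_cond, of n c a b] by (simp add: numeral_2_eq_2 cong: if_cong)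

lemma fp_shrI: "fp n a \<Longrightarrow> fp n b \<Longrightarrow> fp n (\<lambda>vs. a vs div 2 ^ floorlog 2 (b vs))"
  using fp_comp2[OF fp_shr, of n a b] by simp

lemma floorlog_cat [simp]: "floorlog 2 (cat a b) = floorlog 2 a + floorlog 2 b"
  using arg_cong[OF rep_cat[of a b], of length] by (simp add: cat_def)

lemma floorlog_shr [simp]: "floorlog 2 (n div 2 ^ k) = floorlog 2 n - k"
  using arg_cong[OF rep_div[of n k], of length] by simp

lemma less_floorlog: "n < 2 ^ floorlog 2 n"
  using val_less[of "rep n"] by simp

lemma less_pow_floorlog: "floorlog 2 a \<le> k \<Longrightarrow> a < 2 ^ k"
  using less_floorlog[of a] power_increasing[of "floorlog 2 a" k "2::nat"] by linarith

lemma le_cat: "a \<le> cat a b" "b \<le> cat a b"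
  by (auto simp: cat_def intro: trans_le_add1)

lemma floorlog_0 [simp]: "floorlog 2 0 = 0"
  by (simp add: floorlog_def)

lemma floorlog_1 [simp]: "floorlog 2 (Suc 0) = 1"
  by (simp add: floorlog_half)

lemma pow_le_cat_1: "2 ^ floorlog 2 a \<le> cat 1 a"
  by (simp add: cat_def)

text \<open>The leading part to be cut has length
  \<open>floorlog 2 (a vs) - floorlog 2 (b vs)\<close>, which is the length of \<open>a vs\<close>
  shifted right by that of \<open>b vs\<close>; this shifted number is the second argument given to
  \<open>fp_dropz\<close>.\<close>

lemma fp_lowI:
  assumes "fp n a" "fp n b"
  shows "fp n (\<lambda>vs. a vs mod 2 ^ floorlog 2 (b vs))"
proof -
  have "a vs mod 2 ^ (floorlog 2 (a vs) - (floorlog 2 (a vs) - floorlog 2 (b vs))) =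
      a vs mod 2 ^ floorlog 2 (b vs)" for vs
    using less_floorlog[of "a vs"] less_pow_floorlog[of "a vs" "floorlog 2 (b vs)"]
    by (cases "floorlog 2 (a vs) \<le> floorlog 2 (b vs)") auto
  then show ?thesis using fp_comp2[OF fp_dropz assms(1) fp_shrI[OF assms]] by simp
qed

section \<open>Functions whose lengths realise polynomials\<close>

lemma fp_drop:
  assumes "fp n b"
  shows "fp (n + k) (\<lambda>ws. b (drop k ws))"
proof -
  have 1: "fp (n + k) (\<lambda>ws. b (map (\<lambda>g. g ws) (map (\<lambda>i ws. ws ! (i + k)) [0..<n])))"
    by (rule fp_comp[OF assms]) (auto intro: fp_proj)
  have 2: "map (\<lambda>g. g ws) (map (\<lambda>i ws. ws ! (i + k)) [0..<n]) = drop k ws" if "length ws = n + k"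
    for ws :: "nat list"
    using that by (intro nth_equalityI) (auto simp: add.commute)
  show ?thesis by (rule fp_cong[OF 1]) (simp only: 2)
qed

text \<open>The value of \<open>b\<close> is catenated to an accumulator once for each bit of
  \<open>a\<close>. Only the length of the result matters; it grows like that of the smash function
  \<open>#\<close> of bounded arithmetic.\<close>

lemma fp_smash:
  assumes a: "fp n a" and b: "fp n b"
  shows "\<exists>c. fp n c \<and> (\<forall>vs. length vs = n \<longrightarrow> floorlog 2 (c vs) = floorlog 2 (a vs) * floorlog 2 (b vs))"
proof -
  obtain pa where pa: "\<And>vs. length vs = n \<Longrightarrow> floorlog 2 (a vs) \<le> poly pa (insize vs)"
    using fpE[OF a] by metis
  obtain pb where pb: "\<And>vs. length vs = n \<Longrightarrow> floorlog 2 (b vs) \<le> poly pb (insize vs)"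
    using fpE[OF b] by metis
  let ?F = "\<lambda>ws. cat (b (drop 2 ws)) (ws ! 1)"
  have F: "fp (n + 2) ?F" by (intro fp_catI fp_drop[OF b] fp_proj) simp
  have len: "floorlog 2 (iterate ?F vs 0 i) = i * floorlog 2 (b vs)" for vs i
    by (induction i) auto
  have "fp n (\<lambda>vs. iterate ?F vs 0 (floorlog 2 (a vs)))"
  proof (rule fp_iterate[OF F a fp_zero, of "pa * pb"])
    fix vs :: "nat list" and i
    assume "length vs = n" "i \<le> floorlog 2 (a vs)"
    then show "floorlog 2 (iterate ?F vs 0 i) \<le> poly (pa * pb) (insize vs)"
      unfolding len poly_mult using pa[of vs] pb[of vs] by (intro mult_le_mono) simp_all
  qed
  then show ?thesis using len by blast
qed

lemma fp_const: "\<exists>c. fp n (\<lambda>_. c) \<and> floorlog 2 c = a"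
proof (induction a)
  case 0
  then show ?case using fp_zero[of n] floorlog_0 by blast
next
  case (Suc a)
  then obtain c where "fp n (\<lambda>_. c)" "floorlog 2 c = a" by blast
  then show ?case using fp_catI[OF fp_one, of n "\<lambda>_. c"] by (intro exI[of _ "cat 1 c"]) auto
qed

lemma fp_insize: "\<exists>S. fp n S \<and> (\<forall>vs. length vs = n \<longrightarrow> floorlog 2 (S vs) = insize vs)"
proof -
  have "\<exists>S. fp n S \<and> (\<forall>vs. length vs = n \<longrightarrow> floorlog 2 (S vs) = (\<Sum>i<k. floorlog 2 (vs ! i)))"
    if "k \<le> n" for k
    using that
  proof (induction k)
    case 0
    then show ?case using fp_zero[of n] by force
  next
    case (Suc k)
    then obtain S where "fp n S" "\<forall>vs. length vs = n \<longrightarrow> floorlog 2 (S vs) = (\<Sum>i<k. floorlog 2 (vs ! i))"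
      by auto
    then show ?case using Suc.prems
      by (intro exI[of _ "\<lambda>vs. cat (S vs) (vs ! k)"] conjI fp_catI fp_proj) auto
  qed
  from this[of n] obtain S where S: "fp n S"
    "\<forall>vs. length vs = n \<longrightarrow> floorlog 2 (S vs) = (\<Sum>i<n. floorlog 2 (vs ! i))" by auto
  moreover have "(\<Sum>i<length vs. floorlog 2 (vs ! i)) = insize vs" for vs
    by (simp add: sum_list_sum_nth atLeast0LessThan)
  ultimately show ?thesis by metis
qed

text \<open>Horner's rule on lengths: catenation adds and \<open>fp_smash\<close>
  multiplies.\<close>

lemma fp_poly_bound:
  "\<exists>B. fp n B \<and> (\<forall>vs. length vs = n \<longrightarrow> poly q (insize vs) \<le> floorlog 2 (B vs))"
proof (induction q)
  case 0
  then show ?case using fp_zero[of n] by auto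
next
  case (pCons a q)
  then obtain B where B: "fp n B" "\<And>vs. length vs = n \<Longrightarrow> poly q (insize vs) \<le> floorlog 2 (B vs)" by blast
  obtain S where S: "fp n S" "\<And>vs. length vs = n \<Longrightarrow> floorlog 2 (S vs) = insize vs"
    using fp_insize by blast
  obtain C where C: "fp n C" "\<And>vs. length vs = n \<Longrightarrow> floorlog 2 (C vs) = floorlog 2 (S vs) * floorlog 2 (B vs)"
    using fp_smash[OF S(1) B(1)] by blast
  obtain c where c: "fp n (\<lambda>_. c)" "floorlog 2 c = a" using fp_const by blast
  show ?case
    using B(2) S(2) C(2) c(2)
    by (intro exI[of _ "\<lambda>vs. cat c (C vs)"] conjI fp_catI c C) (auto intro: mult_le_mono2)
qed

text \<open>The bound on an inner witness depends on the outer variable \<open>z\<close>. A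
  polynomial length bound is monotone, so the worst case over all \<open>z \<le> t\<close> is again
  bounded in terms of the parameters alone; this provides the fixed block width of sequence
  codes.\<close>

lemma fp_majorant:
  assumes b: "fp (Suc n) b" and t: "fp n t"
  shows "\<exists>C. fp n C \<and> (\<forall>vs z. length vs = n \<longrightarrow> z \<le> t vs \<longrightarrow> floorlog 2 (b (z # vs)) \<le> floorlog 2 (C vs))"
proof -
  obtain pb where pb: "\<And>vs. length vs = Suc n \<Longrightarrow> floorlog 2 (b vs) \<le> poly pb (insize vs)"
    using fpE[OF b] by metis
  obtain pt where pt: "\<And>vs. length vs = n \<Longrightarrow> floorlog 2 (t vs) \<le> poly pt (insize vs)"
    using fpE[OF t] by metis
  obtain C where C: "fp n C"
    "\<And>vs. length vs = n \<Longrightarrow> poly (pcompose pb (pt + [:0, 1:])) (insize vs) \<le> floorlog 2 (C vs)"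
    using fp_poly_bound by blast
  have "floorlog 2 (b (z # vs)) \<le> floorlog 2 (C vs)" if vs: "length vs = n" and z: "z \<le> t vs" for vs z
  proof -
    have "floorlog 2 (b (z # vs)) \<le> poly pb (insize (z # vs))" using pb[of "z # vs"] vs by simp
    also have "\<dots> \<le> poly pb (poly pt (insize vs) + insize vs)"
      using floorlog_mono[OF z, of 2] pt[OF vs] by (intro poly_nat_mono) simp
    also have "\<dots> \<le> floorlog 2 (C vs)" using C(2)[OF vs] by (simp add: poly_pcompose)
    finally show ?thesis .
  qed
  then show ?thesis using C(1) by blast
qed

subsection \<open>Decoding sequences\<close>

text \<open>Digit \<open>y\<close> of \<open>w\<close> in base \<open>2 ^ d\<close>: a sequence is
  stored in blocks of the fixed width \<open>d\<close>, a simple substitute for the beta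
  function.\<close>

definition entry :: "nat \<Rightarrow> nat \<Rightarrow> nat \<Rightarrow> nat" where
  "entry w y d = (w div 2 ^ (d * y)) mod 2 ^ d"

lemma ex_sequence:
  assumes "\<And>y. y < k \<Longrightarrow> z y < 2 ^ d"
  shows "\<exists>w < 2 ^ (d * k). \<forall>y<k. entry w y d = z y"
  using assms
proof (induction k arbitrary: z)
  case (Suc k)
  obtain w where w: "w < 2 ^ (d * k)" "\<And>y. y < k \<Longrightarrow> entry w y d = z (Suc y)"
    using Suc.IH[of "\<lambda>y. z (Suc y)"] Suc.prems by auto
  have z: "z 0 < 2 ^ d" using Suc.prems by simp
  let ?w = "w * 2 ^ d + z 0"
  have "?w < 2 ^ (d * Suc k)"
  proof -
    have "?w < (w + 1) * 2 ^ d" using z by simp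
    also have "\<dots> \<le> 2 ^ (d * k) * 2 ^ d" using w(1) by (intro mult_le_mono1) simp
    finally show ?thesis by (simp add: power_add mult.commute)
  qed
  moreover have "entry ?w y d = z y" if "y < Suc k" for y
  proof (cases y)
    case 0
    then show ?thesis using z by (simp add: entry_def)
  next
    case (Suc i)
    have "?w div 2 ^ (d * Suc i) = (?w div 2 ^ d) div 2 ^ (d * i)"
      by (simp add: power_add div_mult2_eq)
    also have "?w div 2 ^ d = w" using z by simp
    finally show ?thesis using w(2)[of i] that Suc by (simp add: entry_def)
  qed
  ultimately show ?case by blast
qed simp


subsection \<open>Terms, formulas and bounded search\<close>

lemma eval_tm_cong: "closed_tm n t \<Longrightarrow> (\<And>i. i < n \<Longrightarrow> e i = e' i) \<Longrightarrow> eval_tm e t = eval_tm e' t"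
proof (induction t)
  case (Fun k f ts)
  then have "map (eval_tm e) ts = map (eval_tm e') ts" by simp
  then show ?case by (simp only: eval_tm.simps)
qed auto

lemma sat_cong: "closed_fm n \<phi> \<Longrightarrow> (\<And>i. i < n \<Longrightarrow> e i = e' i) \<Longrightarrow> sat e \<phi> = sat e' \<phi>"
proof (induction \<phi> arbitrary: n e e')
  case (Eq s t)
  then show ?case using eval_tm_cong[of n s e e'] eval_tm_cong[of n t e e'] by simp
next
  case (All \<phi>)
  have "sat (case_nat a e) \<phi> = sat (case_nat a e') \<phi>" for a
    by (rule All.IH[of "Suc n"]) (use All.prems in \<open>auto split: nat.splits\<close>)
  then show ?case by simp
next
  case (Ex \<phi>)
  have "sat (case_nat a e) \<phi> = sat (case_nat a e') \<phi>" for a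
    by (rule Ex.IH[of "Suc n"]) (use Ex.prems in \<open>auto split: nat.splits\<close>)
  then show ?case by simp
next
  case (And \<phi> \<psi>)
  then show ?case by (metis closed_fm.simps(3) sat.simps(3))
next
  case (Or \<phi> \<psi>)
  then show ?case by (metis closed_fm.simps(4) sat.simps(4))
next
  case (Neg \<phi>)
  then show ?case by (metis closed_fm.simps(2) sat.simps(2))
qed

lemma fp_eval_tm: "pv_tm t \<Longrightarrow> closed_tm n t \<Longrightarrow> fp n (\<lambda>vs. eval_tm (nth vs) t)"
proof (induction t)
  case (Fun k f ts)
  have "fp n (\<lambda>vs. f (map (\<lambda>g. g vs) (map (\<lambda>t vs. eval_tm (nth vs) t) ts)))"
    by (rule fp_comp) (use Fun in \<open>auto simp: pv_symbol_def poly_time_iff_fp\<close>)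
  then show ?case by (simp add: comp_def)
qed (use fp_one in \<open>auto intro: fp_proj fp_zero\<close>)

abbreviation le_fun :: "nat list \<Rightarrow> nat" where
  "le_fun \<equiv> \<lambda>xs. if length xs = 2 \<and> xs ! 0 \<le> xs ! 1 then 1 else 0"

abbreviation len_fun :: "nat list \<Rightarrow> nat" where
  "len_fun \<equiv> \<lambda>xs. if length xs = 1 then floorlog 2 (xs ! 0) else 0"

section \<open>Search and decoding, given the ordering and the length\<close>

context
  assumes fp_le: "fp 2 le_fun" and fp_len: "fp 1 len_fun"
begin

lemma fp_leI: "fp n a \<Longrightarrow> fp n b \<Longrightarrow> fp n (\<lambda>vs. if a vs \<le> b vs then 1 else 0)"
  using fp_comp2[OF fp_le, of n a b] by simp

lemma fp_lenI: "fp n a \<Longrightarrow> fp n (\<lambda>vs. floorlog 2 (a vs))"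
  using fp_comp1[OF fp_len, of n a] by simp

lemma fp_quantifier_free:
  "quantifier_free \<phi> \<Longrightarrow> pv_fm \<phi> \<Longrightarrow> closed_fm n \<phi> \<Longrightarrow>
     \<exists>c. fp n c \<and> (\<forall>vs. c vs = 0 \<longleftrightarrow> \<not> sat (nth vs) \<phi>)"
proof (induction \<phi>)
  case (Eq s t)
  let ?s = "\<lambda>vs. eval_tm (nth vs) s" and ?t = "\<lambda>vs. eval_tm (nth vs) t"
  have st: "fp n ?s" "fp n ?t" using Eq fp_eval_tm by auto
  \<comment> \<open>Equality is tested by the two comparisons together.\<close>
  show ?case
    by (rule exI, rule conjI, rule fp_ifI[OF fp_leI[OF st] fp_leI[OF st(2,1)] fp_zero]) auto
next
  case (Neg \<phi>)
  then obtain c where c: "fp n c" "\<forall>vs. c vs = 0 \<longleftrightarrow> \<not> sat (nth vs) \<phi>" by auto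
  show ?case by (rule exI, rule conjI, rule fp_ifI[OF c(1) fp_zero fp_one]) (use c(2) in auto)
next
  case (And \<phi> \<psi>)
  then obtain c d where c: "fp n c" "\<forall>vs. c vs = 0 \<longleftrightarrow> \<not> sat (nth vs) \<phi>"
    and d: "fp n d" "\<forall>vs. d vs = 0 \<longleftrightarrow> \<not> sat (nth vs) \<psi>" by auto
  show ?case by (rule exI, rule conjI, rule fp_ifI[OF c(1) d(1) fp_zero]) (use c(2) d(2) in auto)
next
  case (Or \<phi> \<psi>)
  then obtain c d where c: "fp n c" "\<forall>vs. c vs = 0 \<longleftrightarrow> \<not> sat (nth vs) \<phi>"
    and d: "fp n d" "\<forall>vs. d vs = 0 \<longleftrightarrow> \<not> sat (nth vs) \<psi>" by auto
  show ?case by (rule exI, rule conjI, rule fp_ifI[OF c(1) fp_one d(1)]) (use c(2) d(2) in auto)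
qed auto

text \<open>For large \<open>y\<close> no value of length \<open>d * y\<close> can be built, so the
  shift is made of single shifts by \<open>d\<close>, stopped after \<open>y\<close> of them. As
  many rounds as \<open>w\<close> has bits suffice, because by then a nonzero \<open>d\<close> has
  shifted out all of \<open>w\<close>.\<close>

lemma fp_entry:
  assumes w: "fp n w" and y: "fp n y" and b: "fp n b"
  shows "fp n (\<lambda>vs. entry (w vs) (y vs) (floorlog 2 (b vs)))"
proof -
  let ?d = "\<lambda>f ws. f (drop 2 ws)"
  let ?F = "\<lambda>ws. if (if ?d y ws \<le> floorlog 2 (ws ! 0) then 1 else 0 :: nat) = 0
    then ws ! 1 div 2 ^ floorlog 2 (?d b ws) else ws ! 1"
  have F: "fp (n + 2) ?F"
    by (intro fp_ifI fp_leI fp_lenI fp_shrI fp_drop[OF y] fp_drop[OF b] fp_proj) simp_all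
  have it: "iterate ?F vs (w vs) i = w vs div 2 ^ (floorlog 2 (b vs) * min i (y vs))" for vs i
  proof (induction i)
    case (Suc i)
    then show ?case
      by (cases "i < y vs") (simp_all add: min_def div_mult2_eq[symmetric] power_add[symmetric] add.commute)
  qed simp
  obtain p where p: "\<And>vs. length vs = n \<Longrightarrow> floorlog 2 (w vs) \<le> poly p (insize vs)"
    using fpE[OF w] by metis
  have "fp n (\<lambda>vs. iterate ?F vs (w vs) (floorlog 2 (w vs)))"
  proof (rule fp_iterate[OF F w w, of p])
    fix vs :: "nat list" and i
    assume "length vs = n"
    from le_trans[OF diff_le_self p[OF this]]
    show "floorlog 2 (iterate ?F vs (w vs) i) \<le> poly p (insize vs)"
      unfolding it floorlog_shr .
  qed
  then have "fp n (\<lambda>vs. iterate ?F vs (w vs) (floorlog 2 (w vs)) mod 2 ^ floorlog 2 (b vs))"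
    by (rule fp_lowI[OF _ b])
  moreover have "iterate ?F vs (w vs) (floorlog 2 (w vs)) mod 2 ^ floorlog 2 (b vs) =
      entry (w vs) (y vs) (floorlog 2 (b vs))" for vs
  proof (cases "y vs \<le> floorlog 2 (w vs) \<or> floorlog 2 (b vs) = 0")
    case True
    then show ?thesis unfolding it entry_def by (auto simp: min_absorb2)
  next
    case False
    \<comment> \<open>Here \<open>y\<close> exceeds the number of rounds, but both the shift
      performed and the shift wanted are at least the length of \<open>w\<close> and leave
      0.\<close>
    then have "floorlog 2 (w vs) \<le> floorlog 2 (b vs) * floorlog 2 (w vs)"
      "floorlog 2 (w vs) \<le> floorlog 2 (b vs) * y vs"
      by (auto intro: le_trans[of _ "y vs"])
    then have "w vs < 2 ^ (floorlog 2 (b vs) * floorlog 2 (w vs))" "w vs < 2 ^ (floorlog 2 (b vs) * y vs)"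
      by (auto intro: less_pow_floorlog)
    then show ?thesis using False unfolding it entry_def by (simp add: min_absorb1)
  qed
  ultimately show ?thesis by (rule fp_cong)
qed

text \<open>The candidate is kept in unary, as the length of the loop value, and grows by one until
  it is a witness. Candidates run up to \<open>floorlog 2 (t vs)\<close> inclusive, one more than
  there are rounds: if all smaller ones fail, the last one is what remains.\<close>

lemma fp_search:
  assumes c: "fp (Suc n) c" and t: "fp n t"
  shows "\<exists>g. fp n g \<and> (\<forall>vs y. length vs = n \<longrightarrow> y \<le> floorlog 2 (t vs) \<longrightarrow> c (y # vs) \<noteq> 0 \<longrightarrow>
    g vs \<le> floorlog 2 (t vs) \<and> c (g vs # vs) \<noteq> 0)"
proof -
  let ?F = "\<lambda>ws. if c (floorlog 2 (ws ! 1) # drop 2 ws) = 0 then cat 1 (ws ! 1) else ws ! 1"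
  have 1: "fp (n + 2) (\<lambda>ws. c (map (\<lambda>g. g ws) ((\<lambda>ws. floorlog 2 (ws ! 1)) # map (\<lambda>i ws. ws ! (i + 2)) [0..<n])))"
    by (rule fp_comp[OF c]) (auto intro!: fp_lenI fp_proj)
  have 2: "map (\<lambda>g. g ws) ((\<lambda>ws. floorlog 2 (ws ! 1)) # map (\<lambda>i ws. ws ! (i + 2)) [0..<n]) =
      floorlog 2 (ws ! 1) # drop 2 ws" if "length ws = n + 2" for ws
    using that by (auto intro!: nth_equalityI simp: add.commute)
  have "fp (n + 2) (\<lambda>ws. c (floorlog 2 (ws ! 1) # drop 2 ws))"
    by (rule fp_cong[OF 1]) (simp only: 2)
  then have F: "fp (n + 2) ?F" by (intro fp_ifI fp_catI fp_one fp_proj) simp_all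
  have le: "floorlog 2 (iterate ?F vs 0 i) \<le> i" for vs i
    by (induction i) auto
  obtain p where p: "\<And>vs. length vs = n \<Longrightarrow> floorlog 2 (t vs) \<le> poly p (insize vs)"
    using fpE[OF t] by metis
  have "fp n (\<lambda>vs. iterate ?F vs 0 (floorlog 2 (t vs)))"
  proof (rule fp_iterate[OF F t fp_zero, of p])
    fix vs :: "nat list" and i
    assume "length vs = n" "i \<le> floorlog 2 (t vs)"
    then show "floorlog 2 (iterate ?F vs 0 i) \<le> poly p (insize vs)"
      using p[of vs] le[of vs i] by linarith
  qed
  then have "fp n (\<lambda>vs. floorlog 2 (iterate ?F vs 0 (floorlog 2 (t vs))))" by (rule fp_lenI)
  moreover have "c (floorlog 2 (iterate ?F vs 0 (floorlog 2 (t vs))) # vs) \<noteq> 0"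
    if y: "y \<le> floorlog 2 (t vs)" "c (y # vs) \<noteq> 0" for vs y
  proof -
    define l where "l = (LEAST y. c (y # vs) \<noteq> 0)"
    have l: "c (l # vs) \<noteq> 0" "\<And>i. i < l \<Longrightarrow> c (i # vs) = 0" "l \<le> y"
      unfolding l_def using y(2) by (auto intro: LeastI Least_le dest: not_less_Least)
    have "floorlog 2 (iterate ?F vs 0 i) = min i l" for i
    proof (induction i)
      case (Suc i)
      then show ?case using l(1,2) by (cases "i < l") (auto simp: min_def)
    qed simp
    then show ?thesis using l y by (simp add: min_absorb2)
  qed
  ultimately show ?thesis using le by blast
qed

end


section \<open>Substitution and truth\<close>

lemma eval_subst_tm: "eval_tm e (subst_tm \<sigma> t) = eval_tm (\<lambda>i. eval_tm e (\<sigma> i)) t"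
proof (induction t)
  case (Fun k f ts)
  then have "map (eval_tm e) (map (subst_tm \<sigma>) ts) = map (eval_tm (\<lambda>i. eval_tm e (\<sigma> i))) ts" by simp
  then show ?case by (simp only: eval_tm.simps subst_tm.simps)
qed auto

lemma subst_subst_tm: "subst_tm \<tau> (subst_tm \<sigma> t) = subst_tm (\<lambda>i. subst_tm \<tau> (\<sigma> i)) t"
  by (induction t) auto

lemma subst_tm_Var [simp]: "subst_tm Var t = t"
  by (induction t) (auto intro: map_idI)

lemma eval_shift [simp]: "eval_tm (case_nat a e) (shift_tm t) = eval_tm e t"
  by (simp add: shift_tm_def eval_subst_tm)

lemma subst_shift: "subst_tm (under_binder \<sigma>) (shift_tm t) = shift_tm (subst_tm \<sigma> t)"
  by (simp add: shift_tm_def subst_subst_tm under_binder_def)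

lemma eval_under_binder:
  "(\<lambda>i. eval_tm (case_nat a e) (under_binder \<sigma> i)) = case_nat a (\<lambda>i. eval_tm e (\<sigma> i))"
  by (auto simp: fun_eq_iff under_binder_def split: nat.splits)

lemma sat_subst: "sat e (subst_fm \<sigma> \<phi>) \<longleftrightarrow> sat (\<lambda>i. eval_tm e (\<sigma> i)) \<phi>"
  by (induction \<phi> arbitrary: e \<sigma>) (auto simp: eval_subst_tm eval_under_binder)

lemma sat_inst: "sat e (inst_fm t \<phi>) \<longleftrightarrow> sat (case_nat (eval_tm e t) e) \<phi>"
proof -
  have "(\<lambda>i. eval_tm e (case_nat t Var i)) = case_nat (eval_tm e t) e"
    by (auto simp: fun_eq_iff split: nat.splits)
  then show ?thesis by (simp add: inst_fm_def sat_subst)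
qed

lemma sat_shift: "sat (case_nat a e) (shift_fm \<phi>) \<longleftrightarrow> sat e \<phi>"
  by (simp add: shift_fm_def sat_subst)

lemma pv_subst_tm: "pv_tm t \<Longrightarrow> (\<And>i. pv_tm (\<sigma> i)) \<Longrightarrow> pv_tm (subst_tm \<sigma> t)"
  by (induction t) auto

lemma pv_shift [simp]: "pv_tm (shift_tm t) \<longleftrightarrow> pv_tm t"
  by (induction t) (auto simp: shift_tm_def)

lemma pv_under_binder: "(\<And>i. pv_tm (\<sigma> i)) \<Longrightarrow> pv_tm (under_binder \<sigma> i)"
  by (auto simp: under_binder_def split: nat.splits)

lemma pv_subst_fm: "pv_fm \<phi> \<Longrightarrow> (\<And>i. pv_tm (\<sigma> i)) \<Longrightarrow> pv_fm (subst_fm \<sigma> \<phi>)"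
  by (induction \<phi> arbitrary: \<sigma>) (auto simp: pv_subst_tm pv_under_binder)

lemma closed_subst_tm: "closed_tm n t \<Longrightarrow> (\<And>i. i < n \<Longrightarrow> closed_tm m (\<sigma> i)) \<Longrightarrow> closed_tm m (subst_tm \<sigma> t)"
  by (induction t) auto

lemma closed_shift [simp]: "closed_tm (Suc n) (shift_tm t) \<longleftrightarrow> closed_tm n t"
  by (induction t) (auto simp: shift_tm_def)

lemma closed_under_binder:
  "(\<And>i. i < n \<Longrightarrow> closed_tm m (\<sigma> i)) \<Longrightarrow> i < Suc n \<Longrightarrow> closed_tm (Suc m) (under_binder \<sigma> i)"
  by (auto simp: under_binder_def split: nat.splits)

lemma closed_subst_fm:
  "closed_fm n \<phi> \<Longrightarrow> (\<And>i. i < n \<Longrightarrow> closed_tm m (\<sigma> i)) \<Longrightarrow> closed_fm m (subst_fm \<sigma> \<phi>)"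
proof (induction \<phi> arbitrary: n m \<sigma>)
  case (All \<phi>)
  have "closed_fm (Suc m) (subst_fm (under_binder \<sigma>) \<phi>)"
    by (rule All.IH[of "Suc n"]) (use All.prems closed_under_binder[of n m \<sigma>] in auto)
  then show ?case by simp
next
  case (Ex \<phi>)
  have "closed_fm (Suc m) (subst_fm (under_binder \<sigma>) \<phi>)"
    by (rule Ex.IH[of "Suc n"]) (use Ex.prems closed_under_binder[of n m \<sigma>] in auto)
  then show ?case by simp
next
  case (Eq s t)
  then show ?case using closed_subst_tm by auto
qed auto

lemma sat_Le [simp]: "sat e (Le s t) \<longleftrightarrow> eval_tm e s \<le> eval_tm e t"
  by (simp add: Le_def)

lemma sat_BEx: "sat e (BEx t \<phi>) \<longleftrightarrow> (\<exists>a\<le>eval_tm e t. sat (case_nat a e) \<phi>)"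
  by (simp add: BEx_def)

lemma sat_BAll: "sat e (BAll t \<phi>) \<longleftrightarrow> (\<forall>a\<le>eval_tm e t. sat (case_nat a e) \<phi>)"
  by (auto simp: BAll_def)

lemma subst_BEx: "subst_fm \<sigma> (BEx t \<phi>) = BEx (subst_tm \<sigma> t) (subst_fm (under_binder \<sigma>) \<phi>)"
  using subst_shift by (simp add: BEx_def Le_def under_binder_def)

lemma subst_BAll: "subst_fm \<sigma> (BAll t \<phi>) = BAll (subst_tm \<sigma> t) (subst_fm (under_binder \<sigma>) \<phi>)"
  using subst_shift by (simp add: BAll_def Le_def under_binder_def)

lemma quantifier_free_subst [simp]: "quantifier_free (subst_fm \<sigma> \<phi>) \<longleftrightarrow> quantifier_free \<phi>"
  by (induction \<phi> arbitrary: \<sigma>) auto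

lemma strict_subst:
  "sigma_b j \<phi> \<Longrightarrow> sigma_b j (subst_fm \<sigma> \<phi>)"
  "pi_b j \<phi> \<Longrightarrow> pi_b j (subst_fm \<sigma> \<phi>)"
  by (induction arbitrary: \<sigma> and \<sigma> rule: sigma_b_pi_b.inducts)
     (auto simp: subst_BEx subst_BAll intro: sigma_b_pi_b.intros)

lemma quantifier_free_strict: "quantifier_free \<phi> \<Longrightarrow> sigma_b j \<phi> \<and> pi_b j \<phi>"
  by (induction j) (auto intro: sigma_b_pi_b.intros)

lemma strict_0:
  "sigma_b j \<phi> \<Longrightarrow> j = 0 \<Longrightarrow> quantifier_free \<phi>"
  "pi_b j \<phi> \<Longrightarrow> j = 0 \<Longrightarrow> quantifier_free \<phi>"
  by (induction rule: sigma_b_pi_b.inducts) auto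

text \<open>The guard makes the symbol vanish on lists of the wrong length, as
  \<open>pv_symbol\<close> demands, while evaluation at the given terms is unaffected.\<close>

definition app :: "(nat list \<Rightarrow> nat) \<Rightarrow> tm list \<Rightarrow> tm" where
  "app f ts = Fun (length ts) (\<lambda>xs. if length xs = length ts then f xs else 0) ts"

lemma eval_app [simp]: "eval_tm e (app f ts) = f (map (eval_tm e) ts)"
  by (simp add: app_def)

lemma closed_app [simp]: "closed_tm n (app f ts) \<longleftrightarrow> (\<forall>t\<in>set ts. closed_tm n t)"
  by (simp add: app_def)

lemma pv_app:
  assumes "fp (length ts) f" "\<And>t. t \<in> set ts \<Longrightarrow> pv_tm t"
  shows "pv_tm (app f ts)"
proof -
  have "fp (length ts) (\<lambda>xs. if length xs = length ts then f xs else 0)"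
    by (rule fp_cong[OF assms(1)]) simp
  then show ?thesis using assms(2) by (simp add: app_def pv_symbol_def poly_time_iff_fp)
qed

abbreviation vars :: "nat \<Rightarrow> nat \<Rightarrow> tm list" where
  "vars k n \<equiv> map (\<lambda>i. Var (i + k)) [0..<n]"

section \<open>Sharply bounded quantifiers over strict formulas\<close>

context
  assumes fp_le: "fp 2 le_fun" and fp_len: "fp 1 len_fun"
begin

lemma pv_Le [simp]: "pv_fm (Le s t) \<longleftrightarrow> pv_tm s \<and> pv_tm t"
  using fp_le by (auto simp: Le_def pv_symbol_def poly_time_iff_fp)

lemma pv_len_tm [simp]: "pv_tm (len_tm t) \<longleftrightarrow> pv_tm t"
  using fp_len by (simp add: len_tm_def pv_symbol_def poly_time_iff_fp)

lemma eval_len_tm [simp]: "eval_tm e (len_tm t) = floorlog 2 (eval_tm e t)"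
  by (simp add: len_tm_def)

lemma closed_len_tm [simp]: "closed_tm n (len_tm t) \<longleftrightarrow> closed_tm n t"
  by (simp add: len_tm_def)

lemma closed_Le [simp]: "closed_fm n (Le s t) \<longleftrightarrow> closed_tm n s \<and> closed_tm n t"
  by (simp add: Le_def)

lemma pv_BEx [simp]: "pv_fm (BEx t \<phi>) \<longleftrightarrow> pv_tm t \<and> pv_fm \<phi>"
  and pv_BAll [simp]: "pv_fm (BAll t \<phi>) \<longleftrightarrow> pv_tm t \<and> pv_fm \<phi>"
  by (simp_all add: BEx_def BAll_def)

lemma closed_BEx [simp]: "closed_fm n (BEx t \<phi>) \<longleftrightarrow> closed_tm n t \<and> closed_fm (Suc n) \<phi>"
  and closed_BAll [simp]: "closed_fm n (BAll t \<phi>) \<longleftrightarrow> closed_tm n t \<and> closed_fm (Suc n) \<phi>"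
  by (simp_all add: BEx_def BAll_def)

text \<open>Quantifier-free formulas have polynomial-time characteristic functions, so a witness can
  be searched for; truth and bound depend on the first \<open>n\<close> variables only, which are
  the arguments of \<open>g\<close>.\<close>

lemma skolem:
  assumes "quantifier_free \<phi>" "pv_fm \<phi>" "closed_fm (Suc n) \<phi>" "pv_tm t" "closed_tm n t"
  shows "\<exists>g. fp n g \<and> (\<forall>e y. y \<le> floorlog 2 (eval_tm e t) \<longrightarrow> sat (case_nat y e) \<phi> \<longrightarrow>
    g (map e [0..<n]) \<le> floorlog 2 (eval_tm e t) \<and> sat (case_nat (g (map e [0..<n])) e) \<phi>)"
proof -
  obtain c where c: "fp (Suc n) c" "\<And>vs. c vs = 0 \<longleftrightarrow> \<not> sat (nth vs) \<phi>"
    using fp_quantifier_free[OF fp_le fp_len assms(1,2,3)] by blast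
  have t: "fp n (\<lambda>vs. eval_tm (nth vs) t)" by (rule fp_eval_tm[OF assms(4,5)])
  obtain g where g: "fp n g" "\<And>vs y. length vs = n \<Longrightarrow> y \<le> floorlog 2 (eval_tm (nth vs) t) \<Longrightarrow>
      c (y # vs) \<noteq> 0 \<Longrightarrow> g vs \<le> floorlog 2 (eval_tm (nth vs) t) \<and> c (g vs # vs) \<noteq> 0"
    using fp_search[OF fp_le fp_len c(1) t] by blast
  have s: "c (y # map e [0..<n]) \<noteq> 0 \<longleftrightarrow> sat (case_nat y e) \<phi>" for y e
  proof -
    have "sat (nth (y # map e [0..<n])) \<phi> \<longleftrightarrow> sat (case_nat y e) \<phi>"
      by (rule sat_cong[OF assms(3)]) (auto split: nat.splits)
    then show ?thesis by (simp only: c(2) not_not)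
  qed
  have "eval_tm (nth (map e [0..<n])) t = eval_tm e t" for e
    by (rule eval_tm_cong[OF assms(5)]) simp
  with g(2)[of "map e [0..<n]" for e] s g(1) show ?thesis by auto
qed

text \<open>\<open>g\<close> finds a counterexample if there is one, so a single instance decides
  the quantifier. Without a counterexample nothing is known about its value, hence the disjunct on
  the bound.\<close>

lemma quantifier_free_BAll:
  assumes "quantifier_free \<phi>" "pv_fm \<phi>" "closed_fm (Suc n) \<phi>" "pv_tm t" "closed_tm n t"
  shows "\<exists>\<psi>. quantifier_free \<psi> \<and> pv_fm \<psi> \<and> closed_fm n \<psi> \<and> (\<forall>e. sat e \<psi> \<longleftrightarrow> sat e (BAll (len_tm t) \<phi>))"
proof -
  obtain g where g: "fp n g" "\<And>e y. y \<le> floorlog 2 (eval_tm e t) \<Longrightarrow> \<not> sat (case_nat y e) \<phi> \<Longrightarrow>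
    g (map e [0..<n]) \<le> floorlog 2 (eval_tm e t) \<and> \<not> sat (case_nat (g (map e [0..<n])) e) \<phi>"
    using skolem[of "Neg \<phi>" n t] assms by auto
  let ?G = "app g (vars 0 n)"
  let ?\<psi> = "Or (Neg (Le ?G (len_tm t))) (inst_fm ?G \<phi>)"
  have G: "pv_tm ?G" by (rule pv_app) (use g(1) in auto)
  have "quantifier_free ?\<psi>" using assms(1) by (simp add: inst_fm_def Le_def)
  moreover have "pv_fm (inst_fm ?G \<phi>)"
    unfolding inst_fm_def by (rule pv_subst_fm[OF assms(2)]) (use G in \<open>auto split: nat.splits\<close>)
  moreover have "closed_fm n (inst_fm ?G \<phi>)"
    unfolding inst_fm_def by (rule closed_subst_fm[OF assms(3)]) (auto split: nat.splits)
  moreover have "sat e ?\<psi> \<longleftrightarrow> sat e (BAll (len_tm t) \<phi>)" for e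
    using g(2)[of _ e] by (auto simp: sat_BAll sat_inst comp_def)
  ultimately show ?thesis using G assms(4,5) by (intro exI[of _ ?\<psi>]) auto
qed

text \<open>A predicate on environments rather than a formula: the closure properties concern truth
  only, and the negation of a formula can be brought into this form without rewriting the
  formula.\<close>

definition nf :: "nat \<Rightarrow> nat \<Rightarrow> ((nat \<Rightarrow> nat) \<Rightarrow> bool) \<Rightarrow> bool" where
  "nf j n F \<longleftrightarrow> (\<exists>B \<chi>. fp n B \<and> pi_b j \<chi> \<and> pv_fm \<chi> \<and> closed_fm (Suc n) \<chi> \<and>
     (\<forall>e. F e \<longleftrightarrow> (\<exists>w\<le>B (map e [0..<n]). sat (case_nat w e) \<chi>)))"

text \<open>Moving the bound into the matrix, where as a quantifier-free conjunct it does not raise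
  the level, lets later arguments quantify over all \<open>w\<close>.\<close>

lemma nfE:
  assumes "nf j n F"
  obtains B \<chi> where "fp n B" "pi_b j \<chi>" "pv_fm \<chi>" "closed_fm (Suc n) \<chi>"
    "\<And>e. F e \<longleftrightarrow> (\<exists>w. sat (case_nat w e) \<chi>)"
    "\<And>w e. sat (case_nat w e) \<chi> \<Longrightarrow> w \<le> B (map e [0..<n])"
proof -
  obtain B \<chi> where B: "fp n B" and \<chi>: "pi_b j \<chi>" "pv_fm \<chi>" "closed_fm (Suc n) \<chi>"
    and F: "\<And>e. F e \<longleftrightarrow> (\<exists>w\<le>B (map e [0..<n]). sat (case_nat w e) \<chi>)"
    using assms unfolding nf_def by blast
  let ?\<chi> = "And (Le (Var 0) (app B (vars 1 n))) \<chi>"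
  have "pv_tm (app B (vars 1 n))" by (rule pv_app) (use B in auto)
  moreover have "pi_b j (Le (Var 0) (app B (vars 1 n)))"
    by (intro quantifier_free_strict[THEN conjunct2]) (simp add: Le_def)
  ultimately show ?thesis
    by (intro that[OF B, of ?\<chi>]) (use \<chi> F in \<open>auto simp: comp_def intro: sigma_b_pi_b.intros\<close>)
qed

section \<open>Closure properties of the normal form\<close>

lemma nf_mono: "nf j n F \<Longrightarrow> nf (Suc j) n F"
  unfolding nf_def by (meson sigma_b_pi_b.intros(6))

lemma nf_pi:
  assumes "pi_b j \<phi>" "pv_fm \<phi>" "closed_fm n \<phi>"
  shows "nf j n (\<lambda>e. sat e \<phi>)"
proof -
  have "pi_b j (shift_fm \<phi>)" "pv_fm (shift_fm \<phi>)" "closed_fm (Suc n) (shift_fm \<phi>)"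
    unfolding shift_fm_def using assms strict_subst(2) pv_subst_fm closed_subst_fm[OF assms(3)] by simp_all
  moreover have "sat e \<phi> \<longleftrightarrow> (\<exists>w\<le>0. sat (case_nat w e) (shift_fm \<phi>))" for e
    by (simp add: sat_shift)
  ultimately show ?thesis unfolding nf_def using fp_zero by blast
qed

lemma nf_disj:
  assumes "nf j n F" "nf j n G"
  shows "nf j n (\<lambda>e. F e \<or> G e)"
proof -
  obtain B \<chi> where B: "fp n B" and \<chi>: "pi_b j \<chi>" "pv_fm \<chi>" "closed_fm (Suc n) \<chi>"
    and F: "\<And>e. F e \<longleftrightarrow> (\<exists>w. sat (case_nat w e) \<chi>)" "\<And>w e. sat (case_nat w e) \<chi> \<Longrightarrow> w \<le> B (map e [0..<n])"
    using nfE[OF assms(1)] by metis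
  obtain C \<psi> where C: "fp n C" and \<psi>: "pi_b j \<psi>" "pv_fm \<psi>" "closed_fm (Suc n) \<psi>"
    and G: "\<And>e. G e \<longleftrightarrow> (\<exists>w. sat (case_nat w e) \<psi>)" "\<And>w e. sat (case_nat w e) \<psi> \<Longrightarrow> w \<le> C (map e [0..<n])"
    using nfE[OF assms(2)] by metis
  have "(F e \<or> G e) \<longleftrightarrow> (\<exists>w\<le>cat (B (map e [0..<n])) (C (map e [0..<n])). sat (case_nat w e) (Or \<chi> \<psi>))" for e
  proof -
    have "w \<le> cat (B (map e [0..<n])) (C (map e [0..<n]))" if "sat (case_nat w e) (Or \<chi> \<psi>)" for w
    proof -
      from that consider "sat (case_nat w e) \<chi>" | "sat (case_nat w e) \<psi>" by auto
      then show ?thesis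
      proof cases
        case 1
        from le_trans[OF F(2)[OF this] le_cat(1)] show ?thesis .
      next
        case 2
        from le_trans[OF G(2)[OF this] le_cat(2)] show ?thesis .
      qed
    qed
    then show ?thesis using F(1)[of e] G(1)[of e] by auto
  qed
  moreover have "pi_b j (Or \<chi> \<psi>)" "pv_fm (Or \<chi> \<psi>)" "closed_fm (Suc n) (Or \<chi> \<psi>)"
    using \<chi> \<psi> by (simp_all add: sigma_b_pi_b.intros)
  ultimately show ?thesis unfolding nf_def using fp_catI[OF B C] by blast
qed

definition entry_tm :: "(nat list \<Rightarrow> nat) \<Rightarrow> tm \<Rightarrow> tm \<Rightarrow> tm list \<Rightarrow> tm" where
  "entry_tm D w y ts = app (\<lambda>vs. entry (vs ! 0) (vs ! 1) (floorlog 2 (D (drop 2 vs)))) (w # y # ts)"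

lemma eval_entry_tm [simp]:
  "eval_tm e (entry_tm D w y ts) = entry (eval_tm e w) (eval_tm e y) (floorlog 2 (D (map (eval_tm e) ts)))"
  by (simp add: entry_tm_def)

lemma closed_entry_tm [simp]:
  "closed_tm n (entry_tm D w y ts) \<longleftrightarrow> closed_tm n w \<and> closed_tm n y \<and> (\<forall>t\<in>set ts. closed_tm n t)"
  by (simp add: entry_tm_def)

lemma pv_entry_tm:
  assumes "fp (length ts) D" "pv_tm w" "pv_tm y" "\<And>t. t \<in> set ts \<Longrightarrow> pv_tm t"
  shows "pv_tm (entry_tm D w y ts)"
  unfolding entry_tm_def
proof (rule pv_app)
  have "fp (length ts + 2) (\<lambda>vs. entry (vs ! 0) (vs ! 1) (floorlog 2 (D (drop 2 vs))))"
    by (intro fp_entry[OF fp_le fp_len] fp_drop[OF assms(1)] fp_proj) simp_all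
  then show "fp (length (w # y # ts)) (\<lambda>vs. entry (vs ! 0) (vs ! 1) (floorlog 2 (D (drop 2 vs))))" by simp
qed (use assms in auto)

lemma ex_pair:
  assumes "x < 2 ^ d" "y < 2 ^ d"
  shows "\<exists>w<2 ^ (d + d). entry w 0 d = x \<and> entry w 1 d = y"
proof -
  have "\<exists>w<2 ^ (d * 2). \<forall>i<2. entry w i d = (if i = 0 then x else y)"
    by (rule ex_sequence) (use assms in simp)
  then show ?thesis by (auto simp: mult_2_right)
qed

lemma less_pair_bound: "w < 2 ^ (floorlog 2 d + floorlog 2 d) \<Longrightarrow> w \<le> cat 1 (cat d d)"
  using pow_le_cat_1[of "cat d d"] by simp

text \<open>The two witnesses become the entries 0 and 1 of one number, in blocks as wide as a
  common bound is long; each matrix reads its own entry through a substitution, which keeps its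
  level.\<close>

lemma nf_conj:
  assumes "nf j n F" "nf j n G"
  shows "nf j n (\<lambda>e. F e \<and> G e)"
proof -
  obtain B \<chi> where B: "fp n B" and \<chi>: "pi_b j \<chi>" "pv_fm \<chi>" "closed_fm (Suc n) \<chi>"
    and F: "\<And>e. F e \<longleftrightarrow> (\<exists>w. sat (case_nat w e) \<chi>)" "\<And>w e. sat (case_nat w e) \<chi> \<Longrightarrow> w \<le> B (map e [0..<n])"
    using nfE[OF assms(1)] by metis
  obtain C \<psi> where C: "fp n C" and \<psi>: "pi_b j \<psi>" "pv_fm \<psi>" "closed_fm (Suc n) \<psi>"
    and G: "\<And>e. G e \<longleftrightarrow> (\<exists>w. sat (case_nat w e) \<psi>)" "\<And>w e. sat (case_nat w e) \<psi> \<Longrightarrow> w \<le> C (map e [0..<n])"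
    using nfE[OF assms(2)] by metis
  let ?D = "\<lambda>vs. cat (B vs) (C vs)"
  have D: "fp n ?D" by (rule fp_catI[OF B C])
  define \<sigma> where "\<sigma> y = case_nat (entry_tm ?D (Var 0) y (vars 1 n)) (\<lambda>i. Var (Suc i))" for y
  have pv: "pv_tm (\<sigma> y i)" if "pv_tm y" for y i
    using that D by (auto simp: \<sigma>_def intro!: pv_entry_tm split: nat.splits)
  have cl: "closed_tm (Suc n) (\<sigma> y i)" if "closed_tm (Suc n) y" "i < Suc n" for y i
    using that by (auto simp: \<sigma>_def split: nat.splits)
  have sat: "sat (case_nat w e) (subst_fm (\<sigma> y) \<phi>) \<longleftrightarrow>
      sat (case_nat (entry w (eval_tm (case_nat w e) y) (floorlog 2 (?D (map e [0..<n])))) e) \<phi>" for w e y \<phi>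
  proof -
    have "(\<lambda>i. eval_tm (case_nat w e) (\<sigma> y i)) =
        case_nat (entry w (eval_tm (case_nat w e) y) (floorlog 2 (?D (map e [0..<n])))) e"
      by (auto simp: \<sigma>_def fun_eq_iff comp_def split: nat.splits)
    then show ?thesis by (simp only: sat_subst)
  qed
  let ?\<theta> = "And (subst_fm (\<sigma> Zero) \<chi>) (subst_fm (\<sigma> One) \<psi>)"
  have "(F e \<and> G e) \<longleftrightarrow> (\<exists>w\<le>cat 1 (cat (?D (map e [0..<n])) (?D (map e [0..<n]))). sat (case_nat w e) ?\<theta>)" for e
  proof
    assume "F e \<and> G e"
    then obtain x y where x: "sat (case_nat x e) \<chi>" and y: "sat (case_nat y e) \<psi>" using F(1) G(1) by blast
    let ?d = "?D (map e [0..<n])"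
    have "x < 2 ^ floorlog 2 ?d" "y < 2 ^ floorlog 2 ?d"
      using floorlog_mono[OF F(2)[OF x], of 2] floorlog_mono[OF G(2)[OF y], of 2]
      by (auto intro!: less_pow_floorlog)
    from ex_pair[OF this] obtain w where "w < 2 ^ (floorlog 2 ?d + floorlog 2 ?d)"
      "entry w 0 (floorlog 2 ?d) = x" "entry w 1 (floorlog 2 ?d) = y" by blast
    with x y less_pair_bound[of w ?d] show "\<exists>w\<le>cat 1 (cat ?d ?d). sat (case_nat w e) ?\<theta>"
      by (intro exI[of _ w]) (simp add: sat)
  qed (use F(1) G(1) in \<open>auto simp: sat\<close>)
  moreover have "pv_fm ?\<theta>" using \<chi>(2) \<psi>(2) by (auto intro!: pv_subst_fm pv)
  moreover have "closed_fm (Suc n) ?\<theta>"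
    using closed_subst_fm[OF \<chi>(3) cl[of Zero]] closed_subst_fm[OF \<psi>(3) cl[of One]] by simp
  moreover have "pi_b j ?\<theta>" using \<chi>(1) \<psi>(1) by (intro sigma_b_pi_b.intros strict_subst)
  ultimately show ?thesis unfolding nf_def using fp_catI[OF fp_one fp_catI[OF D D]] by blast
qed

lemma map_case_nat: "map (case_nat z e) [0..<Suc n] = z # map e [0..<n]"
  by (simp add: upt_conv_Cons map_Suc_upt[symmetric] comp_def del: upt_Suc)

text \<open>Two adjacent bounded quantifiers are contracted by pairing. Entry 0 is the witness of
  the matrix and entry 1 the value of \<open>z\<close>; \<open>fp_majorant\<close> supplies a block
  width that does not depend on \<open>z\<close>.\<close>

lemma nf_bounded_ex:
  assumes "nf j (Suc n) F" "pv_tm t" "closed_tm n t"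
  shows "nf j n (\<lambda>e. \<exists>z\<le>eval_tm e t. F (case_nat z e))"
proof -
  obtain B \<chi> where B: "fp (Suc n) B" and \<chi>: "pi_b j \<chi>" "pv_fm \<chi>" "closed_fm (Suc (Suc n)) \<chi>"
    and F: "\<And>e. F e \<longleftrightarrow> (\<exists>w. sat (case_nat w e) \<chi>)" "\<And>w e. sat (case_nat w e) \<chi> \<Longrightarrow> w \<le> B (map e [0..<Suc n])"
    using nfE[OF assms(1)] by metis
  let ?t = "\<lambda>vs. eval_tm (nth vs) t"
  have t: "fp n ?t" by (rule fp_eval_tm[OF assms(2,3)])
  have te: "?t (map e [0..<n]) = eval_tm e t" for e by (rule eval_tm_cong[OF assms(3)]) simp
  obtain C where C: "fp n C" "\<And>vs z. length vs = n \<Longrightarrow> z \<le> ?t vs \<Longrightarrow> floorlog 2 (B (z # vs)) \<le> floorlog 2 (C vs)"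
    using fp_majorant[OF B t] by blast
  let ?D = "\<lambda>vs. cat (?t vs) (C vs)"
  have D: "fp n ?D" by (rule fp_catI[OF t C(1)])
  define E where "E y = entry_tm ?D (Var 0) y (vars 1 n)" for y
  define \<sigma> where "\<sigma> = case_nat (E Zero) (case_nat (E One) (\<lambda>i. Var (Suc i)))"
  have pvE: "pv_tm (E y)" if "pv_tm y" for y using that D by (auto simp: E_def intro!: pv_entry_tm)
  have pv: "pv_tm (\<sigma> i)" for i using pvE by (auto simp: \<sigma>_def split: nat.splits)
  have clE: "closed_tm (Suc n) (E y)" if "closed_tm (Suc n) y" for y using that by (auto simp: E_def)
  have cl: "closed_tm (Suc n) (\<sigma> i)" if "i < Suc (Suc n)" for i
    using that clE by (auto simp: \<sigma>_def split: nat.splits)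
  let ?e = "\<lambda>w y e. entry w y (floorlog 2 (?D (map e [0..<n])))"
  have evE: "eval_tm (case_nat w e) (E y) = ?e w (eval_tm (case_nat w e) y) e" for w e y
    by (simp add: E_def comp_def)
  have sat: "sat (case_nat w e) (subst_fm \<sigma> \<phi>) \<longleftrightarrow> sat (case_nat (?e w 0 e) (case_nat (?e w 1 e) e)) \<phi>" for w e \<phi>
  proof -
    have "(\<lambda>i. eval_tm (case_nat w e) (\<sigma> i)) = case_nat (?e w 0 e) (case_nat (?e w 1 e) e)"
      by (auto simp: \<sigma>_def fun_eq_iff evE split: nat.splits)
    then show ?thesis by (simp only: sat_subst)
  qed
  let ?\<theta> = "And (Le (E One) (shift_tm t)) (subst_fm \<sigma> \<chi>)"
  have "(\<exists>z\<le>eval_tm e t. F (case_nat z e)) \<longleftrightarrow>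
      (\<exists>w\<le>cat 1 (cat (?D (map e [0..<n])) (?D (map e [0..<n]))). sat (case_nat w e) ?\<theta>)" for e
  proof
    assume "\<exists>z\<le>eval_tm e t. F (case_nat z e)"
    then obtain z x where z: "z \<le> eval_tm e t" and x: "sat (case_nat x (case_nat z e)) \<chi>" using F(1) by blast
    let ?d = "?D (map e [0..<n])"
    have "floorlog 2 x \<le> floorlog 2 (B (z # map e [0..<n]))"
      using F(2)[OF x] by (intro floorlog_mono) (simp only: map_case_nat)
    also have "\<dots> \<le> floorlog 2 (C (map e [0..<n]))" using z by (intro C(2)) (simp_all only: te length_map length_upt diff_zero)
    finally have "x < 2 ^ floorlog 2 ?d" by (intro less_pow_floorlog) simp
    moreover have "z < 2 ^ floorlog 2 ?d"
      using floorlog_mono[OF z, of 2] by (intro less_pow_floorlog) (simp add: te)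
    ultimately obtain w where "w < 2 ^ (floorlog 2 ?d + floorlog 2 ?d)"
      "entry w 0 (floorlog 2 ?d) = x" "entry w 1 (floorlog 2 ?d) = z" using ex_pair by blast
    with x z less_pair_bound[of w ?d] show "\<exists>w\<le>cat 1 (cat ?d ?d). sat (case_nat w e) ?\<theta>"
      by (intro exI[of _ w]) (simp add: sat evE)
  qed (use F(1) in \<open>auto simp: sat evE\<close>)
  moreover have "pv_fm ?\<theta>" using \<chi>(2) pvE assms(2) pv by (auto intro!: pv_subst_fm)
  moreover have "closed_fm (Suc n) ?\<theta>" using closed_subst_fm[OF \<chi>(3) cl] clE assms(3) by simp
  moreover have "pi_b j ?\<theta>"
    by (rule sigma_b_pi_b.intros(9)[OF quantifier_free_strict[THEN conjunct2] strict_subst(2)[OF \<chi>(1)]])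
       (simp add: Le_def)
  ultimately show ?thesis unfolding nf_def using fp_catI[OF fp_one fp_catI[OF D D]] by blast
qed

text \<open>Sharpness matters here: there are only polynomially many values of \<open>y\<close> in
  terms of the input length, so the witnesses chosen for all of them fit into one number of
  polynomial length.\<close>

lemma nf_sharp_all:
  assumes "nf j (Suc n) F" "pv_tm t" "closed_tm n t"
  shows "nf j n (\<lambda>e. \<forall>y\<le>floorlog 2 (eval_tm e t). F (case_nat y e))"
proof -
  obtain B \<chi> where B: "fp (Suc n) B" and \<chi>: "pi_b j \<chi>" "pv_fm \<chi>" "closed_fm (Suc (Suc n)) \<chi>"
    and F: "\<And>e. F e \<longleftrightarrow> (\<exists>w. sat (case_nat w e) \<chi>)" "\<And>w e. sat (case_nat w e) \<chi> \<Longrightarrow> w \<le> B (map e [0..<Suc n])"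
    using nfE[OF assms(1)] by metis
  let ?t = "\<lambda>vs. floorlog 2 (eval_tm (nth vs) t)"
  have t: "fp n (\<lambda>vs. eval_tm (nth vs) t)" by (rule fp_eval_tm[OF assms(2,3)])
  have te: "?t (map e [0..<n]) = floorlog 2 (eval_tm e t)" for e
    using eval_tm_cong[OF assms(3), of "nth (map e [0..<n])" e] by simp
  obtain D where D: "fp n D" "\<And>vs y. length vs = n \<Longrightarrow> y \<le> ?t vs \<Longrightarrow> floorlog 2 (B (y # vs)) \<le> floorlog 2 (D vs)"
    using fp_majorant[OF B fp_lenI[OF fp_le fp_len t]] by blast
  \<comment> \<open>One block for each \<open>y\<close> from 0 to the length of \<open>t\<close>
    inclusive; the 1 catenated in front of \<open>t\<close> supplies the additional block.\<close>
  obtain S where S: "fp n S" "\<And>vs. length vs = n \<Longrightarrow> floorlog 2 (S vs) = floorlog 2 (D vs) * (?t vs + 1)"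
    using fp_smash[OF D(1) fp_catI[OF fp_one t]] by auto
  define E where "E = entry_tm D (Var 1) (Var 0) (vars 2 n)"
  \<comment> \<open>In \<open>\<chi>\<close> the witness is variable 0 and \<open>y\<close> is
    variable 1. Under the new quantifiers \<open>y\<close> is variable 0 and the sequence variable
    1, so the witness turns into entry \<open>y\<close> of the sequence.\<close>
  define \<sigma> where "\<sigma> = case_nat E (case_nat (Var 0) (\<lambda>i. Var (Suc (Suc i))))"
  have pvE: "pv_tm E" using D by (auto simp: E_def intro!: pv_entry_tm)
  have pv: "pv_tm (\<sigma> i)" for i using pvE by (auto simp: \<sigma>_def split: nat.splits)
  have clE: "closed_tm (Suc (Suc n)) E" by (auto simp: E_def)
  have cl: "closed_tm (Suc (Suc n)) (\<sigma> i)" if "i < Suc (Suc n)" for i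
    using that clE by (auto simp: \<sigma>_def split: nat.splits)
  let ?e = "\<lambda>w y e. entry w y (floorlog 2 (D (map e [0..<n])))"
  have sat: "sat (case_nat y (case_nat w e)) (subst_fm \<sigma> \<phi>) \<longleftrightarrow> sat (case_nat (?e w y e) (case_nat y e)) \<phi>" for w y e \<phi>
  proof -
    have "eval_tm (case_nat y (case_nat w e)) E = ?e w y e"
      by (simp add: E_def comp_def)
    then have "(\<lambda>i. eval_tm (case_nat y (case_nat w e)) (\<sigma> i)) = case_nat (?e w y e) (case_nat y e)"
      by (auto simp: \<sigma>_def fun_eq_iff split: nat.splits)
    then show ?thesis by (simp only: sat_subst)
  qed
  let ?A = "BAll (len_tm (shift_tm t)) (subst_fm \<sigma> \<chi>)"
  have A: "pv_fm (subst_fm \<sigma> \<chi>)" "closed_fm (Suc (Suc n)) (subst_fm \<sigma> \<chi>)" "pi_b j (subst_fm \<sigma> \<chi>)"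
    using pv_subst_fm[OF \<chi>(2) pv] closed_subst_fm[OF \<chi>(3) cl] strict_subst(2)[OF \<chi>(1)] by auto
  have t': "pv_tm (shift_tm t)" "closed_tm (Suc n) (shift_tm t)" using assms(2,3) by auto
  \<comment> \<open>At level 0 the inner universal quantifier must disappear altogether; at higher
    levels it is an ordinary bounded quantifier of a Pi class.\<close>
  have "\<exists>\<theta>. pi_b j \<theta> \<and> pv_fm \<theta> \<and> closed_fm (Suc n) \<theta> \<and> (\<forall>e. sat e \<theta> \<longleftrightarrow> sat e ?A)"
  proof (cases j)
    case 0
    then have "quantifier_free (subst_fm \<sigma> \<chi>)" using strict_0(2)[OF A(3)] by simp
    from quantifier_free_BAll[OF this A(1,2) t'] show ?thesis using quantifier_free_strict by blast
  next
    case (Suc i)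
    then have "pi_b j ?A" using A(3) by (auto intro: sigma_b_pi_b.intros)
    moreover have "closed_tm (Suc n) (len_tm (shift_tm t))" using t'(2) by simp
    ultimately show ?thesis using A t' by (intro exI[of _ ?A]) simp
  qed
  then obtain \<theta> where \<theta>: "pi_b j \<theta>" "pv_fm \<theta>" "closed_fm (Suc n) \<theta>" "\<And>e. sat e \<theta> \<longleftrightarrow> sat e ?A" by blast
  have "(\<forall>y\<le>floorlog 2 (eval_tm e t). F (case_nat y e)) \<longleftrightarrow>
      (\<exists>w\<le>cat 1 (S (map e [0..<n])). sat (case_nat w e) \<theta>)" for e
  proof
    let ?l = "floorlog 2 (eval_tm e t)" and ?d = "floorlog 2 (D (map e [0..<n]))"
    assume "\<forall>y\<le>?l. F (case_nat y e)"
    then have "\<exists>x. y \<le> ?l \<longrightarrow> sat (case_nat x (case_nat y e)) \<chi>" for y using F(1)[of "case_nat y e"] by auto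
    then have "\<exists>z. \<forall>y. y \<le> ?l \<longrightarrow> sat (case_nat (z y) (case_nat y e)) \<chi>" by (intro choice allI)
    then obtain z where z: "\<And>y. y \<le> ?l \<Longrightarrow> sat (case_nat (z y) (case_nat y e)) \<chi>" by blast
    have "z y < 2 ^ ?d" if "y < ?l + 1" for y
    proof (rule less_pow_floorlog)
      have y: "y \<le> ?l" using that by simp
      have "floorlog 2 (z y) \<le> floorlog 2 (B (y # map e [0..<n]))"
        using F(2)[OF z[OF y]] by (intro floorlog_mono) (simp only: map_case_nat)
      also have "\<dots> \<le> ?d" using y by (intro D(2)) (simp_all only: te length_map length_upt diff_zero)
      finally show "floorlog 2 (z y) \<le> ?d" .
    qed
    from ex_sequence[of "?l + 1" z ?d, OF this] obtain w where w: "w < 2 ^ (?d * (?l + 1))" "\<And>y. y < ?l + 1 \<Longrightarrow> entry w y ?d = z y"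
      by blast
    have "2 ^ (?d * (?l + 1)) \<le> cat 1 (S (map e [0..<n]))"
      using pow_le_cat_1[of "S (map e [0..<n])"] S(2)[of "map e [0..<n]"] by (simp only: te length_map length_upt diff_zero)
    then have "w \<le> cat 1 (S (map e [0..<n]))" using w(1) by linarith
    moreover have "sat (case_nat w e) \<theta>" using z w(2) by (simp add: \<theta>(4) sat_BAll sat)
    ultimately show "\<exists>w\<le>cat 1 (S (map e [0..<n])). sat (case_nat w e) \<theta>" by blast
  qed (use F(1) in \<open>auto simp: \<theta>(4) sat_BAll sat\<close>)
  then show ?thesis unfolding nf_def using \<theta>(1,2,3) fp_catI[OF fp_one S(1)] by blast
qed

text \<open>For the Pi classes it is the negation that is brought into normal form, so
  \<open>Neg\<close> exchanges the two statements and a bounded universal quantifier becomes an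
  existential one to be contracted. Formulas from the level below are either matrices themselves or
  covered by the induction hypothesis and \<open>nf_mono\<close>.\<close>

lemma strict_nf:
  "sigma_b j \<phi> \<Longrightarrow> j = Suc i \<Longrightarrow> pv_fm \<phi> \<Longrightarrow> closed_fm n \<phi> \<Longrightarrow> nf i n (\<lambda>e. sat e \<phi>)"
  "pi_b j \<phi> \<Longrightarrow> j = Suc i \<Longrightarrow> pv_fm \<phi> \<Longrightarrow> closed_fm n \<phi> \<Longrightarrow> nf i n (\<lambda>e. \<not> sat e \<phi>)"
proof (induction arbitrary: i n and i n rule: sigma_b_pi_b.inducts)
  case (3 j \<phi>)
  show ?case
  proof (cases j)
    case 0
    then have "pi_b i \<phi>" using 3 strict_0(1) quantifier_free_strict by blast
    then show ?thesis using 3 by (intro nf_pi)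
  next
    case (Suc k)
    then show ?thesis using 3 nf_mono by blast
  qed
next
  case (4 j \<phi>)
  then show ?case by (auto intro: nf_pi)
next
  case (5 j \<phi>)
  then show ?case using nf_pi[OF sigma_b_pi_b.intros(12)[OF 5(1)]] by simp
next
  case (6 j \<phi>)
  show ?case
  proof (cases j)
    case 0
    then have "pi_b i (Neg \<phi>)" using 6 strict_0(2) quantifier_free_strict by (metis quantifier_free.simps(2))
    then show ?thesis using nf_pi[of i "Neg \<phi>" n] 6 by simp
  next
    case (Suc k)
    then show ?thesis using 6 nf_mono by blast
  qed
next
  case (9 j \<phi> \<psi>)
  then show ?case using nf_disj[of i n "\<lambda>e. \<not> sat e \<phi>" "\<lambda>e. \<not> sat e \<psi>"] by simp
next
  case (10 j \<phi> \<psi>)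
  then show ?case using nf_conj[of i n "\<lambda>e. \<not> sat e \<phi>" "\<lambda>e. \<not> sat e \<psi>"] by simp
next
  case (13 j \<phi> t)
  then show ?case using nf_bounded_ex[of i n "\<lambda>e. sat e \<phi>" t] by (simp add: sat_BEx)
next
  case (14 j \<phi> t)
  then show ?case using nf_bounded_ex[of i n "\<lambda>e. \<not> sat e \<phi>" t] by (simp add: sat_BAll)
qed (simp_all add: nf_conj nf_disj)

text \<open>The result records that the matrix is in \<open>pi_b j\<close>: when the quantifier over
  the sequence is moved to the front of an implication, the level of that matrix is what
  counts.\<close>

lemma sigma_b_sharp_all:
  assumes "sigma_b (Suc j) \<phi>" "pv_fm \<phi>" "closed_fm (Suc n) \<phi>" "pv_tm t" "closed_tm n t"
  shows "\<exists>B \<chi>. pi_b j \<chi> \<and> pv_tm B \<and> closed_tm n B \<and> pv_fm \<chi> \<and> closed_fm (Suc n) \<chi> \<and>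
    (\<forall>e. sat e (BEx B \<chi>) \<longleftrightarrow> sat e (BAll (len_tm t) \<phi>))"
proof -
  have "nf j n (\<lambda>e. \<forall>y\<le>floorlog 2 (eval_tm e t). sat (case_nat y e) \<phi>)"
    using nf_sharp_all[OF strict_nf(1)[OF assms(1) refl assms(2,3)] assms(4,5)] .
  then obtain B \<chi> where B: "fp n B" and \<chi>: "pi_b j \<chi>" "pv_fm \<chi>" "closed_fm (Suc n) \<chi>"
    "\<And>e. (\<forall>y\<le>floorlog 2 (eval_tm e t). sat (case_nat y e) \<phi>) \<longleftrightarrow>
      (\<exists>w\<le>B (map e [0..<n]). sat (case_nat w e) \<chi>)"
    unfolding nf_def by blast
  have "pv_tm (app B (vars 0 n))" by (rule pv_app) (use B in auto)
  then show ?thesis using \<chi>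
    by (intro exI[of _ "app B (vars 0 n)"] exI[of _ \<chi>]) (auto simp: sat_BEx sat_BAll comp_def)
qed

lemma pi_b_sharp_ex:
  assumes "pi_b (Suc j) \<phi>" "pv_fm \<phi>" "closed_fm (Suc n) \<phi>" "pv_tm t" "closed_tm n t"
  shows "\<exists>B \<chi>. sigma_b j \<chi> \<and> pv_tm B \<and> closed_tm n B \<and> pv_fm \<chi> \<and> closed_fm (Suc n) \<chi> \<and>
    (\<forall>e. sat e (BAll B \<chi>) \<longleftrightarrow> sat e (BEx (len_tm t) \<phi>))"
proof -
  obtain B \<chi> where "pi_b j \<chi>" "pv_tm B" "closed_tm n B" "pv_fm \<chi>" "closed_fm (Suc n) \<chi>"
    and eq: "\<And>e. sat e (BEx B \<chi>) \<longleftrightarrow> sat e (BAll (len_tm t) (Neg \<phi>))"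
    using sigma_b_sharp_all[of j "Neg \<phi>" n t] assms sigma_b_pi_b.intros(11) by auto
  moreover have "sat e (BAll B (Neg \<chi>)) \<longleftrightarrow> sat e (BEx (len_tm t) \<phi>)" for e
    using eq[of e] unfolding sat_BEx sat_BAll sat.simps by blast
  ultimately show ?thesis
    by (intro exI[of _ B] exI[of _ "Neg \<chi>"]) (simp add: sigma_b_pi_b.intros)
qed

end


section \<open>Derivations\<close>

lemma under_binder_Var [simp]: "under_binder Var = Var"
  by (auto simp: fun_eq_iff under_binder_def shift_tm_def split: nat.splits)

lemma under_binder_comp:
  "(\<lambda>i. subst_tm (under_binder \<tau>) (under_binder \<sigma> i)) = under_binder (\<lambda>i. subst_tm \<tau> (\<sigma> i))"
  using subst_shift by (auto simp: fun_eq_iff under_binder_def split: nat.splits)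

lemma subst_subst_fm: "subst_fm \<tau> (subst_fm \<sigma> \<phi>) = subst_fm (\<lambda>i. subst_tm \<tau> (\<sigma> i)) \<phi>"
  by (induction \<phi> arbitrary: \<sigma> \<tau>) (auto simp: subst_subst_tm under_binder_comp)

lemma subst_fm_Var [simp]: "subst_fm Var \<phi> = \<phi>"
  by (induction \<phi>) auto

lemma quantifier_free_Le [simp]: "quantifier_free (Le s t)"
  by (simp add: Le_def)

lemma subst_tm_cong: "closed_tm n t \<Longrightarrow> (\<And>i. i < n \<Longrightarrow> \<sigma> i = \<tau> i) \<Longrightarrow> subst_tm \<sigma> t = subst_tm \<tau> t"
  by (induction t) auto

lemma under_binder_cong:
  "(\<And>i. i < n \<Longrightarrow> \<sigma> i = \<tau> i) \<Longrightarrow> i < Suc n \<Longrightarrow> under_binder \<sigma> i = under_binder \<tau> i"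
  by (auto simp: under_binder_def split: nat.splits)

lemma subst_fm_cong: "closed_fm n \<phi> \<Longrightarrow> (\<And>i. i < n \<Longrightarrow> \<sigma> i = \<tau> i) \<Longrightarrow> subst_fm \<sigma> \<phi> = subst_fm \<tau> \<phi>"
proof (induction \<phi> arbitrary: n \<sigma> \<tau>)
  case (All \<phi>)
  have "subst_fm (under_binder \<sigma>) \<phi> = subst_fm (under_binder \<tau>) \<phi>"
    by (rule All.IH[of "Suc n"]) (use All.prems under_binder_cong[of n \<sigma> \<tau>] in auto)
  then show ?case by simp
next
  case (Ex \<phi>)
  have "subst_fm (under_binder \<sigma>) \<phi> = subst_fm (under_binder \<tau>) \<phi>"
    by (rule Ex.IH[of "Suc n"]) (use Ex.prems under_binder_cong[of n \<sigma> \<tau>] in auto)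
  then show ?case by simp
next
  case (Eq s t)
  then show ?case using subst_tm_cong[of n _ \<sigma> \<tau>] by simp
next
  case (And \<phi> \<psi>)
  from And.IH(1)[of n \<sigma> \<tau>] And.IH(2)[of n \<sigma> \<tau>] And.prems show ?case by simp
next
  case (Or \<phi> \<psi>)
  from Or.IH(1)[of n \<sigma> \<tau>] Or.IH(2)[of n \<sigma> \<tau>] Or.prems show ?case by simp
next
  case (Neg \<phi>)
  from Neg.IH[of n \<sigma> \<tau>] Neg.prems show ?case by simp
qed

abbreviation lift_fm :: "fm \<Rightarrow> fm" where
  "lift_fm \<equiv> subst_fm (under_binder (\<lambda>x. Var (Suc x)))"

text \<open>Lifting makes room for a fresh variable 0, and instantiating with that variable restores
  the formula; so an eigenvariable can instantiate a quantifier that was shifted past it.\<close>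

lemma inst_lift [simp]: "inst_fm (Var 0) (lift_fm \<phi>) = \<phi>"
proof -
  have "(\<lambda>i. subst_tm (case_nat (Var 0) Var) (under_binder (\<lambda>x. Var (Suc x)) i)) = Var"
    by (auto simp: fun_eq_iff under_binder_def shift_tm_def split: nat.splits)
  then show ?thesis by (simp add: inst_fm_def subst_subst_fm)
qed

lemma shift_Ex: "shift_fm (Ex \<phi>) = Ex (lift_fm \<phi>)"
  and shift_All: "shift_fm (All \<phi>) = All (lift_fm \<phi>)"
  by (simp_all add: shift_fm_def)

lemma pv_shift_fm: "pv_fm \<phi> \<Longrightarrow> pv_fm (shift_fm \<phi>)"
  and pv_lift_fm: "pv_fm \<phi> \<Longrightarrow> pv_fm (lift_fm \<phi>)"
  by (auto simp: shift_fm_def intro!: pv_subst_fm pv_under_binder)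

lemma closed_shift_fm: "closed_fm n \<phi> \<Longrightarrow> closed_fm (Suc n) (shift_fm \<phi>)"
  by (auto simp: shift_fm_def intro: closed_subst_fm)

lemma closed_lift_fm: "closed_fm (Suc n) \<phi> \<Longrightarrow> closed_fm (Suc (Suc n)) (lift_fm \<phi>)"
  by (erule closed_subst_fm) (auto intro: closed_under_binder)

section \<open>Derived rules of the calculus\<close>

lemma weaken: "\<Gamma> \<turnstile> \<phi> \<Longrightarrow> \<Gamma> \<subseteq> \<Delta> \<Longrightarrow> \<Delta> \<turnstile> \<phi>"
proof (induction arbitrary: \<Delta> rule: proves.induct)
  case (OrE \<Gamma> \<phi> \<psi> \<chi>)
  show ?case by (rule proves.OrE[OF OrE.IH(1) OrE.IH(2) OrE.IH(3)]) (use OrE.prems in auto)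
next
  case (NegI \<phi> \<Gamma> \<psi>)
  show ?case by (rule proves.NegI[OF NegI.hyps(1) NegI.IH(1) NegI.IH(2)]) (use NegI.prems in auto)
next
  case (Contr \<phi> \<Gamma> \<psi>)
  show ?case by (rule proves.Contr[OF Contr.hyps(1) Contr.IH(1) Contr.IH(2)]) (use Contr.prems in auto)
next
  case (AllI \<Gamma> \<phi>)
  show ?case by (rule proves.AllI[OF AllI.IH]) (use AllI.prems in auto)
next
  case (ExE \<Gamma> \<phi> \<chi>)
  show ?case by (rule proves.ExE[OF ExE.IH(1) ExE.IH(2)]) (use ExE.prems in auto)
next
  case (EqE \<Gamma> s t \<phi>)
  show ?case by (rule proves.EqE[OF EqE.IH(1) EqE.IH(2)]) (use EqE.prems in auto)
qed (auto intro: proves.intros)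

text \<open>The calculus has no implication; the cut is obtained by eliminating the disjunction of
  \<open>\<phi>\<close> with itself, with the same derivation in both cases.\<close>

lemma cut: "\<Gamma> \<turnstile> \<phi> \<Longrightarrow> pv_fm \<phi> \<Longrightarrow> insert \<phi> \<Gamma> \<turnstile> \<psi> \<Longrightarrow> \<Gamma> \<turnstile> \<psi>"
  using OrE OrI1 by blast

lemma proves_trans: "insert \<phi> \<Gamma> \<turnstile> \<psi> \<Longrightarrow> pv_fm \<psi> \<Longrightarrow> insert \<psi> \<Gamma> \<turnstile> \<chi> \<Longrightarrow> insert \<phi> \<Gamma> \<turnstile> \<chi>"
  by (rule cut) (auto intro: weaken)

lemma mp:
  assumes "\<Gamma> \<turnstile> Or (Neg \<phi>) \<psi>" "\<Gamma> \<turnstile> \<phi>" "pv_fm \<psi>"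
  shows "\<Gamma> \<turnstile> \<psi>"
proof (rule OrE[OF assms(1)])
  show "insert (Neg \<phi>) \<Gamma> \<turnstile> \<psi>"
    by (rule Contr[OF assms(3), of _ \<phi>]) (auto intro: Assm weaken[OF assms(2)])
qed (auto intro: Assm)

lemma proves_imp: "\<Gamma> \<turnstile> Or (Neg \<phi>) \<psi> \<Longrightarrow> pv_fm \<psi> \<Longrightarrow> insert \<phi> \<Gamma> \<turnstile> \<psi>"
  by (rule mp[of _ \<phi>]) (auto intro: Assm weaken)

lemma And_mono:
  assumes "insert \<phi> \<Gamma> \<turnstile> \<phi>'" "insert \<psi> \<Gamma> \<turnstile> \<psi>'" "pv_fm \<phi>" "pv_fm \<psi>"
  shows "insert (And \<phi> \<psi>) \<Gamma> \<turnstile> And \<phi>' \<psi>'"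
proof (rule AndI)
  have *: "insert (And \<phi> \<psi>) \<Gamma> \<turnstile> And \<phi> \<psi>" by (auto intro: Assm)
  show "insert (And \<phi> \<psi>) \<Gamma> \<turnstile> \<phi>'"
    by (rule cut[OF AndE1[OF *] assms(3)]) (auto intro: weaken[OF assms(1)])
  show "insert (And \<phi> \<psi>) \<Gamma> \<turnstile> \<psi>'"
    by (rule cut[OF AndE2[OF *] assms(4)]) (auto intro: weaken[OF assms(2)])
qed

lemma Or_mono:
  assumes "insert \<phi> \<Gamma> \<turnstile> \<phi>'" "insert \<psi> \<Gamma> \<turnstile> \<psi>'" "pv_fm \<phi>'" "pv_fm \<psi>'"
  shows "insert (Or \<phi> \<psi>) \<Gamma> \<turnstile> Or \<phi>' \<psi>'"
proof (rule OrE[of _ \<phi> \<psi>])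
  show "insert \<phi> (insert (Or \<phi> \<psi>) \<Gamma>) \<turnstile> Or \<phi>' \<psi>'"
    by (rule OrI1[OF _ assms(4)]) (auto intro: weaken[OF assms(1)])
  show "insert \<psi> (insert (Or \<phi> \<psi>) \<Gamma>) \<turnstile> Or \<phi>' \<psi>'"
    by (rule OrI2[OF _ assms(3)]) (auto intro: weaken[OF assms(2)])
qed (auto intro: Assm)

lemma Neg_mono:
  assumes "insert \<phi> \<Gamma> \<turnstile> \<psi>" "pv_fm \<phi>"
  shows "insert (Neg \<psi>) \<Gamma> \<turnstile> Neg \<phi>"
  by (rule NegI[OF assms(2), of _ \<psi>]) (auto intro: Assm weaken[OF assms(1)])

text \<open>All that is needed of a set of sentences is that shifting an eigenvariable does not change it.\<close>

definition sentences :: "fm set \<Rightarrow> bool" where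
  "sentences T \<longleftrightarrow> shift_fm ` T = T"

lemma Ex_elim_sentences:
  assumes "sentences T" "insert \<phi> T \<turnstile> shift_fm \<psi>"
  shows "insert (Ex \<phi>) T \<turnstile> \<psi>"
proof (rule ExE[of _ \<phi>])
  show "insert \<phi> (shift_fm ` insert (Ex \<phi>) T) \<turnstile> shift_fm \<psi>"
    by (rule weaken[OF assms(2)]) (use assms(1) in \<open>auto simp: sentences_def\<close>)
qed (auto intro: Assm)

lemma All_intro_sentences:
  assumes "sentences T" "insert (shift_fm \<phi>) T \<turnstile> \<psi>"
  shows "insert \<phi> T \<turnstile> All \<psi>"
  using assms by (intro AllI) (simp add: sentences_def)

lemma Ex_mono:
  assumes "sentences T" "insert \<phi> T \<turnstile> \<psi>"
  shows "insert (Ex \<phi>) T \<turnstile> Ex \<psi>"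
proof (rule Ex_elim_sentences[OF assms(1)])
  show "insert \<phi> T \<turnstile> shift_fm (Ex \<psi>)"
    unfolding shift_Ex by (rule ExI[of _ "Var 0"]) (simp_all add: assms(2))
qed

lemma All_elim_lift: "insert (All (lift_fm \<phi>)) T \<turnstile> \<phi>"
  using AllE[OF Assm[of "All (lift_fm \<phi>)"], of _ "Var 0"] by simp

lemma All_mono:
  assumes "sentences T" "insert \<phi> T \<turnstile> \<psi>" "pv_fm \<phi>"
  shows "insert (All \<phi>) T \<turnstile> All \<psi>"
proof (rule All_intro_sentences[OF assms(1)])
  show "insert (shift_fm (All \<phi>)) T \<turnstile> \<psi>"
    unfolding shift_All by (rule proves_trans[OF All_elim_lift assms(3,2)])
qed

text \<open>Two variables are opened: 0 is the witness for \<open>\<phi>\<close> and 1 the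
  eigenvariable for \<open>\<psi>\<close>. In \<open>lift_fm \<phi>\<close> variable 0 stays and 1
  is skipped, in \<open>shift_fm \<psi>\<close> it is the other way round, so the premise is the
  implication with two distinct variables.\<close>

lemma Ex_imp_All:
  assumes "sentences T" "T \<turnstile> Or (Neg (lift_fm \<phi>)) (shift_fm \<psi>)" "pv_fm \<psi>"
  shows "insert (Ex \<phi>) T \<turnstile> All \<psi>"
proof (rule All_intro_sentences[OF assms(1)])
  show "insert (shift_fm (Ex \<phi>)) T \<turnstile> \<psi>"
    unfolding shift_Ex
    by (rule Ex_elim_sentences[OF assms(1)], rule proves_imp[OF assms(2)]) (rule pv_shift_fm[OF assms(3)])
qed

lemma BEx_mono:
  assumes "sentences T" "insert \<phi> T \<turnstile> \<psi>" "pv_fm (BEx t \<phi>)"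
  shows "insert (BEx t \<phi>) T \<turnstile> BEx t \<psi>"
  unfolding BEx_def by (rule Ex_mono[OF assms(1)], rule And_mono) (use assms in \<open>auto intro: Assm simp: BEx_def\<close>)

lemma BAll_mono:
  assumes "sentences T" "insert \<phi> T \<turnstile> \<psi>" "pv_fm (BAll t \<phi>)" "pv_fm \<psi>"
  shows "insert (BAll t \<phi>) T \<turnstile> BAll t \<psi>"
  unfolding BAll_def
  by (rule All_mono[OF assms(1)], rule Or_mono) (use assms in \<open>auto intro: Assm simp: BAll_def\<close>)


section \<open>The theories\<close>

lemma sentences_T_PV: "sentences (T_PV i)"
proof -
  have "shift_fm \<phi> = \<phi>" if "\<phi> \<in> T_PV i" for \<phi>
    using that subst_fm_cong[of 0 \<phi> "\<lambda>x. Var (Suc x)" Var]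
    by (simp add: T_PV_def forall_sentence_def pv_sentence_def shift_fm_def)
  then show ?thesis by (force simp: sentences_def)
qed

lemma T_PV_mono: "T_PV (Suc j) \<subseteq> T_PV (Suc (Suc j))"
  by (auto simp: T_PV_def forall_sentence_def intro: sigma_b_pi_b.intros)

text \<open>Generalised over a substitution \<open>\<sigma>\<close> already applied, because each
  elimination of an outer quantifier leaves one behind.\<close>

lemma proves_instance:
  assumes "\<Gamma> \<turnstile> subst_fm \<sigma> ((All ^^ n) \<phi>)" "\<And>i. pv_tm (\<rho> i)"
  shows "\<Gamma> \<turnstile> subst_fm (\<lambda>i. if i < n then \<rho> i else \<sigma> (i - n)) \<phi>"
  using assms(1)
proof (induction n arbitrary: \<sigma>)
  case (Suc n)
  have "(\<lambda>i. subst_tm (case_nat (\<rho> n) Var) (under_binder \<sigma> i)) = case_nat (\<rho> n) \<sigma>"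
    by (auto simp: fun_eq_iff under_binder_def shift_tm_def subst_subst_tm split: nat.splits)
  then have "\<Gamma> \<turnstile> subst_fm (case_nat (\<rho> n) \<sigma>) ((All ^^ n) \<phi>)"
    using AllE[of \<Gamma> "subst_fm (under_binder \<sigma>) ((All ^^ n) \<phi>)" "\<rho> n"] Suc.prems assms(2)
    by (simp add: inst_fm_def subst_subst_fm)
  from Suc.IH[OF this] have "\<Gamma> \<turnstile> subst_fm (\<lambda>i. if i < n then \<rho> i else case_nat (\<rho> n) \<sigma> (i - n)) \<phi>" .
  moreover have "(\<lambda>i. if i < n then \<rho> i else case_nat (\<rho> n) \<sigma> (i - n)) =
      (\<lambda>i. if i < Suc n then \<rho> i else \<sigma> (i - Suc n))"
    by (auto simp: fun_eq_iff less_Suc_eq not_less split: nat.splits dest: le_neq_implies_less)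
       (metis Suc_diff_Suc diff_Suc_Suc diff_is_0_eq' less_irrefl_nat nat.inject not_less_iff_gr_or_eq zero_less_diff)+
  ultimately show ?case by simp
qed simp

lemma All_pow_simps [simp]:
  "pv_fm ((All ^^ n) \<phi>) \<longleftrightarrow> pv_fm \<phi>"
  "closed_fm k ((All ^^ n) \<phi>) \<longleftrightarrow> closed_fm (k + n) \<phi>"
  by (induction n arbitrary: k) auto

lemma env_cases: obtains a e' where "e = (case_nat a e' :: nat \<Rightarrow> nat)"
proof
  show "e = case_nat (e 0) (\<lambda>i. e (Suc i))" by (auto simp: fun_eq_iff split: nat.splits)
qed

lemma sat_All_pow: "(\<forall>e. sat e ((All ^^ n) \<phi>)) \<longleftrightarrow> (\<forall>e. sat e \<phi>)"
proof (induction n)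
  case (Suc n)
  have "(\<forall>e a. sat (case_nat a e) \<psi>) \<longleftrightarrow> (\<forall>e. sat e \<psi>)" for \<psi>
  proof
    assume *: "\<forall>e a. sat (case_nat a e) \<psi>"
    then show "\<forall>e. sat e \<psi>" by (metis env_cases)
  qed simp
  then show ?case using Suc by simp
qed simp

text \<open>A true open formula is an instance of its universal closure, which is an axiom; the
  quantified variables are instantiated by themselves.\<close>

lemma T_PV_open:
  assumes "sigma_b j \<phi>" "pv_fm \<phi>" "closed_fm n \<phi>" "\<And>e. sat e \<phi>"
  shows "T_PV (Suc j) \<turnstile> \<phi>"
proof -
  have "(All ^^ n) \<phi> \<in> T_PV (Suc j)"
    using assms sat_All_pow[of n \<phi>] unfolding T_PV_def forall_sentence_def pv_sentence_def true_in_nat_def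
    by auto
  then have "T_PV (Suc j) \<turnstile> subst_fm Var ((All ^^ n) \<phi>)" by (simp add: Assm)
  then have "T_PV (Suc j) \<turnstile> subst_fm (\<lambda>i. if i < n then Var i else Var (i - n)) \<phi>"
    by (rule proves_instance) simp
  also have "subst_fm (\<lambda>i. if i < n then Var i else Var (i - n)) \<phi> = subst_fm Var \<phi>"
    by (rule subst_fm_cong[OF assms(3)]) simp
  finally show ?thesis by simp
qed

lemma T_PV_imp:
  assumes "sigma_b j (Or (Neg \<phi>) \<psi>)" "pv_fm \<phi>" "pv_fm \<psi>" "closed_fm n \<phi>" "closed_fm n \<psi>"
    and "\<And>e. sat e \<phi> \<Longrightarrow> sat e \<psi>"
  shows "T_PV (Suc j) \<turnstile> Or (Neg \<phi>) \<psi>"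
  by (rule T_PV_open[OF assms(1)]) (use assms in auto)

lemma All_pow_intro: "sentences T \<Longrightarrow> T \<turnstile> \<phi> \<Longrightarrow> T \<turnstile> (All ^^ n) \<phi>"
  by (induction n) (auto simp: sentences_def intro: AllI)

definition equiv_strict :: "nat \<Rightarrow> fm \<Rightarrow> fm \<Rightarrow> bool" where
  "equiv_strict n \<phi> \<phi>' \<longleftrightarrow> pv_fm \<phi>' \<and> closed_fm n \<phi>' \<and> (\<forall>e. sat e \<phi>' \<longleftrightarrow> sat e \<phi>)"

text \<open>
  One level up, the strict form is provably equivalent; at its own level only the implication that
  is needed to transfer truth is provable.
\<close>

definition strict_sigma :: "nat \<Rightarrow> nat \<Rightarrow> fm \<Rightarrow> fm \<Rightarrow> bool" where
  "strict_sigma j n \<phi> \<psi> \<longleftrightarrow> sigma_b j \<psi> \<and> equiv_strict n \<phi> \<psi> \<and>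
     insert \<psi> (T_PV (Suc j)) \<turnstile> \<phi> \<and> insert \<phi> (T_PV (Suc (Suc j))) \<turnstile> \<psi>"

text \<open>The two implications are those of \<open>strict_sigma\<close> for the negated formulas,
  hence exchanged.\<close>

definition strict_pi :: "nat \<Rightarrow> nat \<Rightarrow> fm \<Rightarrow> fm \<Rightarrow> bool" where
  "strict_pi j n \<phi> \<psi> \<longleftrightarrow> pi_b j \<psi> \<and> equiv_strict n \<phi> \<psi> \<and>
     insert \<phi> (T_PV (Suc j)) \<turnstile> \<psi> \<and> insert \<psi> (T_PV (Suc (Suc j))) \<turnstile> \<phi>"

section \<open>Eliminating one sharply bounded quantifier in front of a strict formula\<close>

context
  assumes fp_le: "fp 2 le_fun" and fp_len: "fp 1 len_fun"
begin

lemmas pv_simps [simp] = pv_Le[OF fp_le fp_len] pv_len_tm[OF fp_le fp_len] eval_len_tm[OF fp_le fp_len]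
  closed_Le[OF fp_le fp_len] closed_len_tm[OF fp_le fp_len] pv_BEx[OF fp_le fp_len] pv_BAll[OF fp_le fp_len]
  closed_BEx[OF fp_le fp_len] closed_BAll[OF fp_le fp_len]

text \<open>The lowest theory proves both directions. The search term instantiates the quantifier;
  conversely, that this term is a witness whenever variable 0 is one is a true quantifier-free
  formula.\<close>

lemma quantifier_free_sharp_ex:
  assumes \<phi>: "quantifier_free \<phi>" "pv_fm \<phi>" "closed_fm (Suc n) \<phi>" and t: "pv_tm t" "closed_tm n t"
  shows "\<exists>\<psi>. quantifier_free \<psi> \<and> equiv_strict n (BEx (len_tm t) \<phi>) \<psi> \<and>
    insert \<psi> (T_PV (Suc 0)) \<turnstile> BEx (len_tm t) \<phi> \<and> insert (BEx (len_tm t) \<phi>) (T_PV (Suc 0)) \<turnstile> \<psi>"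
proof -
  obtain g where g: "fp n g" "\<And>e y. y \<le> floorlog 2 (eval_tm e t) \<Longrightarrow> sat (case_nat y e) \<phi> \<Longrightarrow>
    g (map e [0..<n]) \<le> floorlog 2 (eval_tm e t) \<and> sat (case_nat (g (map e [0..<n])) e) \<phi>"
    using skolem[OF fp_le fp_len \<phi> t] by blast
  define G where "G = app g (vars 0 n)"
  have G: "pv_tm G" "closed_tm n G" "\<And>e. eval_tm e G = g (map e [0..<n])"
    unfolding G_def using g(1) by (auto intro!: pv_app simp: comp_def)
  define A where "A = And (Le (Var 0) (shift_tm (len_tm t))) \<phi>"
  have BEx: "BEx (len_tm t) \<phi> = Ex A" by (simp add: BEx_def A_def)
  have A: "quantifier_free A" "pv_fm A" "closed_fm (Suc n) A"
    using \<phi> t by (simp_all add: A_def)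
  have \<psi>: "quantifier_free (inst_fm G A)" "pv_fm (inst_fm G A)" "closed_fm n (inst_fm G A)"
    unfolding inst_fm_def using A G(1,2)
    by (auto intro!: pv_subst_fm closed_subst_fm[of "Suc n"] split: nat.splits)
  have sat: "sat e (inst_fm G A) \<longleftrightarrow> sat e (Ex A)" for e
    using g(2)[of _ e] by (auto simp: sat_inst A_def G(3))
  have "insert (inst_fm G A) (T_PV (Suc 0)) \<turnstile> Ex A"
    by (rule ExI[OF Assm G(1)]) simp
  moreover have "insert (Ex A) (T_PV (Suc 0)) \<turnstile> inst_fm G A"
  proof (rule Ex_elim_sentences[OF sentences_T_PV proves_imp[OF T_PV_imp]])
    show "sigma_b 0 (Or (Neg A) (shift_fm (inst_fm G A)))"
      using A(1) \<psi>(1) by (intro quantifier_free_strict[THEN conjunct1]) (simp add: shift_fm_def)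
    show "sat e (shift_fm (inst_fm G A))" if "sat e A" for e
    proof -
      obtain a e' where e: "e = case_nat a e'" by (rule env_cases)
      then have "sat e' (Ex A)" using that by auto
      then show ?thesis by (simp only: e sat_shift sat)
    qed
  qed (use A \<psi> in \<open>auto intro: pv_shift_fm closed_shift_fm\<close>)
  ultimately show ?thesis using \<psi> sat unfolding BEx equiv_strict_def by blast
qed

lemma quantifier_free_sharp_all:
  assumes \<phi>: "quantifier_free \<phi>" "pv_fm \<phi>" "closed_fm (Suc n) \<phi>" and t: "pv_tm t" "closed_tm n t"
  shows "\<exists>\<psi>. quantifier_free \<psi> \<and> equiv_strict n (BAll (len_tm t) \<phi>) \<psi> \<and>
    insert \<psi> (T_PV (Suc 0)) \<turnstile> BAll (len_tm t) \<phi> \<and> insert (BAll (len_tm t) \<phi>) (T_PV (Suc 0)) \<turnstile> \<psi>"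
proof -
  have "quantifier_free (Neg \<phi>)" "pv_fm (Neg \<phi>)" "closed_fm (Suc n) (Neg \<phi>)" using \<phi> by auto
  from skolem[OF fp_le fp_len this t] obtain g
    where g: "fp n g" "\<And>e y. y \<le> floorlog 2 (eval_tm e t) \<Longrightarrow> \<not> sat (case_nat y e) \<phi> \<Longrightarrow>
    g (map e [0..<n]) \<le> floorlog 2 (eval_tm e t) \<and> \<not> sat (case_nat (g (map e [0..<n])) e) \<phi>"
    by auto
  define G where "G = app g (vars 0 n)"
  have G: "pv_tm G" "closed_tm n G" "\<And>e. eval_tm e G = g (map e [0..<n])"
    unfolding G_def using g(1) by (auto intro!: pv_app simp: comp_def)
  define A where "A = Or (Neg (Le (Var 0) (shift_tm (len_tm t)))) \<phi>"
  have BAll: "BAll (len_tm t) \<phi> = All A" by (simp add: BAll_def A_def)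
  have A: "quantifier_free A" "pv_fm A" "closed_fm (Suc n) A"
    using \<phi> t by (simp_all add: A_def)
  have \<psi>: "quantifier_free (inst_fm G A)" "pv_fm (inst_fm G A)" "closed_fm n (inst_fm G A)"
    unfolding inst_fm_def using A G(1,2)
    by (auto intro!: pv_subst_fm closed_subst_fm[of "Suc n"] split: nat.splits)
  have sat: "sat e (inst_fm G A) \<longleftrightarrow> sat e (All A)" for e
    using g(2)[of _ e] by (auto simp: sat_inst A_def G(3))
  have "insert (All A) (T_PV (Suc 0)) \<turnstile> inst_fm G A"
    by (rule AllE[OF Assm G(1)]) simp
  moreover have "insert (inst_fm G A) (T_PV (Suc 0)) \<turnstile> All A"
  proof (rule All_intro_sentences[OF sentences_T_PV proves_imp[OF T_PV_imp]])
    show "sigma_b 0 (Or (Neg (shift_fm (inst_fm G A))) A)"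
      using A(1) \<psi>(1) by (intro quantifier_free_strict[THEN conjunct1]) (simp add: shift_fm_def)
    show "sat e A" if "sat e (shift_fm (inst_fm G A))" for e
    proof -
      obtain a e' where e: "e = case_nat a e'" by (rule env_cases)
      then have "sat e' (All A)" using that by (simp only: sat_shift sat)
      then show ?thesis using e by simp
    qed
  qed (use A \<psi> in \<open>auto intro: pv_shift_fm closed_shift_fm\<close>)
  ultimately show ?thesis using \<psi> sat unfolding BAll equiv_strict_def by blast
qed

lemma sat_lift: "sat (case_nat a (case_nat b e)) (lift_fm \<phi>) \<longleftrightarrow> sat (case_nat a e) \<phi>"
proof -
  have "(\<lambda>i. eval_tm (case_nat a (case_nat b e)) (under_binder (\<lambda>x. Var (Suc x)) i)) = case_nat a e"
    by (auto simp: fun_eq_iff under_binder_def shift_tm_def split: nat.splits)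
  then show ?thesis by (simp add: sat_subst)
qed

text \<open>
  The implication from \<open>Ex \<phi>\<close> to \<open>All \<psi>\<close> is above the level of the axioms, but it is equivalent to
  the universal closure of the implication from \<open>\<phi>\<close> to \<open>\<psi>\<close> with distinct variables.
\<close>

lemma T_PV_Ex_imp_All:
  assumes "sigma_b j (Neg \<phi>)" "sigma_b j \<psi>" "pv_fm \<phi>" "pv_fm \<psi>" "closed_fm (Suc n) \<phi>" "closed_fm (Suc n) \<psi>"
    and "\<And>e. sat e (Ex \<phi>) \<Longrightarrow> sat e (All \<psi>)"
  shows "insert (Ex \<phi>) (T_PV (Suc j)) \<turnstile> All \<psi>"
proof (rule Ex_imp_All[OF sentences_T_PV T_PV_imp])
  have "sigma_b j (lift_fm (Neg \<phi>))" "sigma_b j (shift_fm \<psi>)"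
    unfolding shift_fm_def by (rule strict_subst(1), fact)+
  then show "sigma_b j (Or (Neg (lift_fm \<phi>)) (shift_fm \<psi>))"
    by (auto intro: sigma_b_pi_b.intros)
  show "sat e (shift_fm \<psi>)" if "sat e (lift_fm \<phi>)" for e
  proof -
    obtain a e1 where e: "e = case_nat a e1" by (rule env_cases)
    obtain b e' where e1: "e1 = case_nat b e'" by (rule env_cases)
    have "sat e' (Ex \<phi>)" using that unfolding e e1 sat_lift by auto
    then have "sat (case_nat b e') \<psi>" using assms(7)[of e'] by simp
    then show ?thesis unfolding e e1 sat_shift .
  qed
qed (use assms in \<open>auto intro: pv_lift_fm pv_shift_fm closed_lift_fm closed_shift_fm\<close>)

text \<open>Above level 0 a sharply bounded existential quantifier is an ordinary one, and the
  formula is its own strict form.\<close>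

lemma sigma_b_sharp_ex_provable:
  assumes \<phi>: "sigma_b j \<phi>" "pv_fm \<phi>" "closed_fm (Suc n) \<phi>" and t: "pv_tm t" "closed_tm n t"
  shows "\<exists>\<psi>. strict_sigma j n (BEx (len_tm t) \<phi>) \<psi>"
proof (cases j)
  case 0
  then show ?thesis
    unfolding strict_sigma_def using quantifier_free_sharp_ex[OF strict_0(1)[OF \<phi>(1)] \<phi>(2,3) t] quantifier_free_strict T_PV_mono
    by (meson insert_mono weaken)
next
  case (Suc i)
  then show ?thesis using \<phi> t
    by (intro exI[of _ "BEx (len_tm t) \<phi>"])
       (auto simp: strict_sigma_def equiv_strict_def intro: Assm sigma_b_pi_b.intros)
qed

lemma pi_b_sharp_all_provable:
  assumes \<phi>: "pi_b j \<phi>" "pv_fm \<phi>" "closed_fm (Suc n) \<phi>" and t: "pv_tm t" "closed_tm n t"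
  shows "\<exists>\<psi>. strict_pi j n (BAll (len_tm t) \<phi>) \<psi>"
proof (cases j)
  case 0
  then show ?thesis
    unfolding strict_pi_def using quantifier_free_sharp_all[OF strict_0(2)[OF \<phi>(1)] \<phi>(2,3) t] quantifier_free_strict T_PV_mono
    by (meson insert_mono weaken)
next
  case (Suc i)
  then show ?thesis using \<phi> t
    by (intro exI[of _ "BAll (len_tm t) \<phi>"])
       (auto simp: strict_pi_def equiv_strict_def intro: Assm sigma_b_pi_b.intros)
qed

lemma sigma_b_sharp_all_provable:
  assumes \<phi>: "sigma_b j \<phi>" "pv_fm \<phi>" "closed_fm (Suc n) \<phi>" and t: "pv_tm t" "closed_tm n t"
  shows "\<exists>\<psi>. strict_sigma j n (BAll (len_tm t) \<phi>) \<psi>"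
proof (cases j)
  case 0
  then show ?thesis
    unfolding strict_sigma_def using quantifier_free_sharp_all[OF strict_0(1)[OF \<phi>(1)] \<phi>(2,3) t] quantifier_free_strict T_PV_mono
    by (meson insert_mono weaken)
next
  case (Suc i)
  obtain B \<chi> where \<chi>: "pi_b i \<chi>" "pv_tm B" "closed_tm n B" "pv_fm \<chi>" "closed_fm (Suc n) \<chi>"
    and eq: "\<And>e. sat e (BEx B \<chi>) \<longleftrightarrow> sat e (BAll (len_tm t) \<phi>)"
    using sigma_b_sharp_all[OF fp_le fp_len, of i \<phi> n t] \<phi> t Suc by blast
  have strict: "sigma_b j (BEx B \<chi>)" using \<chi>(1) Suc by (auto intro: sigma_b_pi_b.intros)
  have "insert (BEx B \<chi>) (T_PV (Suc j)) \<turnstile> BAll (len_tm t) \<phi>"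
    unfolding BEx_def BAll_def
  proof (rule T_PV_Ex_imp_All)
    have "pi_b i (And (Le (Var 0) (shift_tm B)) \<chi>)"
      using \<chi>(1) quantifier_free_strict[of "Le (Var 0) (shift_tm B)" i]
      by (auto simp: Le_def intro: sigma_b_pi_b.intros)
    \<comment> \<open>The negated matrix is Sigma at level \<open>i\<close>, hence at level
      \<open>j\<close>; \<open>\<phi>\<close> has level \<open>j\<close> as well, so the prenexed
      implication does not exceed it.\<close>
    then show "sigma_b j (Neg (And (Le (Var 0) (shift_tm B)) \<chi>))"
      unfolding Suc by (rule sigma_b_pi_b.intros(3)[OF sigma_b_pi_b.intros(11)])
    show "sigma_b j (Or (Neg (Le (Var 0) (shift_tm (len_tm t)))) \<phi>)"
      using \<phi>(1) quantifier_free_strict[of "Neg (Le (Var 0) (shift_tm (len_tm t)))" j]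
      by (auto simp: Le_def intro: sigma_b_pi_b.intros)
    show "sat e (Ex (And (Le (Var 0) (shift_tm B)) \<chi>)) \<Longrightarrow>
        sat e (All (Or (Neg (Le (Var 0) (shift_tm (len_tm t)))) \<phi>))" for e
      using eq[of e] by (simp only: BEx_def BAll_def)
  qed (use \<chi> \<phi> t in auto)
  moreover have "insert (BAll (len_tm t) \<phi>) (T_PV (Suc (Suc j))) \<turnstile> BEx B \<chi>"
  proof (rule proves_imp[OF T_PV_imp])
    \<comment> \<open>In this direction the universal quantifier stands in front of a Sigma formula
      and is negated, which is what costs one level.\<close>
    have "pi_b (Suc j) (BAll (len_tm t) \<phi>)" using \<phi>(1) by (auto intro: sigma_b_pi_b.intros)
    then show "sigma_b (Suc j) (Or (Neg (BAll (len_tm t) \<phi>)) (BEx B \<chi>))"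
      using strict by (auto intro: sigma_b_pi_b.intros)
  qed (use \<chi> \<phi> t eq in auto)
  ultimately show ?thesis using strict \<chi> eq by (intro exI[of _ "BEx B \<chi>"]) (auto simp: strict_sigma_def equiv_strict_def)
qed

lemma pi_b_sharp_ex_provable:
  assumes \<phi>: "pi_b j \<phi>" "pv_fm \<phi>" "closed_fm (Suc n) \<phi>" and t: "pv_tm t" "closed_tm n t"
  shows "\<exists>\<psi>. strict_pi j n (BEx (len_tm t) \<phi>) \<psi>"
proof (cases j)
  case 0
  then show ?thesis
    unfolding strict_pi_def using quantifier_free_sharp_ex[OF strict_0(2)[OF \<phi>(1)] \<phi>(2,3) t] quantifier_free_strict T_PV_mono
    by (meson insert_mono weaken)
next
  case (Suc i)
  obtain B \<chi> where \<chi>: "sigma_b i \<chi>" "pv_tm B" "closed_tm n B" "pv_fm \<chi>" "closed_fm (Suc n) \<chi>"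
    and eq: "\<And>e. sat e (BAll B \<chi>) \<longleftrightarrow> sat e (BEx (len_tm t) \<phi>)"
    using pi_b_sharp_ex[OF fp_le fp_len, of i \<phi> n t] \<phi> t Suc by blast
  have strict: "pi_b j (BAll B \<chi>)" using \<chi>(1) Suc by (auto intro: sigma_b_pi_b.intros)
  have "insert (BEx (len_tm t) \<phi>) (T_PV (Suc j)) \<turnstile> BAll B \<chi>"
    unfolding BEx_def BAll_def
  proof (rule T_PV_Ex_imp_All)
    \<comment> \<open>The roles are exchanged: now the sharp quantifier is the existential premise,
      over a Pi formula of level \<open>j\<close>, and the strict form is the universal
      conclusion.\<close>
    have "pi_b j (And (Le (Var 0) (shift_tm (len_tm t))) \<phi>)"
      using \<phi>(1) quantifier_free_strict[of "Le (Var 0) (shift_tm (len_tm t))" j]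
      by (auto simp: Le_def intro: sigma_b_pi_b.intros)
    then show "sigma_b j (Neg (And (Le (Var 0) (shift_tm (len_tm t))) \<phi>))"
      by (rule sigma_b_pi_b.intros(11))
    show "sigma_b j (Or (Neg (Le (Var 0) (shift_tm B))) \<chi>)"
      using \<chi>(1) quantifier_free_strict[of "Neg (Le (Var 0) (shift_tm B))" i] Suc
      by (auto simp: Le_def intro: sigma_b_pi_b.intros)
    show "sat e (Ex (And (Le (Var 0) (shift_tm (len_tm t))) \<phi>)) \<Longrightarrow>
        sat e (All (Or (Neg (Le (Var 0) (shift_tm B))) \<chi>))" for e
      using eq[of e] by (simp only: BEx_def BAll_def)
  qed (use \<chi> \<phi> t in auto)
  moreover have "insert (BAll B \<chi>) (T_PV (Suc (Suc j))) \<turnstile> BEx (len_tm t) \<phi>"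
  proof (rule proves_imp[OF T_PV_imp])
    have "sigma_b (Suc j) (BEx (len_tm t) \<phi>)" using \<phi>(1) by (auto intro: sigma_b_pi_b.intros)
    then show "sigma_b (Suc j) (Or (Neg (BAll B \<chi>)) (BEx (len_tm t) \<phi>))"
      using strict by (auto intro: sigma_b_pi_b.intros)
  qed (use \<chi> \<phi> t eq in auto)
  ultimately show ?thesis using strict \<chi> eq by (intro exI[of _ "BAll B \<chi>"]) (auto simp: strict_pi_def equiv_strict_def)
qed

end

text \<open>Discharges the assumption on the ordering: its symbol occurs in the formula, so
  membership in the language makes the function polynomial-time.\<close>

lemma pv_LeD: "pv_fm (Le s t) \<Longrightarrow> fp 2 le_fun \<and> pv_tm s \<and> pv_tm t"
  by (simp add: Le_def pv_symbol_def poly_time_iff_fp)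

lemma pv_len_tmD: "pv_tm (len_tm t) \<Longrightarrow> fp 1 len_fun \<and> pv_tm t"
  by (simp add: len_tm_def pv_symbol_def poly_time_iff_fp)

lemma pv_boundedD:
  "pv_fm (BEx t \<phi>) \<Longrightarrow> fp 2 le_fun \<and> pv_tm t \<and> pv_fm \<phi>"
  "pv_fm (BAll t \<phi>) \<Longrightarrow> fp 2 le_fun \<and> pv_tm t \<and> pv_fm \<phi>"
  using pv_LeD[of "Var 0" "shift_tm t"] by (auto simp: BEx_def BAll_def)

lemma closed_bounded:
  "closed_fm n (BEx t \<phi>) \<longleftrightarrow> closed_tm n t \<and> closed_fm (Suc n) \<phi>"
  "closed_fm n (BAll t \<phi>) \<longleftrightarrow> closed_tm n t \<and> closed_fm (Suc n) \<phi>"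
  by (auto simp: BEx_def BAll_def Le_def)

lemma pv_bounded_cong:
  "pv_fm (BEx t \<phi>) \<Longrightarrow> pv_fm \<psi> \<Longrightarrow> pv_fm (BEx t \<psi>)"
  "pv_fm (BAll t \<phi>) \<Longrightarrow> pv_fm \<psi> \<Longrightarrow> pv_fm (BAll t \<psi>)"
  by (auto simp: BEx_def BAll_def)

lemma weaken_T_PV: "insert \<phi> (T_PV (Suc j)) \<turnstile> \<psi> \<Longrightarrow> insert \<phi> (T_PV (Suc (Suc j))) \<turnstile> \<psi>"
  by (erule weaken) (use T_PV_mono in auto)

section \<open>Strict forms of compound formulas\<close>

lemma strict_refl:
  "sigma_b j \<phi> \<Longrightarrow> pv_fm \<phi> \<Longrightarrow> closed_fm n \<phi> \<Longrightarrow> strict_sigma j n \<phi> \<phi>"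
  "pi_b j \<phi> \<Longrightarrow> pv_fm \<phi> \<Longrightarrow> closed_fm n \<phi> \<Longrightarrow> strict_pi j n \<phi> \<phi>"
  by (auto simp: strict_sigma_def strict_pi_def equiv_strict_def intro: Assm)

text \<open>In the two mixed cases the implications change their roles: the one that was provable
  only one level up becomes the one demanded at the new level of the formula. This is why both are
  recorded.\<close>

lemma strict_Suc:
  "strict_sigma j n \<phi> \<psi> \<Longrightarrow> strict_sigma (Suc j) n \<phi> \<psi>"
  "strict_pi j n \<phi> \<psi> \<Longrightarrow> strict_sigma (Suc j) n \<phi> \<psi>"
  "strict_sigma j n \<phi> \<psi> \<Longrightarrow> strict_pi (Suc j) n \<phi> \<psi>"
  "strict_pi j n \<phi> \<psi> \<Longrightarrow> strict_pi (Suc j) n \<phi> \<psi>"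
  unfolding strict_sigma_def strict_pi_def using weaken_T_PV sigma_b_pi_b.intros(3-6) by blast+

lemma strict_Neg:
  "pv_fm \<phi> \<Longrightarrow> strict_pi j n \<phi> \<psi> \<Longrightarrow> strict_sigma j n (Neg \<phi>) (Neg \<psi>)"
  "pv_fm \<phi> \<Longrightarrow> strict_sigma j n \<phi> \<psi> \<Longrightarrow> strict_pi j n (Neg \<phi>) (Neg \<psi>)"
  by (auto simp: strict_sigma_def strict_pi_def equiv_strict_def intro: Neg_mono sigma_b_pi_b.intros)

lemma strict_And:
  assumes "pv_fm \<phi>" "pv_fm \<phi>'"
  shows "strict_sigma j n \<phi> \<psi> \<Longrightarrow> strict_sigma j n \<phi>' \<psi>' \<Longrightarrow> strict_sigma j n (And \<phi> \<phi>') (And \<psi> \<psi>')"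
    and "strict_pi j n \<phi> \<psi> \<Longrightarrow> strict_pi j n \<phi>' \<psi>' \<Longrightarrow> strict_pi j n (And \<phi> \<phi>') (And \<psi> \<psi>')"
  using assms
  by (auto simp: strict_sigma_def strict_pi_def equiv_strict_def intro: And_mono sigma_b_pi_b.intros)

lemma strict_Or:
  assumes "pv_fm \<phi>" "pv_fm \<phi>'"
  shows "strict_sigma j n \<phi> \<psi> \<Longrightarrow> strict_sigma j n \<phi>' \<psi>' \<Longrightarrow> strict_sigma j n (Or \<phi> \<phi>') (Or \<psi> \<psi>')"
    and "strict_pi j n \<phi> \<psi> \<Longrightarrow> strict_pi j n \<phi>' \<psi>' \<Longrightarrow> strict_pi j n (Or \<phi> \<phi>') (Or \<psi> \<psi>')"
  using assms
  by (auto simp: strict_sigma_def strict_pi_def equiv_strict_def intro: Or_mono sigma_b_pi_b.intros)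

lemma strict_BEx_BAll:
  assumes "pv_fm \<phi>"
  shows "strict_sigma j (Suc n) \<phi> \<psi> \<Longrightarrow> pv_fm (BEx t \<phi>) \<Longrightarrow>
      insert (BEx t \<psi>) (T_PV (Suc j)) \<turnstile> BEx t \<phi> \<and> insert (BEx t \<phi>) (T_PV (Suc (Suc j))) \<turnstile> BEx t \<psi>"
    and "strict_sigma j (Suc n) \<phi> \<psi> \<Longrightarrow> pv_fm (BAll t \<phi>) \<Longrightarrow>
      insert (BAll t \<psi>) (T_PV (Suc j)) \<turnstile> BAll t \<phi> \<and> insert (BAll t \<phi>) (T_PV (Suc (Suc j))) \<turnstile> BAll t \<psi>"
    and "strict_pi j (Suc n) \<phi> \<psi> \<Longrightarrow> pv_fm (BEx t \<phi>) \<Longrightarrow>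
      insert (BEx t \<phi>) (T_PV (Suc j)) \<turnstile> BEx t \<psi> \<and> insert (BEx t \<psi>) (T_PV (Suc (Suc j))) \<turnstile> BEx t \<phi>"
    and "strict_pi j (Suc n) \<phi> \<psi> \<Longrightarrow> pv_fm (BAll t \<phi>) \<Longrightarrow>
      insert (BAll t \<phi>) (T_PV (Suc j)) \<turnstile> BAll t \<psi> \<and> insert (BAll t \<psi>) (T_PV (Suc (Suc j))) \<turnstile> BAll t \<phi>"
  using assms unfolding strict_sigma_def strict_pi_def equiv_strict_def
  by (meson BEx_mono[OF sentences_T_PV] BAll_mono[OF sentences_T_PV] pv_bounded_cong)+

lemma strict_trans:
  assumes "pv_fm \<psi>" "\<And>e. sat e \<psi> \<longleftrightarrow> sat e \<phi>"
  shows "strict_sigma j n \<psi> \<theta> \<Longrightarrow> insert \<psi> (T_PV (Suc j)) \<turnstile> \<phi> \<and> insert \<phi> (T_PV (Suc (Suc j))) \<turnstile> \<psi> \<Longrightarrow>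
      strict_sigma j n \<phi> \<theta>"
    and "strict_pi j n \<psi> \<theta> \<Longrightarrow> insert \<phi> (T_PV (Suc j)) \<turnstile> \<psi> \<and> insert \<psi> (T_PV (Suc (Suc j))) \<turnstile> \<phi> \<Longrightarrow>
      strict_pi j n \<phi> \<theta>"
  using assms proves_trans[OF _ assms(1)] by (auto simp: strict_sigma_def strict_pi_def equiv_strict_def)

lemma pv_sharpD:
  "pv_fm (BEx (len_tm t) \<phi>) \<Longrightarrow> fp 2 le_fun \<and> fp 1 len_fun \<and> pv_tm t \<and> pv_fm \<phi>"
  "pv_fm (BAll (len_tm t) \<phi>) \<Longrightarrow> fp 2 le_fun \<and> fp 1 len_fun \<and> pv_tm t \<and> pv_fm \<phi>"
  using pv_boundedD[of "len_tm t" \<phi>] pv_len_tmD[of t] by auto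

text \<open>Monotonicity replaces the body by its strict form \<open>\<psi>\<close> under the
  quantifier; the quantifier in front of \<open>\<psi>\<close> is then eliminated, and
  \<open>strict_trans\<close> chains the two passages.\<close>

lemma strict_sharp:
  assumes t: "closed_tm n (len_tm t)"
  shows "strict_sigma j (Suc n) \<phi> \<psi> \<Longrightarrow> pv_fm (BEx (len_tm t) \<phi>) \<Longrightarrow> \<exists>\<theta>. strict_sigma j n (BEx (len_tm t) \<phi>) \<theta>"
    and "strict_sigma j (Suc n) \<phi> \<psi> \<Longrightarrow> pv_fm (BAll (len_tm t) \<phi>) \<Longrightarrow> \<exists>\<theta>. strict_sigma j n (BAll (len_tm t) \<phi>) \<theta>"
    and "strict_pi j (Suc n) \<phi> \<psi> \<Longrightarrow> pv_fm (BEx (len_tm t) \<phi>) \<Longrightarrow> \<exists>\<theta>. strict_pi j n (BEx (len_tm t) \<phi>) \<theta>"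
    and "strict_pi j (Suc n) \<phi> \<psi> \<Longrightarrow> pv_fm (BAll (len_tm t) \<phi>) \<Longrightarrow> \<exists>\<theta>. strict_pi j n (BAll (len_tm t) \<phi>) \<theta>"
proof -
  have t': "closed_tm n t" using t by (simp add: len_tm_def)
  have sat: "sat e (BEx u \<psi>) \<longleftrightarrow> sat e (BEx u \<phi>)" "sat e (BAll u \<psi>) \<longleftrightarrow> sat e (BAll u \<phi>)"
    if "\<forall>e. sat e \<psi> \<longleftrightarrow> sat e \<phi>" for e u using that by (simp_all add: sat_BEx sat_BAll)
  {
    assume s: "strict_sigma j (Suc n) \<phi> \<psi>"
    then have \<psi>: "sigma_b j \<psi>" "pv_fm \<psi>" "closed_fm (Suc n) \<psi>" and eq: "\<forall>e. sat e \<psi> \<longleftrightarrow> sat e \<phi>"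
      by (simp_all add: strict_sigma_def equiv_strict_def)
    show "\<exists>\<theta>. strict_sigma j n (BEx (len_tm t) \<phi>) \<theta>" if pv: "pv_fm (BEx (len_tm t) \<phi>)"
      using sigma_b_sharp_ex_provable[OF _ _ \<psi> _ t'] pv_sharpD(1)[OF pv] strict_BEx_BAll(1)[OF _ s pv]
        strict_trans(1)[OF pv_bounded_cong(1)[OF pv \<psi>(2)] sat(1)[OF eq]] by blast
    show "\<exists>\<theta>. strict_sigma j n (BAll (len_tm t) \<phi>) \<theta>" if pv: "pv_fm (BAll (len_tm t) \<phi>)"
      using sigma_b_sharp_all_provable[OF _ _ \<psi> _ t'] pv_sharpD(2)[OF pv] strict_BEx_BAll(2)[OF _ s pv]
        strict_trans(1)[OF pv_bounded_cong(2)[OF pv \<psi>(2)] sat(2)[OF eq]] by blast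
  next
    assume s: "strict_pi j (Suc n) \<phi> \<psi>"
    then have \<psi>: "pi_b j \<psi>" "pv_fm \<psi>" "closed_fm (Suc n) \<psi>" and eq: "\<forall>e. sat e \<psi> \<longleftrightarrow> sat e \<phi>"
      by (simp_all add: strict_pi_def equiv_strict_def)
    show "\<exists>\<theta>. strict_pi j n (BEx (len_tm t) \<phi>) \<theta>" if pv: "pv_fm (BEx (len_tm t) \<phi>)"
      using pi_b_sharp_ex_provable[OF _ _ \<psi> _ t'] pv_sharpD(1)[OF pv] strict_BEx_BAll(3)[OF _ s pv]
        strict_trans(2)[OF pv_bounded_cong(1)[OF pv \<psi>(2)] sat(1)[OF eq]] by blast
    show "\<exists>\<theta>. strict_pi j n (BAll (len_tm t) \<phi>) \<theta>" if pv: "pv_fm (BAll (len_tm t) \<phi>)"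
      using pi_b_sharp_all_provable[OF _ _ \<psi> _ t'] pv_sharpD(2)[OF pv] strict_BEx_BAll(4)[OF _ s pv]
        strict_trans(2)[OF pv_bounded_cong(2)[OF pv \<psi>(2)] sat(2)[OF eq]] by blast
  }
qed

lemma sharp_strict:
  "sigma_b_sh j \<phi> \<Longrightarrow> pv_fm \<phi> \<Longrightarrow> closed_fm n \<phi> \<Longrightarrow> \<exists>\<psi>. strict_sigma j n \<phi> \<psi>"
  "pi_b_sh j \<phi> \<Longrightarrow> pv_fm \<phi> \<Longrightarrow> closed_fm n \<phi> \<Longrightarrow> \<exists>\<psi>. strict_pi j n \<phi> \<psi>"
proof (induction arbitrary: n and n rule: sigma_b_sh_pi_b_sh.inducts)
  case (1 \<phi>)
  then show ?case using strict_refl sigma_b_pi_b.intros(1) by blast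
next
  case (2 \<phi>)
  then show ?case using strict_refl sigma_b_pi_b.intros(2) by blast
next
  case (3 j \<phi>)
  then show ?case using strict_Suc by blast
next
  case (4 j \<phi>)
  then show ?case using strict_Suc by blast
next
  case (5 j \<phi>)
  then show ?case using strict_Suc by blast
next
  case (6 j \<phi>)
  then show ?case using strict_Suc by blast
next
  case (7 j \<phi> \<psi>)
  then show ?case using strict_And by (metis closed_fm.simps(3) pv_fm.simps(3))
next
  case (8 j \<phi> \<psi>)
  then show ?case using strict_Or by (metis closed_fm.simps(4) pv_fm.simps(4))
next
  case (9 j \<phi> \<psi>)
  then show ?case using strict_And by (metis closed_fm.simps(3) pv_fm.simps(3))
next
  case (10 j \<phi> \<psi>)
  then show ?case using strict_Or by (metis closed_fm.simps(4) pv_fm.simps(4))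
next
  case (11 j \<phi>)
  then show ?case using strict_Neg by (metis closed_fm.simps(2) pv_fm.simps(2))
next
  case (12 j \<phi>)
  then show ?case using strict_Neg by (metis closed_fm.simps(2) pv_fm.simps(2))
next
  case (13 j \<phi> t)
  then have pv: "pv_fm \<phi>" and cl: "closed_tm n t" "closed_fm (Suc n) \<phi>"
    using pv_boundedD(1) closed_bounded(1) by blast+
  from 13(2)[OF pv cl(2)] obtain \<psi> where \<psi>: "strict_sigma (Suc j) (Suc n) \<phi> \<psi>" ..
  \<comment> \<open>An ordinary bounded quantifier of the matching kind stays in place, because the
    strict class is closed under it.\<close>
  then have "strict_sigma (Suc j) n (BEx t \<phi>) (BEx t \<psi>)"
    using strict_BEx_BAll(1)[OF pv \<psi> 13(3)] pv_bounded_cong(1)[OF 13(3)] cl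
    by (auto simp: strict_sigma_def equiv_strict_def closed_bounded sat_BEx intro: sigma_b_pi_b.intros)
  then show ?case ..
next
  case (14 j \<phi> t)
  then have pv: "pv_fm \<phi>" and cl: "closed_tm n t" "closed_fm (Suc n) \<phi>"
    using pv_boundedD(2) closed_bounded(2) by blast+
  from 14(2)[OF pv cl(2)] obtain \<psi> where \<psi>: "strict_pi (Suc j) (Suc n) \<phi> \<psi>" ..
  then have "strict_pi (Suc j) n (BAll t \<phi>) (BAll t \<psi>)"
    using strict_BEx_BAll(4)[OF pv \<psi> 14(3)] pv_bounded_cong(2)[OF 14(3)] cl
    by (auto simp: strict_pi_def equiv_strict_def closed_bounded sat_BAll intro: sigma_b_pi_b.intros)
  then show ?case ..
next
  case (15 j \<phi> t)
  then show ?case using strict_sharp(1) pv_boundedD(1) closed_bounded(1) by blast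
next
  case (16 j \<phi> t)
  then show ?case using strict_sharp(2) pv_boundedD(2) closed_bounded(2) by blast
next
  case (17 j \<phi> t)
  then show ?case using strict_sharp(3) pv_boundedD(1) closed_bounded(1) by blast
next
  case (18 j \<phi> t)
  then show ?case using strict_sharp(4) pv_boundedD(2) closed_bounded(2) by blast
qed

theorem theoremA4:
  fixes i :: nat and \<phi> :: fm
  assumes "i \<ge> 1"
    and "forall_sentence (sigma_b_sh (i - 1)) \<phi>"
    and "true_in_nat \<phi>"
  shows "T_PV i \<turnstile> \<phi>"
proof -
  obtain j where i: "i = Suc j" using assms(1) by (cases i) auto
  obtain n \<psi> where \<psi>: "sigma_b_sh j \<psi>" "\<phi> = (All ^^ n) \<psi>" "pv_fm \<psi>" "closed_fm n \<psi>"
    using assms(2) by (auto simp: i forall_sentence_def pv_sentence_def)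
  obtain \<theta> where \<theta>: "sigma_b j \<theta>" "pv_fm \<theta>" "closed_fm n \<theta>" "\<And>e. sat e \<theta> \<longleftrightarrow> sat e \<psi>"
    and imp: "insert \<theta> (T_PV (Suc j)) \<turnstile> \<psi>"
    using sharp_strict(1)[OF \<psi>(1,3,4)] by (auto simp: strict_sigma_def equiv_strict_def)
  have "\<forall>e. sat e \<psi>" using assms(3) sat_All_pow[of n \<psi>] \<psi>(2) by (simp add: true_in_nat_def)
  then have "T_PV (Suc j) \<turnstile> \<theta>" using \<theta> by (intro T_PV_open) auto
  then have "T_PV (Suc j) \<turnstile> \<psi>" by (rule cut[OF _ \<theta>(2) imp])
  \<comment> \<open>The quantifier prefix is restored by generalisation, which is possible because
    the axioms are sentences.\<close>
  then show ?thesis unfolding i \<psi>(2) by (rule All_pow_intro[OF sentences_T_PV])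
qed

end
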